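(* Let $V$ be a superspace over $\mathbb{C}$ with $\dim V=(n,n)$ and let $k,p\ge0$. The inner products $$(v^*_t,v_s),\quad [v^*_t,v_s]\qquad (1\le t\le k,\ 1\le s\le p)$$ form a system of generators of the algebra of $\mathfrak{q}(V)$-invariants in $\mathfrak{A}^{p}_{k}$.
   Context: All superspaces are over $\mathbb{C}$; $\dim V=(n,n)$ means $\dim V_{\bar 0}=\dim V_{\bar 1}=n$. Let $U=\mathbb{C}^k$, $W=\mathbb{C}^p$ (purely even) and $$\mathfrak{A}^{p}_{k}=S^{\bullet}(V^{k}\oplus V^{*p})=S^{\bullet}(U\otimes V\oplus V^*\otimes W)$$ (symmetric algebra in the super sense), on which $\mathfrak{gl}(V)$ acts by superderivations. (Since $V\cong\Pi(V)$ as $\mathfrak q(V)$-modules, the algebra $S^{\bullet}(V^{k}\oplus\Pi(V)^{l}\oplus V^{*p}\oplus\Pi(V)^{*q})$ is isomorphic to $\mathfrak{A}^{p+q}_{k+l}$, so only this case need be considered.) Invariant means annihilated by the Lie superalgebra. Let $I=\{1,\dots,n,\bar1,\dots,\bar n\}$ (barred indices odd, unbarred even), $\{e_i\}_{i\in I}$ a homogeneous basis of $V$ with parities of the indices, $\{e^*_i\}$ the dual basis of $V^*$, $e_i^*(e_j)=\delta_{ij}$; $\{u_t\}$, $\{w_s\}$ bases of $U$, $W$; $x_{ti}=u_t\otimes e_i$, $x^*_{is}=e^*_i\otimes w_s$. $\mathfrak q(V)\subset\mathfrak{gl}(V)$ is the Lie superalgebra preserving the tensor $\sum_{i=1}^n(e_i\otimes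 e^*_{\bar i}+e_{\bar i}\otimes e^*_i)$. Finally $$(v^*_t,v_s)=\sum_{i\in I}x_{ti}x^*_{is},\qquad [v^*_t,v_s]=\sum_{i=1}^n\bigl(x_{ti}x^*_{\bar i s}+x_{t\bar i}x^*_{is}\bigr).$$ *)

theory Defs
  imports
    Complex_Main
    "HOL-Library.Poly_Mapping"
    "HOL-Algebra.QuotRing"
    "HOL-Algebra.Generated_Rings"
begin

section \<open>The superspace \<open>V\<close> of dimension \<open>(n,n)\<close> and \<open>gl(V)\<close>\<close>

text \<open>\<open>V\<close> is given by its homogeneous basis \<open>e\<^sub>i\<close>, \<open>i \<in> I\<close>.\<close>

datatype idx = Ev nat | Od nat

fun ipar :: "idx \<Rightarrow> nat" where
  "ipar (Ev i) = 0"
| "ipar (Od i) = 1"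

definition Idx :: "nat \<Rightarrow> idx set" where
  "Idx n = Ev ` {1..n} \<union> Od ` {1..n}"

text \<open>\<open>A \<in> gl(V)\<close> is its matrix: \<open>A e\<^sub>j = (\<Sum>i. A i j e\<^sub>i)\<close>.\<close>

type_synonym mat = "idx \<Rightarrow> idx \<Rightarrow> complex"

definition gl :: "nat \<Rightarrow> mat set" where
  "gl n = {A. \<forall>i j. i \<notin> Idx n \<or> j \<notin> Idx n \<longrightarrow> A i j = 0}"

definition hom_part :: "nat \<Rightarrow> mat \<Rightarrow> mat" where
  "hom_part \<pi> A = (\<lambda>i j. if (ipar i + ipar j) mod 2 = \<pi> then A i j else 0)"


section \<open>The tensor algebra of \<open>U \<otimes> V \<oplus> V\<^sup>* \<otimes> W\<close>\<close>

text \<open>\<open>Vec t i\<close> stands for \<open>u\<^sub>t \<otimes> e\<^sub>i\<close> and \<open>Dual i s\<close> for \<open>e\<^sub>i\<^sup>* \<otimes> w\<^sub>s\<close>; both have the parity of \<open>i\<close>.\<close>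

datatype gen = Vec nat idx | Dual idx nat

fun gpar :: "gen \<Rightarrow> nat" where
  "gpar (Vec t i) = ipar i"
| "gpar (Dual i s) = ipar i"

definition gens :: "nat \<Rightarrow> nat \<Rightarrow> nat \<Rightarrow> gen set" where
  "gens n k p = {Vec t i | t i. t \<in> {1..k} \<and> i \<in> Idx n} \<union> {Dual i s | i s. i \<in> Idx n \<and> s \<in> {1..p}}"

text \<open>With concatenation of words as addition of exponents, \<open>gen list \<Rightarrow>\<^sub>0 complex\<close> is the free
  associative algebra on \<open>gen\<close>.\<close>

instantiation list :: (type) monoid_add
begin
definition zero_list :: "'a list" where "zero_list = []"
definition plus_list :: "'a list \<Rightarrow> 'a list \<Rightarrow> 'a list" where "plus_list = (@)"
instance by standard (simp_all add: zero_list_def plus_list_def)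
end

type_synonym tensor = "gen list \<Rightarrow>\<^sub>0 complex"

definition tconst :: "complex \<Rightarrow> tensor" where
  "tconst c = Poly_Mapping.single [] c"

definition tword :: "gen list \<Rightarrow> tensor" where
  "tword w = Poly_Mapping.single w 1"

definition tensor_ring :: "nat \<Rightarrow> nat \<Rightarrow> nat \<Rightarrow> tensor ring" where
  "tensor_ring n k p =
    \<lparr>carrier = {f. Poly_Mapping.keys f \<subseteq> lists (gens n k p)},
     mult = (*), one = 1, zero = 0, add = (+)\<rparr>"

text \<open>
  Action of a homogeneous \<open>A\<close> of parity \<open>\<pi>\<close> by superderivations. On \<open>V\<^sup>*\<close> it is
  \<open>(A \<phi>)(v) = - (-1)\<^bsup>|A||\<phi>|\<^esup> \<phi>(A v)\<close>, so \<open>A e\<^sub>i\<^sup>* = - (-1)\<^bsup>|A||i|\<^esup> (\<Sum>j. A i j e\<^sub>j\<^sup>*)\<close>.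
\<close>

fun gen_act :: "nat \<Rightarrow> nat \<Rightarrow> mat \<Rightarrow> gen \<Rightarrow> tensor" where
  "gen_act n \<pi> A (Vec t j) = (\<Sum>i\<in>Idx n. tconst (A i j) * tword [Vec t i])"
| "gen_act n \<pi> A (Dual i s) = (\<Sum>j\<in>Idx n. tconst (- ((-1) ^ (\<pi> * ipar i)) * A i j) * tword [Dual j s])"

fun word_act :: "nat \<Rightarrow> nat \<Rightarrow> mat \<Rightarrow> gen list \<Rightarrow> tensor" where
  "word_act n \<pi> A [] = 0"
| "word_act n \<pi> A (g # w) =
     gen_act n \<pi> A g * tword w + tconst ((-1) ^ (\<pi> * gpar g)) * tword [g] * word_act n \<pi> A w"

definition hom_act :: "nat \<Rightarrow> nat \<Rightarrow> mat \<Rightarrow> tensor \<Rightarrow> tensor" where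
  "hom_act n \<pi> A f = (\<Sum>w\<in>Poly_Mapping.keys f. tconst (Poly_Mapping.lookup f w) * word_act n \<pi> A w)"

definition tensor_act :: "nat \<Rightarrow> mat \<Rightarrow> tensor \<Rightarrow> tensor" where
  "tensor_act n A f = hom_act n 0 (hom_part 0 A) f + hom_act n 1 (hom_part 1 A) f"


section \<open>The Lie superalgebra \<open>q(V)\<close>\<close>

definition even_tensor :: "nat \<Rightarrow> nat \<Rightarrow> nat \<Rightarrow> tensor" where
  "even_tensor n t s = (\<Sum>i\<in>Idx n. tword [Vec t i] * tword [Dual i s])"

definition odd_tensor :: "nat \<Rightarrow> nat \<Rightarrow> nat \<Rightarrow> tensor" where
  "odd_tensor n t s =
    (\<Sum>i\<in>{1..n}. tword [Vec t (Ev i)] * tword [Dual (Od i) s] + tword [Vec t (Od i)] * tword [Dual (Ev i) s])"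

text \<open>For \<open>k = p = 1\<close> the words \<open>Vec 1 i, Dual j 1\<close> form the basis \<open>e\<^sub>i \<otimes> e\<^sub>j\<^sup>*\<close> of \<open>V \<otimes> V\<^sup>*\<close>
  inside the tensor algebra of \<open>V \<oplus> V\<^sup>*\<close>. No relation has been imposed at this point, so
  \<open>odd_tensor n 1 1\<close> is the tensor \<open>(\<Sum>i. e\<^sub>i \<otimes> e\<^sub>i'\<^sup>* + e\<^sub>i' \<otimes> e\<^sub>i\<^sup>*)\<close>, with \<open>i'\<close> the odd
  partner of \<open>i\<close>, as an element of \<open>V \<otimes> V\<^sup>*\<close>.\<close>

definition q_alg :: "nat \<Rightarrow> mat set" where
  "q_alg n = {A \<in> gl n. tensor_act n A (odd_tensor n 1 1) = 0}"


section \<open>The symmetric superalgebra and its invariants\<close>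

definition super_ideal :: "nat \<Rightarrow> nat \<Rightarrow> nat \<Rightarrow> tensor set" where
  "super_ideal n k p =
    genideal (tensor_ring n k p)
      {tword [x] * tword [y] - tconst ((-1) ^ (gpar x * gpar y)) * tword [y] * tword [x] | x y.
        x \<in> gens n k p \<and> y \<in> gens n k p}"

definition sym_alg :: "nat \<Rightarrow> nat \<Rightarrow> nat \<Rightarrow> tensor set ring" where
  "sym_alg n k p = tensor_ring n k p Quot super_ideal n k p"

definition proj :: "nat \<Rightarrow> nat \<Rightarrow> nat \<Rightarrow> tensor \<Rightarrow> tensor set" where
  "proj n k p f = super_ideal n k p +>\<^bsub>tensor_ring n k p\<^esub> f"

definition sym_act :: "nat \<Rightarrow> nat \<Rightarrow> nat \<Rightarrow> mat \<Rightarrow> tensor set \<Rightarrow> tensor set" where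
  "sym_act n k p A F = (\<Union>f\<in>F. proj n k p (tensor_act n A f))"

definition q_invariants :: "nat \<Rightarrow> nat \<Rightarrow> nat \<Rightarrow> tensor set set" where
  "q_invariants n k p =
    {F \<in> carrier (sym_alg n k p). \<forall>A\<in>q_alg n. sym_act n k p A F = \<zero>\<^bsub>sym_alg n k p\<^esub>}"

definition even_inner :: "nat \<Rightarrow> nat \<Rightarrow> nat \<Rightarrow> nat \<Rightarrow> nat \<Rightarrow> tensor set" where
  "even_inner n k p t s = proj n k p (even_tensor n t s)"

definition odd_inner :: "nat \<Rightarrow> nat \<Rightarrow> nat \<Rightarrow> nat \<Rightarrow> nat \<Rightarrow> tensor set" where
  "odd_inner n k p t s = proj n k p (odd_tensor n t s)"

text \<open>The complex subalgebra generated by a set is the subring generated by it and the scalars.\<close>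

definition generated_subalgebra :: "nat \<Rightarrow> nat \<Rightarrow> nat \<Rightarrow> tensor set set \<Rightarrow> tensor set set" where
  "generated_subalgebra n k p S =
    generate_ring (sym_alg n k p) (range (\<lambda>c. proj n k p (tconst c)) \<union> S)"


section \<open>Well-definedness\<close>

lemma finite_Idx [simp]: "finite (Idx n)"
  by (simp add: Idx_def)

lemma tconst_0 [simp]: "tconst 0 = 0"
  by (simp add: tconst_def)

lemma tconst_1 [simp]: "tconst 1 = 1"
  by (simp add: tconst_def zero_list_def [symmetric])

lemma tword_Nil: "tword [] = 1"
  by (simp add: tword_def zero_list_def [symmetric])

lemma tword_append: "tword (u @ v) = tword u * tword v"
  by (simp add: tword_def mult_single plus_list_def)

lemma tconst_add: "tconst (a + b) = tconst a + tconst b"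
  by (simp add: tconst_def single_add)

lemma tconst_mult: "tconst (a * b) = tconst a * tconst b"
  by (simp add: tconst_def mult_single plus_list_def)

lemma single_eq: "Poly_Mapping.single w c = tconst c * tword w"
  by (simp add: tconst_def tword_def mult_single plus_list_def)

lemma tensor_expand: "f = (\<Sum>w\<in>Poly_Mapping.keys f. Poly_Mapping.single w (Poly_Mapping.lookup f w))"
  by (rule poly_mapping_eqI) (simp add: lookup_sum lookup_single when_def in_keys_iff)

lemma tensor_induct [case_names zero single add]:
  assumes "P 0" "\<And>w c. P (Poly_Mapping.single w c)" "\<And>f g. P f \<Longrightarrow> P g \<Longrightarrow> P (f + g)"
  shows "P (f :: tensor)"
proof -
  have "P (\<Sum>w\<in>S. Poly_Mapping.single w (Poly_Mapping.lookup f w))" if "finite S" for S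
    using that by induction (auto intro: assms)
  then show ?thesis using tensor_expand [of f] finite_keys [of f] by metis
qed

lemma tconst_commute: "f * tconst c = tconst c * f"
proof (induction f rule: tensor_induct)
  case (single w a)
  show ?case by (simp add: tconst_def mult_single plus_list_def mult.commute)
next
  case (add f g)
  then show ?case by (simp add: algebra_simps)
qed simp

lemma tensor_ring_simps [simp]:
  "mult (tensor_ring n k p) = (*)" "one (tensor_ring n k p) = 1"
  "zero (tensor_ring n k p) = 0" "add (tensor_ring n k p) = (+)"
  by (simp_all add: tensor_ring_def)

lemma tensor_ring_mult_closed:
  assumes "f \<in> carrier (tensor_ring n k p)" "g \<in> carrier (tensor_ring n k p)"
  shows "f * g \<in> carrier (tensor_ring n k p)"
proof -
  have "Poly_Mapping.keys (f * g) \<subseteq> {a + b | a b. a \<in> Poly_Mapping.keys f \<and> b \<in> Poly_Mapping.keys g}"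
    by (rule keys_mult)
  with assms show ?thesis
    by (fastforce simp: tensor_ring_def plus_list_def)
qed

lemma tensor_ring_add_closed:
  assumes "f \<in> carrier (tensor_ring n k p)" "g \<in> carrier (tensor_ring n k p)"
  shows "f + g \<in> carrier (tensor_ring n k p)"
  using assms Poly_Mapping.keys_add[of f g] by (auto simp: tensor_ring_def)

lemma tconst_carrier [simp]: "tconst c \<in> carrier (tensor_ring n k p)"
  by (simp add: tensor_ring_def tconst_def)

lemma tword_carrier: "set w \<subseteq> gens n k p \<Longrightarrow> tword w \<in> carrier (tensor_ring n k p)"
  by (auto simp add: tensor_ring_def tword_def)

lemma ring_tensor_ring: "ring (tensor_ring n k p)"
proof (rule ringI)
  show "abelian_group (tensor_ring n k p)"
  proof (rule abelian_groupI)
    fix f assume "f \<in> carrier (tensor_ring n k p)"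
    then have "- f \<in> carrier (tensor_ring n k p)" by (simp add: tensor_ring_def)
    then show "\<exists>g\<in>carrier (tensor_ring n k p). g \<oplus>\<^bsub>tensor_ring n k p\<^esub> f = \<zero>\<^bsub>tensor_ring n k p\<^esub>"
      by (intro bexI [of _ "- f"]) simp_all
  qed (simp_all add: tensor_ring_add_closed algebra_simps, simp add: tensor_ring_def)
  show "Group.monoid (tensor_ring n k p)"
    using tconst_carrier [of 1]
    by (intro monoidI) (simp_all add: tensor_ring_mult_closed algebra_simps)
qed (simp_all add: algebra_simps)

interpretation tensor: ring "tensor_ring n k p" for n k p
  by (rule ring_tensor_ring)

lemma tensor_minus:
  assumes "g \<in> carrier (tensor_ring n k p)"
  shows "f \<ominus>\<^bsub>tensor_ring n k p\<^esub> g = f - g"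
proof -
  have "- g \<in> carrier (tensor_ring n k p)" using assms by (simp add: tensor_ring_def)
  then have "\<ominus>\<^bsub>tensor_ring n k p\<^esub> g = - g"
    using assms by (intro tensor.minus_equality) simp_all
  then show ?thesis by (simp add: a_minus_def)
qed

lemma relators_carrier:
  "{tword [x] * tword [y] - tconst ((-1) ^ (gpar x * gpar y)) * tword [y] * tword [x] | x y.
     x \<in> gens n k p \<and> y \<in> gens n k p} \<subseteq> carrier (tensor_ring n k p)"
proof clarify
  fix x y assume "x \<in> gens n k p" "y \<in> gens n k p"
  then have "tword [x] \<in> carrier (tensor_ring n k p)" "tword [y] \<in> carrier (tensor_ring n k p)"
    by (simp_all add: tword_carrier)
  then show "tword [x] * tword [y] - tconst ((-1) ^ (gpar x * gpar y)) * tword [y] * tword [x]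
      \<in> carrier (tensor_ring n k p)"
    using tensor.minus_closed [of "tword [x] * tword [y]" n k p] 
    by (metis tensor_minus tensor_ring_mult_closed tconst_carrier)
qed

lemma ideal_super_ideal: "ideal (super_ideal n k p) (tensor_ring n k p)"
  unfolding super_ideal_def by (rule tensor.genideal_ideal [OF relators_carrier])

lemma ring_sym_alg: "ring (sym_alg n k p)"
  unfolding sym_alg_def by (rule ideal.quotient_is_ring [OF ideal_super_ideal])


text \<open>\<open>hom_act\<close> is a superderivation: it satisfies the Leibniz rule twisted by the powers of the
  parity automorphism \<open>par_aut\<close>.\<close>

definition wpar :: "gen list \<Rightarrow> nat" where
  "wpar w = (\<Sum>g\<leftarrow>w. gpar g)"

definition par_aut :: "nat \<Rightarrow> tensor \<Rightarrow> tensor" where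
  "par_aut \<pi> f = (\<Sum>w\<in>Poly_Mapping.keys f.
     tconst (Poly_Mapping.lookup f w) * (tconst ((-1) ^ (\<pi> * wpar w)) * tword w))"

lemma linear_extension_single:
  "(\<Sum>v\<in>Poly_Mapping.keys (Poly_Mapping.single w c).
    tconst (Poly_Mapping.lookup (Poly_Mapping.single w c) v) * h v) = tconst c * h w"
  by (cases "c = 0") auto

lemma linear_extension_add:
  fixes f g :: tensor
  shows "(\<Sum>w\<in>Poly_Mapping.keys (f + g). tconst (Poly_Mapping.lookup (f + g) w) * h w) =
    (\<Sum>w\<in>Poly_Mapping.keys f. tconst (Poly_Mapping.lookup f w) * h w) +
    (\<Sum>w\<in>Poly_Mapping.keys g. tconst (Poly_Mapping.lookup g w) * h w)"
proof -
  let ?S = "Poly_Mapping.keys f \<union> Poly_Mapping.keys g"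
  have *: "(\<Sum>w\<in>Poly_Mapping.keys e. tconst (Poly_Mapping.lookup e w) * h w) =
      (\<Sum>w\<in>?S. tconst (Poly_Mapping.lookup e w) * h w)" if "Poly_Mapping.keys e \<subseteq> ?S" for e
    using that by (intro sum.mono_neutral_left) (auto simp: in_keys_iff)
  show ?thesis
    using * [of "f + g"] * [of f] * [of g] Poly_Mapping.keys_add [of f g]
    by (simp add: lookup_add tconst_add algebra_simps sum.distrib)
qed

lemma hom_act_add: "hom_act n \<pi> A (f + g) = hom_act n \<pi> A f + hom_act n \<pi> A g"
  unfolding hom_act_def by (rule linear_extension_add)

lemma hom_act_single: "hom_act n \<pi> A (Poly_Mapping.single w c) = tconst c * word_act n \<pi> A w"
  unfolding hom_act_def by (rule linear_extension_single)

lemma par_aut_add: "par_aut \<pi> (f + g) = par_aut \<pi> f + par_aut \<pi> g"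
  unfolding par_aut_def by (rule linear_extension_add)

lemma par_aut_single:
  "par_aut \<pi> (Poly_Mapping.single w c) = tconst c * (tconst ((-1) ^ (\<pi> * wpar w)) * tword w)"
  unfolding par_aut_def by (rule linear_extension_single)

lemma word_act_append:
  "word_act n \<pi> A (u @ v) =
     word_act n \<pi> A u * tword v + tconst ((-1) ^ (\<pi> * wpar u)) * tword u * word_act n \<pi> A v"
proof (induction u)
  case Nil
  then show ?case by (simp add: wpar_def tword_Nil)
next
  case (Cons g u)
  have "tword (g # u) = tword [g] * tword u" using tword_append [of "[g]" u] by simp
  moreover have "tword [g] * tconst c = tconst c * tword [g]" for c by (rule tconst_commute)
  then have "tword [g] * (tconst c * h) = tconst c * (tword [g] * h)" for c h
    by (simp add: mult.assoc [symmetric])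
  ultimately show ?case
    using Cons by (simp add: wpar_def tword_append power_add tconst_mult algebra_simps)
qed

lemma tconst_commute': "f * (tconst c * g) = tconst c * (f * g)"
  by (metis tconst_commute mult.assoc)

lemma tconst_fold: "tconst a * (tconst b * f) = tconst (a * b) * f"
  by (simp add: tconst_mult mult.assoc)

lemma hom_act_0 [simp]: "hom_act n \<pi> A 0 = 0" and par_aut_0 [simp]: "par_aut \<pi> 0 = 0"
  by (simp_all add: hom_act_def par_aut_def)

lemma single_mult:
  "(Poly_Mapping.single u a :: tensor) * Poly_Mapping.single v b = Poly_Mapping.single (u @ v) (a * b)"
  by (simp add: mult_single plus_list_def)

lemma hom_act_mult:
  "hom_act n \<pi> A (f * g) = hom_act n \<pi> A f * g + par_aut \<pi> f * hom_act n \<pi> A g"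
proof (induction f rule: tensor_induct)
  case (single u a)
  show ?case
  proof (induction g rule: tensor_induct)
    case (single v b)
    have b: "Poly_Mapping.single v b = tconst b * tword v" by (rule single_eq)
    have "hom_act n \<pi> A (Poly_Mapping.single u a) * Poly_Mapping.single v b =
        tconst (a * b) * (word_act n \<pi> A u * tword v)"
      unfolding b by (simp add: hom_act_single tconst_fold mult.assoc
          tconst_commute' [of "word_act _ _ _ _"])
    then show ?case
      by (simp add: single_mult hom_act_single par_aut_single word_act_append
          tconst_fold tconst_mult [symmetric] tword_append algebra_simps tconst_commute' [of "tword _"] tconst_commute' [of "word_act _ _ _ _"])
  qed (simp_all add: hom_act_add algebra_simps)
qed (simp_all add: hom_act_add par_aut_add algebra_simps)

lemma par_aut_mult: "par_aut \<pi> (f * g) = par_aut \<pi> f * par_aut \<pi> g"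
proof (induction f rule: tensor_induct)
  case (single u a)
  show ?case
  proof (induction g rule: tensor_induct)
    case (single v b)
    show ?case
      by (simp add: single_mult par_aut_single wpar_def tword_append
          power_add tconst_fold tconst_mult [symmetric] algebra_simps tconst_commute' [of "tword _"] tconst_commute' [of "word_act _ _ _ _"])
  qed (simp_all add: par_aut_add algebra_simps)
qed (simp_all add: par_aut_add algebra_simps)

lemma super_ideal_carrier: "f \<in> super_ideal n k p \<Longrightarrow> f \<in> carrier (tensor_ring n k p)"
  by (rule ideal.Icarr [OF ideal_super_ideal])

lemma super_ideal_0 [simp]: "0 \<in> super_ideal n k p"
  using additive_subgroup.zero_closed [OF ideal.axioms(1) [OF ideal_super_ideal [of n k p]]] by simp

lemma super_ideal_add:
  "f \<in> super_ideal n k p \<Longrightarrow> g \<in> super_ideal n k p \<Longrightarrow> f + g \<in> super_ideal n k p"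
  using additive_subgroup.a_closed [OF ideal.axioms(1) [OF ideal_super_ideal [of n k p]]] by simp

lemma super_ideal_lmult:
  "f \<in> super_ideal n k p \<Longrightarrow> g \<in> carrier (tensor_ring n k p) \<Longrightarrow> g * f \<in> super_ideal n k p"
  using ideal.I_l_closed [OF ideal_super_ideal [of n k p]] by simp

lemma super_ideal_rmult:
  "f \<in> super_ideal n k p \<Longrightarrow> g \<in> carrier (tensor_ring n k p) \<Longrightarrow> f * g \<in> super_ideal n k p"
  using ideal.I_r_closed [OF ideal_super_ideal [of n k p]] by simp

lemma super_ideal_smult: "f \<in> super_ideal n k p \<Longrightarrow> tconst c * f \<in> super_ideal n k p"
  by (simp add: super_ideal_lmult)

lemma tconst_minus: "tconst (- c) = - tconst c"
  by (simp add: tconst_def single_uminus)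

lemma super_ideal_minus: "f \<in> super_ideal n k p \<Longrightarrow> - f \<in> super_ideal n k p"
  using super_ideal_smult [of f n k p "-1"] by (simp add: tconst_minus)

lemma super_ideal_sum:
  "(\<And>i. i \<in> S \<Longrightarrow> f i \<in> super_ideal n k p) \<Longrightarrow> (\<Sum>i\<in>S. f i) \<in> super_ideal n k p"
  by (induction S rule: infinite_finite_induct) (auto intro: super_ideal_add)

lemma super_ideal_relator:
  assumes "x \<in> gens n k p" "y \<in> gens n k p"
  shows "tword [x] * tword [y] - tconst ((-1) ^ (gpar x * gpar y)) * tword [y] * tword [x]
    \<in> super_ideal n k p"
  unfolding super_ideal_def
  by (rule subsetD [OF tensor.genideal_self [OF relators_carrier]]) (use assms in blast)

lemma gen_act_expand:
  assumes "x \<in> gens n k p"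
    and A: "\<And>i j. A i j \<noteq> 0 \<Longrightarrow> (ipar i + ipar j) mod 2 = \<pi>"
  obtains c h where "gen_act n \<pi> A x = (\<Sum>i\<in>Idx n. tconst (c i) * tword [h i])"
    and "\<And>i. i \<in> Idx n \<Longrightarrow> h i \<in> gens n k p"
    and "\<And>i. c i \<noteq> 0 \<Longrightarrow> (gpar (h i) + gpar x) mod 2 = \<pi>"
proof (cases x)
  case (Vec t j)
  with assms show ?thesis by (intro that [of "\<lambda>i. A i j" "Vec t"]) (auto simp: gens_def)
next
  case (Dual i s)
  with assms show ?thesis
    by (intro that [of "\<lambda>j. - ((-1) ^ (\<pi> * ipar i)) * A i j" "\<lambda>j. Dual j s"])
      (auto simp: gens_def, metis add.commute)
qed

lemma zero_carrier [simp]: "0 \<in> carrier (tensor_ring n k p)"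
  by (simp add: tensor_ring_def)

lemma tensor_ring_sum_closed:
  "(\<And>i. i \<in> S \<Longrightarrow> f i \<in> carrier (tensor_ring n k p)) \<Longrightarrow>
    (\<Sum>i\<in>S. f i) \<in> carrier (tensor_ring n k p)"
  by (induction S rule: infinite_finite_induct)
    (auto intro: tensor_ring_add_closed)

lemma gen_act_carrier: "x \<in> gens n k p \<Longrightarrow> gen_act n \<pi> A x \<in> carrier (tensor_ring n k p)"
  by (cases x; simp, intro tensor_ring_sum_closed tensor_ring_mult_closed tconst_carrier tword_carrier)
    (auto simp: gens_def)

lemma word_act_carrier: "set w \<subseteq> gens n k p \<Longrightarrow> word_act n \<pi> A w \<in> carrier (tensor_ring n k p)"
  by (induction w)
    (auto intro!: tensor_ring_add_closed tensor_ring_mult_closed gen_act_carrier tword_carrier)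

lemma hom_act_carrier:
  "f \<in> carrier (tensor_ring n k p) \<Longrightarrow> hom_act n \<pi> A f \<in> carrier (tensor_ring n k p)"
  unfolding hom_act_def
  by (intro tensor_ring_sum_closed tensor_ring_mult_closed tconst_carrier word_act_carrier)
    (auto simp: tensor_ring_def)

lemma par_aut_carrier:
  "f \<in> carrier (tensor_ring n k p) \<Longrightarrow> par_aut \<pi> f \<in> carrier (tensor_ring n k p)"
  unfolding par_aut_def
  by (intro tensor_ring_sum_closed tensor_ring_mult_closed tconst_carrier tword_carrier)
    (auto simp: tensor_ring_def)

lemma gen_act_supercommute:
  assumes "x \<in> gens n k p" "y \<in> gens n k p"
    and A: "\<And>i j. A i j \<noteq> 0 \<Longrightarrow> (ipar i + ipar j) mod 2 = \<pi>"
  shows "gen_act n \<pi> A x * tword [y] -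
      tconst ((-1) ^ ((\<pi> + gpar x) * gpar y)) * tword [y] * gen_act n \<pi> A x \<in> super_ideal n k p"
proof -
  from gen_act_expand [of x n k p A \<pi>, OF assms(1) A] obtain c h where
    e: "gen_act n \<pi> A x = (\<Sum>i\<in>Idx n. tconst (c i) * tword [h i])" and
    h: "\<And>i. i \<in> Idx n \<Longrightarrow> h i \<in> gens n k p" and
    c: "\<And>i. c i \<noteq> 0 \<Longrightarrow> (gpar (h i) + gpar x) mod 2 = \<pi>"
    by blast
  let ?\<sigma> = "(-1) ^ ((\<pi> + gpar x) * gpar y) :: complex"
  have "gen_act n \<pi> A x * tword [y] - tconst ?\<sigma> * tword [y] * gen_act n \<pi> A x =
      (\<Sum>i\<in>Idx n. tconst (c i) * (tword [h i] * tword [y] - tconst ?\<sigma> * tword [y] * tword [h i]))"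
    unfolding e
    unfolding sum_distrib_left sum_distrib_right sum_subtractf [symmetric] mult.assoc
      right_diff_distrib tconst_fold tconst_commute' [of "tword _"]
    by (intro sum.cong refl arg_cong2 [where f = minus]) (simp add: mult.commute)
  also have "\<dots> = (\<Sum>i\<in>Idx n. tconst (c i) *
      (tword [h i] * tword [y] - tconst ((-1) ^ (gpar (h i) * gpar y)) * tword [y] * tword [h i]))"
  proof (rule sum.cong [OF refl])
    fix i
    show "tconst (c i) * (tword [h i] * tword [y] - tconst ?\<sigma> * tword [y] * tword [h i]) =
      tconst (c i) *
        (tword [h i] * tword [y] - tconst ((-1) ^ (gpar (h i) * gpar y)) * tword [y] * tword [h i])"
    proof (cases "c i = 0")
      case False
      then have "even (\<pi> + gpar x) \<longleftrightarrow> even (gpar (h i))" using c [of i] by presburger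
      then have "?\<sigma> = (-1) ^ (gpar (h i) * gpar y)"
        by (simp only: minus_one_power_iff even_mult_iff)
      then show ?thesis by simp
    qed simp
  qed
  also have "\<dots> \<in> super_ideal n k p"
    by (intro super_ideal_sum super_ideal_smult super_ideal_relator h assms(2))
  finally show ?thesis .
qed

lemma hom_act_word: "hom_act n \<pi> A (tword w) = word_act n \<pi> A w"
  by (simp add: tword_def hom_act_single)

lemma par_aut_word: "par_aut \<pi> (tword w) = tconst ((-1) ^ (\<pi> * wpar w)) * tword w"
  by (simp add: tword_def par_aut_single)

lemma hom_act_tconst [simp]: "hom_act n \<pi> A (tconst c) = 0"
  by (simp add: tconst_def hom_act_single)

lemma par_aut_tconst [simp]: "par_aut \<pi> (tconst c) = tconst c"
  by (simp add: tconst_def par_aut_single) (simp add: tconst_def wpar_def tword_def single_mult)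

lemma hom_act_smult: "hom_act n \<pi> A (tconst c * f) = tconst c * hom_act n \<pi> A f"
  by (simp add: hom_act_mult)

lemma par_aut_smult: "par_aut \<pi> (tconst c * f) = tconst c * par_aut \<pi> f"
  by (simp add: par_aut_mult)

lemma hom_act_minus: "hom_act n \<pi> A (- f) = - hom_act n \<pi> A f"
  using hom_act_add [of n \<pi> A "- f" f] by (simp add: eq_neg_iff_add_eq_0)

lemma par_aut_minus: "par_aut \<pi> (- f) = - par_aut \<pi> f"
  using par_aut_add [of \<pi> "- f" f] by (simp add: eq_neg_iff_add_eq_0)

lemma hom_act_relator:
  assumes "x \<in> gens n k p" "y \<in> gens n k p"
    and A: "\<And>i j. A i j \<noteq> 0 \<Longrightarrow> (ipar i + ipar j) mod 2 = \<pi>"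
  shows "hom_act n \<pi> A (tword [x] * tword [y] -
      tconst ((-1) ^ (gpar x * gpar y)) * tword [y] * tword [x]) \<in> super_ideal n k p"
proof -
  let ?D = "gen_act n \<pi> A" and ?\<sigma> = "(-1) ^ (gpar x * gpar y) :: complex"
  define P where "P = ?D x * tword [y] - tconst ((-1) ^ ((\<pi> + gpar x) * gpar y)) * tword [y] * ?D x"
  define Q where "Q = ?D y * tword [x] - tconst ((-1) ^ ((\<pi> + gpar y) * gpar x)) * tword [x] * ?D y"
  have PQ: "P \<in> super_ideal n k p" "Q \<in> super_ideal n k p"
    unfolding P_def Q_def by (intro gen_act_supercommute assms; assumption)+
  have w: "word_act n \<pi> A [z] = ?D z" "wpar [z] = gpar z" for z
    by (simp_all add: tword_Nil wpar_def)
  have s1: "?\<sigma> * (-1) ^ (\<pi> * gpar y) = (-1) ^ ((\<pi> + gpar x) * gpar y)"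
    by (simp add: power_add [symmetric] algebra_simps)
  have s2: "?\<sigma> * (-1) ^ ((\<pi> + gpar y) * gpar x) = (-1) ^ (\<pi> * gpar x)"
    by (simp add: power_add algebra_simps flip: power_mult_distrib)
  have "hom_act n \<pi> A (tword [x] * tword [y] - tconst ?\<sigma> * tword [y] * tword [x]) =
      ?D x * tword [y] + tconst ((-1) ^ (\<pi> * gpar x)) * (tword [x] * ?D y)
      - (tconst ?\<sigma> * (?D y * tword [x]) +
         tconst ((-1) ^ ((\<pi> + gpar x) * gpar y)) * (tword [y] * ?D x))"
    unfolding diff_conv_add_uminus hom_act_add hom_act_minus hom_act_smult mult.assoc hom_act_mult
      hom_act_word par_aut_word w distrib_left
    by (simp add: tconst_fold s1)
  also have "\<dots> = P - tconst ?\<sigma> * Q"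
    unfolding P_def Q_def right_diff_distrib mult.assoc tconst_fold s2 by simp
  also have "\<dots> \<in> super_ideal n k p"
    unfolding diff_conv_add_uminus by (intro super_ideal_add super_ideal_minus super_ideal_smult PQ)
  finally show ?thesis .
qed

lemma par_aut_relator:
  assumes "x \<in> gens n k p" "y \<in> gens n k p"
  shows "par_aut \<pi> (tword [x] * tword [y] -
      tconst ((-1) ^ (gpar x * gpar y)) * tword [y] * tword [x]) \<in> super_ideal n k p"
proof -
  have "par_aut \<pi> (tword [x] * tword [y] - tconst ((-1) ^ (gpar x * gpar y)) * tword [y] * tword [x]) =
      tconst ((-1) ^ (\<pi> * gpar x) * (-1) ^ (\<pi> * gpar y)) *
      (tword [x] * tword [y] - tconst ((-1) ^ (gpar x * gpar y)) * tword [y] * tword [x])"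
    unfolding diff_conv_add_uminus par_aut_add par_aut_minus par_aut_smult mult.assoc par_aut_mult
      par_aut_word tconst_commute' [of "tword _"] tconst_fold distrib_left mult_minus_right
    by (simp add: wpar_def mult.assoc tconst_fold) (simp add: mult_ac)
  then show ?thesis using super_ideal_relator [OF assms] by (simp add: super_ideal_smult)
qed

lemma hom_act_super_ideal:
  assumes "f \<in> super_ideal n k p"
    and A: "\<And>i j. A i j \<noteq> 0 \<Longrightarrow> (ipar i + ipar j) mod 2 = \<pi>"
  shows "hom_act n \<pi> A f \<in> super_ideal n k p"
proof -
  let ?J = "super_ideal n k p" and ?R = "tensor_ring n k p"
  define K where "K = {f \<in> ?J. par_aut \<pi> f \<in> ?J \<and> hom_act n \<pi> A f \<in> ?J}"
  have "ideal K ?R"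
  proof (rule idealI [OF ring_tensor_ring])
    show "subgroup K (add_monoid ?R)"
    proof (rule tensor.add.subgroupI)
      show "K \<subseteq> carrier ?R" by (auto simp: K_def super_ideal_carrier)
      show "K \<noteq> {}" by (auto simp: K_def intro!: exI [of _ 0])
    next
      fix f assume f: "f \<in> K"
      then have "\<ominus>\<^bsub>?R\<^esub> f = - f"
        using tensor_minus [of f n k p 0] tensor.minus_closed
        by (simp add: K_def super_ideal_carrier a_minus_def)
      with f show "\<ominus>\<^bsub>?R\<^esub> f \<in> K"
        by (simp add: K_def super_ideal_minus hom_act_minus par_aut_minus)
    qed (auto simp: K_def super_ideal_add hom_act_add par_aut_add)
  qed (auto simp: K_def hom_act_mult par_aut_mult super_ideal_carrier intro: super_ideal_add
      super_ideal_lmult super_ideal_rmult hom_act_carrier par_aut_carrier)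
  moreover have "{tword [x] * tword [y] - tconst ((-1) ^ (gpar x * gpar y)) * tword [y] * tword [x] | x y.
        x \<in> gens n k p \<and> y \<in> gens n k p} \<subseteq> K"
    using hom_act_relator [OF _ _ A] super_ideal_relator par_aut_relator by (auto simp: K_def)
  ultimately have "?J \<subseteq> K"
    unfolding super_ideal_def by (rule tensor.genideal_minimal)
  with assms(1) show ?thesis by (auto simp: K_def)
qed

lemma tensor_act_add: "tensor_act n A (f + g) = tensor_act n A f + tensor_act n A g"
  by (simp add: tensor_act_def hom_act_add)

lemma tensor_act_carrier:
  "f \<in> carrier (tensor_ring n k p) \<Longrightarrow> tensor_act n A f \<in> carrier (tensor_ring n k p)"
  by (simp add: tensor_act_def hom_act_carrier tensor_ring_add_closed)

lemma tensor_act_super_ideal: "f \<in> super_ideal n k p \<Longrightarrow> tensor_act n A f \<in> super_ideal n k p"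
  unfolding tensor_act_def
  by (intro super_ideal_add hom_act_super_ideal) (auto simp: hom_part_def split: if_splits)

lemma proj_eq_iff:
  assumes "f \<in> carrier (tensor_ring n k p)" "g \<in> carrier (tensor_ring n k p)"
  shows "proj n k p f = proj n k p g \<longleftrightarrow> f - g \<in> super_ideal n k p"
  using tensor.quotient_eq_iff_same_a_r_cos [OF ideal_super_ideal assms] assms
  by (simp add: tensor_minus proj_def)

lemma proj_eq: "proj n k p f = {h + f | h. h \<in> super_ideal n k p}"
  by (auto simp: proj_def a_r_coset_def r_coset_def)

lemma sym_act_proj:
  assumes "f \<in> carrier (tensor_ring n k p)"
  shows "sym_act n k p A (proj n k p f) = proj n k p (tensor_act n A f)"
proof -
  have "proj n k p (tensor_act n A (h + f)) = proj n k p (tensor_act n A f)"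
    if "h \<in> super_ideal n k p" for h
    using that assms super_ideal_carrier [OF that]
    by (subst proj_eq_iff)
      (simp_all add: tensor_act_carrier tensor_ring_add_closed tensor_act_add tensor_act_super_ideal)
  then have "sym_act n k p A (proj n k p f) =
      (\<Union>h\<in>super_ideal n k p. proj n k p (tensor_act n A f))"
    unfolding sym_act_def proj_eq [of n k p f] by auto
  also have "\<dots> = proj n k p (tensor_act n A f)" using super_ideal_0 by blast
  finally show ?thesis .
qed

end

(*
Symmetrization identifies the invariants of the symmetric superalgebra with invariant tensors in
r copies of V and s copies of its dual. The identity matrix, an element of q(V), acts on these by
r - s, so r = s, and an invariant tensor is an operator T on the r-th tensor power of V that
supercommutes with q(V). Twisted by a sign, T commutes with q(V) in the ordinary sense.

Let G be the finite group generated by the signed permutations of the tensor factors and by the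
operators induced by e_i -> e_{flip i} on a single factor. Averaging elementary operators over G
shows that the commutant of G is spanned by symmetrized products of elements of q(V), and these
lie in the algebra generated by the action of q(V). Hence T is in the double commutant of G, which
by Maschke averaging is the span of G. The tensor of an element of G is, up to sign and order of
the letters, a product of r inner products: the permutation says which vectors are paired, the
flips say which pairings are odd.
*)
theory Submission
  imports Defs "HOL-Combinatorics.Permutations"
begin

abbreviation coeff :: "tensor \<Rightarrow> gen list \<Rightarrow> complex" where
  "coeff \<equiv> Poly_Mapping.lookup"


section \<open>Linear operators on functions\<close>

text \<open>As a type, the linear operators form a noncommutative unital ring under composition, so
  that commutation identities become ring algebra.\<close>

typedef 'i lop = "{F :: ('i \<Rightarrow> complex) \<Rightarrow> 'i \<Rightarrow> complex.
    (\<forall>u v. F (\<lambda>i. u i + v i) = (\<lambda>i. F u i + F v i)) \<and> (\<forall>c v. F (\<lambda>i. c * v i) = (\<lambda>i. c * F v i))}"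
  morphisms app Lop
  by (rule exI [of _ "\<lambda>v. v"]) simp

setup_lifting type_definition_lop

instantiation lop :: (type) ring_1
begin
lift_definition zero_lop :: "'a lop" is "\<lambda>v i. 0" by simp
lift_definition one_lop :: "'a lop" is "\<lambda>v. v" by simp
lift_definition plus_lop :: "'a lop \<Rightarrow> 'a lop \<Rightarrow> 'a lop" is "\<lambda>X Y v i. X v i + Y v i"
  by (auto simp: algebra_simps)
lift_definition minus_lop :: "'a lop \<Rightarrow> 'a lop \<Rightarrow> 'a lop" is "\<lambda>X Y v i. X v i - Y v i"
  by (auto simp: algebra_simps)
lift_definition uminus_lop :: "'a lop \<Rightarrow> 'a lop" is "\<lambda>X v i. - X v i"
  by (auto simp: algebra_simps)
lift_definition times_lop :: "'a lop \<Rightarrow> 'a lop \<Rightarrow> 'a lop" is "\<lambda>X Y v. X (Y v)"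
  by simp
instance
proof
  show "(0 :: 'a lop) \<noteq> 1"
    by transfer (auto simp: fun_eq_iff intro!: exI [of _ "\<lambda>_. 1"])
qed (transfer; force simp: algebra_simps)+
end

text \<open>Complex scalars enter the ring as central elements, by \<open>scal_commute\<close>; this
  replaces a vector space structure on \<open>lop\<close>.\<close>

lift_definition scal :: "complex \<Rightarrow> 'i lop" is "\<lambda>c v i. c * v i"
  by (auto simp: algebra_simps)

lemma app_simps [simp]:
  "app 0 v i = 0" "app 1 v = v" "app (X + Y) v i = app X v i + app Y v i"
  "app (X - Y) v i = app X v i - app Y v i" "app (- X) v i = - app X v i"
  "app (X * Y) v = app X (app Y v)" "app (scal c) v i = c * v i"
  by (transfer, simp)+

lemma app_sum [simp]: "app (\<Sum>k\<in>K. X k) v i = (\<Sum>k\<in>K. app (X k) v i)"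
  by (induction K rule: infinite_finite_induct) simp_all

lemma app_add: "app X (\<lambda>i. u i + v i) = (\<lambda>i. app X u i + app X v i)"
  and app_scale: "app X (\<lambda>i. c * v i) = (\<lambda>i. c * app X v i)"
  using app [of X] by auto

lemma lop_eqI: "(\<And>v i. app X v i = app Y v i) \<Longrightarrow> X = Y"
  by (simp add: app_inject [symmetric] fun_eq_iff)

lemma scal_simps [simp]: "scal 0 = 0" "scal 1 = 1"
  by (auto intro: lop_eqI)

lemma scal_add: "scal (a + b) = scal a + scal b" and sc_mult: "scal (a * b) = scal a * scal b"
  and scal_minus: "scal (- a) = - scal a"
  by (auto intro!: lop_eqI simp: algebra_simps)

lemma scal_commute: "X * scal c = scal c * X"
  by (rule lop_eqI) (metis app_simps(6,7) app_scale ext)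

lemma sc_commute': "X * (scal c * Y) = scal c * (X * Y)"
  by (metis scal_commute mult.assoc)

lemma scal_fold: "scal a * (scal b * X) = scal (a * b) * X"
  by (simp add: sc_mult mult.assoc)

lemma app_Lop:
  assumes "\<And>u v i. F (\<lambda>i. u i + v i) i = F u i + F v i" "\<And>c v i. F (\<lambda>i. c * v i) i = c * F v i"
  shows "app (Lop F) = F"
  by (rule Lop_inverse) (use assms in auto)


section \<open>Operators on the tensor powers of the superspace\<close>

type_synonym midx = "nat \<Rightarrow> idx"

fun flip :: "idx \<Rightarrow> idx" where
  "flip (Ev i) = Od i"
| "flip (Od i) = Ev i"

lemma flip_flip [simp]: "flip (flip i) = i"
  by (cases i) auto

lemma flip_Idx [simp]: "flip i \<in> Idx n \<longleftrightarrow> i \<in> Idx n"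
  by (cases i) (auto simp: Idx_def)

lemma sgn_flip: "(-1) ^ ipar (flip i) = - ((-1) ^ ipar i :: complex)"
  by (cases i) auto

text \<open>Only the parity of \<pi> matters: a product carries the sum of the parities of its
  factors, which is not reduced modulo 2.\<close>

definition homog :: "nat \<Rightarrow> mat \<Rightarrow> bool" where
  "homog \<pi> X \<longleftrightarrow> (\<forall>i j. X i j \<noteq> 0 \<longrightarrow> (even (ipar i + ipar j) \<longleftrightarrow> even \<pi>))"

lemma homog_sgn:
  assumes "homog \<pi> X" "X a b \<noteq> 0"
  shows "(-1) ^ ipar b = ((-1) ^ \<pi> * (-1) ^ ipar a :: complex)"
proof -
  have "even (ipar a + ipar b) \<longleftrightarrow> even \<pi>"
    using assms unfolding homog_def by blast
  then show ?thesis by (simp add: power_add [symmetric] minus_one_power_iff) blast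
qed

definition par_sum :: "nat set \<Rightarrow> midx \<Rightarrow> nat" where
  "par_sum M i = (\<Sum>l\<in>M. ipar (i l))"

lemma par_sum_upd: "finite M \<Longrightarrow> (-1) ^ par_sum M (i(l := b)) =
    (if l \<in> M then (-1) ^ par_sum M i * (-1) ^ ipar (i l) * (-1) ^ ipar b else (-1) ^ par_sum M i :: complex)"
proof -
  assume "finite M"
  have "par_sum M (i(l := b)) + ipar (i l) = par_sum M i + ipar b" if "l \<in> M"
    using that \<open>finite M\<close> by (simp add: par_sum_def sum.remove [of M l])
  then have "l \<in> M \<Longrightarrow> (-1) ^ par_sum M (i(l := b)) * (-1) ^ ipar (i l) = ((-1) ^ par_sum M i * (-1) ^ ipar b :: complex)"
    by (simp add: power_add [symmetric])
  then have "l \<in> M \<Longrightarrow> (-1) ^ par_sum M (i(l := b)) * ((-1) ^ ipar (i l) * (-1) ^ ipar (i l))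
      = ((-1) ^ par_sum M i * (-1) ^ ipar (i l) * (-1) ^ ipar b :: complex)"
    by (metis mult.assoc mult.commute)
  moreover have "l \<notin> M \<Longrightarrow> par_sum M (i(l := b)) = par_sum M i"
    by (auto simp: par_sum_def intro!: sum.cong)
  ultimately show ?thesis by (auto simp flip: power_mult_distrib)
qed

text \<open>
  A tuple of indices is a function on \<open>nat\<close> of which only the entries below \<open>r\<close> count. Entry
  \<open>r - 1\<close> is the leftmost tensor factor, so \<open>X\<close> of parity \<open>\<pi>\<close> acting at \<open>m\<close> has to pass the entries
  above \<open>m\<close>: this is the Koszul sign in \<open>pos_op\<close>. The operator \<open>cliff_op m\<close> is, up to a scalar, the
  odd involution \<open>e\<^sub>i \<mapsto> e\<^bsub>flip i\<^esub>\<close> at \<open>m\<close> composed with the parity automorphism of the whole tensor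
  power; this makes it commute with \<open>q(V)\<close> in the ordinary sense instead of supercommute.
\<close>

definition pos_op :: "nat \<Rightarrow> nat \<Rightarrow> nat \<Rightarrow> mat \<Rightarrow> nat \<Rightarrow> midx lop" where
  "pos_op n r \<pi> X m = Lop (\<lambda>v i. ((-1) ^ par_sum {m<..<r} i) ^ \<pi> * (\<Sum>a\<in>Idx n. X (i m) a * v (i(m := a))))"

definition swap_op :: "nat \<Rightarrow> midx lop" where
  "swap_op a = Lop (\<lambda>v i. ((-1) ^ ipar (i a)) ^ ipar (i (Suc a)) * v (i \<circ> transpose a (Suc a)))"

definition cliff_op :: "nat \<Rightarrow> midx lop" where
  "cliff_op m = Lop (\<lambda>v i. (-1) ^ par_sum {..m} i * v (i(m := flip (i m))))"

lemma app_pos: "app (pos_op n r \<pi> X m) v i =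
    ((-1) ^ par_sum {m<..<r} i) ^ \<pi> * (\<Sum>a\<in>Idx n. X (i m) a * v (i(m := a)))"
  unfolding pos_op_def by (subst app_Lop) (auto simp: algebra_simps sum.distrib sum_distrib_left)

lemma app_swap: "app (swap_op a) v i = ((-1) ^ ipar (i a)) ^ ipar (i (Suc a)) * v (i \<circ> transpose a (Suc a))"
  unfolding swap_op_def by (subst app_Lop) (auto simp: algebra_simps)

lemma app_cliff: "app (cliff_op m) v i = (-1) ^ par_sum {..m} i * v (i(m := flip (i m)))"
  unfolding cliff_op_def by (subst app_Lop) (auto simp: algebra_simps)

definition mprod :: "nat \<Rightarrow> mat \<Rightarrow> mat \<Rightarrow> mat" where
  "mprod n X Y = (\<lambda>i j. \<Sum>a\<in>Idx n. X i a * Y a j)"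

lemma sgn_sq [simp]: "(-1) ^ k * (-1) ^ k = (1 :: complex)" "(-1) ^ k * ((-1) ^ k * x) = (x :: complex)"
  by (simp_all flip: power_mult_distrib mult.assoc)

lemma sgn_pow_sq [simp]: "((-1) ^ k) ^ l * ((-1) ^ k) ^ l = (1 :: complex)"
  "((-1) ^ k) ^ l * (((-1) ^ k) ^ l * x) = (x :: complex)"
  by (simp_all flip: power_mult_distrib mult.assoc)

text \<open>Both Koszul signs count only the entries above \<open>m\<close>, which an operator at
  \<open>m\<close> leaves unchanged, so the signs simply multiply.\<close>

lemma pos_mult_same:
  "pos_op n r \<pi> X m * pos_op n r \<rho> Y m = pos_op n r (\<pi> + \<rho>) (mprod n X Y) m"
proof (rule lop_eqI)
  fix v i
  let ?e = "(-1) ^ par_sum {m<..<r} i :: complex"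
  have "app (pos_op n r \<pi> X m * pos_op n r \<rho> Y m) v i =
      ?e ^ \<pi> * (\<Sum>a\<in>Idx n. \<Sum>b\<in>Idx n. X (i m) a * (?e ^ \<rho> * (Y a b * v (i(m := b)))))"
    by (simp add: app_pos par_sum_upd sum_distrib_left)
  also have "\<dots> = app (pos_op n r (\<pi> + \<rho>) (mprod n X Y) m) v i"
    by (subst sum.swap) (simp add: app_pos mprod_def power_add sum_distrib_left sum_distrib_right mult_ac)
  finally show "app (pos_op n r \<pi> X m * pos_op n r \<rho> Y m) v i = app (pos_op n r (\<pi> + \<rho>) (mprod n X Y) m) v i" .
qed


text \<open>Bilinear signs are kept as iterated powers; exchanging the exponents decides which of
  the two is expanded into a product of signs.\<close>

lemma sgn_pow_swap: "((-1) ^ a) ^ b = (((-1) ^ b) ^ a :: complex)"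
  by (simp add: mult.commute flip: power_mult)

lemma sgn_pow_swap_sq [simp]: "((-1) ^ a) ^ b * ((-1) ^ b) ^ a = (1 :: complex)"
  "((-1) ^ a) ^ b * (((-1) ^ b) ^ a * x) = (x :: complex)"
  by (simp_all add: sgn_pow_swap [of b a])

lemma sgn_sq_right [simp]: "x * (-1) ^ k * (-1) ^ k = (x :: complex)"
  by (simp add: mult.assoc)

text \<open>Only nonzero entries of \<open>X\<close> contribute, and for these homogeneity
  determines the sign of the column index from that of the row index.\<close>

lemma sum_cong_homog:
  assumes "homog \<pi> X" and "\<And>a. a \<in> A \<Longrightarrow> (-1) ^ ipar a = ((-1) ^ \<pi> * (-1) ^ ipar x :: complex) \<Longrightarrow> f a = (g a :: complex)"
  shows "(\<Sum>a\<in>A. X x a * f a) = (\<Sum>a\<in>A. X x a * g a)"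
  by (rule sum.cong [OF refl]) (use assms homog_sgn in fastforce)

text \<open>The Koszul sign of the operator at \<open>m\<close> counts the entry at
  \<open>l\<close>, whose parity the other operator shifts by \<rho>; this is the sign
  \<open>(-1) ^ (\<pi> * \<rho>)\<close>. The sign of the operator at \<open>l\<close> does not see
  \<open>m\<close>.\<close>

lemma pos_commute_less:
  assumes "m < l" "l < r" and X: "homog \<pi> X" and Y: "homog \<rho> Y"
  shows "pos_op n r \<pi> X m * pos_op n r \<rho> Y l = scal ((-1) ^ (\<pi> * \<rho>)) * (pos_op n r \<rho> Y l * pos_op n r \<pi> X m)"
proof (rule lop_eqI)
  fix v i
  let ?e = "(-1) ^ par_sum {m<..<r} i :: complex" and ?f = "(-1) ^ par_sum {l<..<r} i :: complex"
  have "app (pos_op n r \<pi> X m * pos_op n r \<rho> Y l) v i =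
      (\<Sum>a\<in>Idx n. \<Sum>b\<in>Idx n. ?e ^ \<pi> * ?f ^ \<rho> * X (i m) a * Y (i l) b * v (i(m := a, l := b)))"
    using assms by (simp add: app_pos par_sum_upd sum_distrib_left mult_ac)
  also have "\<dots> = (\<Sum>b\<in>Idx n. ?e ^ \<pi> * ?f ^ \<rho> * (Y (i l) b * (\<Sum>a\<in>Idx n. X (i m) a * v (i(m := a, l := b)))))"
    by (subst sum.swap) (simp add: sum_distrib_left mult_ac)
  also have "\<dots> = (-1) ^ (\<pi> * \<rho>) * (?f ^ \<rho> * (\<Sum>b\<in>Idx n. Y (i l) b *
      (((-1) ^ par_sum {m<..<r} (i(l := b))) ^ \<pi> * (\<Sum>a\<in>Idx n. X (i m) a * v (i(l := b, m := a))))))"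
  proof -
    have "(\<Sum>b\<in>Idx n. Y (i l) b * (((-1) ^ par_sum {m<..<r} (i(l := b))) ^ \<pi> * (\<Sum>a\<in>Idx n. X (i m) a * v (i(l := b, m := a)))))
      = (\<Sum>b\<in>Idx n. Y (i l) b * (?e ^ \<pi> * (-1) ^ (\<pi> * \<rho>) * (\<Sum>a\<in>Idx n. X (i m) a * v (i(m := a, l := b)))))"
    proof (rule sum_cong_homog [OF Y])
      fix b assume b: "(-1) ^ ipar b = ((-1) ^ \<rho> * (-1) ^ ipar (i l) :: complex)"
      have "(-1) ^ par_sum {m<..<r} (i(l := b)) = (?e * (-1) ^ \<rho> :: complex)"
        using assms(1,2) by (simp add: par_sum_upd b)
      moreover have "i(l := b, m := a) = i(m := a, l := b)" for a
        using assms(1) by (simp add: fun_upd_twist)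
      ultimately show "((-1) ^ par_sum {m<..<r} (i(l := b))) ^ \<pi> * (\<Sum>a\<in>Idx n. X (i m) a * v (i(l := b, m := a))) =
          ?e ^ \<pi> * (-1) ^ (\<pi> * \<rho>) * (\<Sum>a\<in>Idx n. X (i m) a * v (i(m := a, l := b)))"
        by (simp add: power_mult_distrib power_mult [symmetric] mult.commute)
    qed
    then show ?thesis by (simp add: sum_distrib_left mult_ac flip: power_mult_distrib)
  qed
  also have "\<dots> = app (scal ((-1) ^ (\<pi> * \<rho>)) * (pos_op n r \<rho> Y l * pos_op n r \<pi> X m)) v i"
    using assms(1) by (simp add: app_pos)
  finally show "app (pos_op n r \<pi> X m * pos_op n r \<rho> Y l) v i =
    app (scal ((-1) ^ (\<pi> * \<rho>)) * (pos_op n r \<rho> Y l * pos_op n r \<pi> X m)) v i" .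
qed

lemma pos_commute:
  assumes "m \<noteq> l" "m < r" "l < r" "homog \<pi> X" "homog \<rho> Y"
  shows "pos_op n r \<pi> X m * pos_op n r \<rho> Y l = scal ((-1) ^ (\<pi> * \<rho>)) * (pos_op n r \<rho> Y l * pos_op n r \<pi> X m)"
proof (cases "m < l")
  case True
  then show ?thesis using assms by (simp add: pos_commute_less)
next
  case False
  then have "l < m" using assms by simp
  from pos_commute_less [OF this assms(2) assms(5,4)] show ?thesis
    by (simp add: scal_fold mult.commute [of \<rho>])
qed

lemma swap_swap [simp]: "swap_op a * swap_op a = 1"
  by (rule lop_eqI) (simp add: app_swap comp_assoc power_mult [symmetric] mult.commute)

lemma sw_sw' [simp]: "swap_op a * (swap_op a * X) = X"
  by (simp flip: mult.assoc)

text \<open>The prefix \<open>{..m}\<close> includes the flipped entry itself, so the signs of the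
  two applications differ by -1.\<close>

lemma cliff_cliff: "cliff_op m * cliff_op m = - 1"
  by (rule lop_eqI) (simp add: app_cliff par_sum_upd sgn_flip)

lemma cl_cl': "cliff_op m * (cliff_op m * X) = - X"
  by (simp add: cliff_cliff flip: mult.assoc)

lemma par_sum_transpose: "a \<in> M \<longleftrightarrow> b \<in> M \<Longrightarrow> par_sum M (i \<circ> transpose a b) = par_sum M i"
proof -
  assume "a \<in> M \<longleftrightarrow> b \<in> M"
  then have "transpose a b ` M = M"
    by (auto simp: transpose_def image_iff split: if_splits)
  then have "bij_betw (transpose a b) M M"
    by (simp add: bij_betw_def)
  then show ?thesis
    unfolding par_sum_def comp_def by (rule sum.reindex_bij_betw)
qed

lemma upd_transpose: "(i \<circ> transpose a b)(m := x) \<circ> transpose a b = i(transpose a b m := x)"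
  by (auto simp: fun_eq_iff transpose_def)

text \<open>Between the two swaps the operator at \<open>a\<close> also has to pass the neighbouring
  letter. This extra sign cancels against the second swap, whose sign is taken with a letter of
  parity shifted by \<pi>.\<close>

lemma swap_pos_at:
  assumes "Suc a < r" and X: "homog \<pi> X"
  shows "swap_op a * (pos_op n r \<pi> X a * swap_op a) = pos_op n r \<pi> X (Suc a)"
proof (rule lop_eqI)
  fix v i
  let ?\<tau> = "transpose a (Suc a)" and ?f = "(-1) ^ par_sum {Suc a<..<r} i :: complex"
  have e: "(-1) ^ par_sum {a<..<r} (i \<circ> ?\<tau>) = ?f * (-1) ^ ipar (i a)"
  proof -
    have "{a<..<r} = insert (Suc a) {Suc a<..<r}" using assms(1) by auto
    then have "par_sum {a<..<r} (i \<circ> ?\<tau>) = ipar (i a) + par_sum {Suc a<..<r} (i \<circ> ?\<tau>)"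
      by (simp add: par_sum_def)
    then show ?thesis by (simp add: par_sum_transpose power_add)
  qed
  have "app (swap_op a * (pos_op n r \<pi> X a * swap_op a)) v i = ((-1) ^ ipar (i a)) ^ ipar (i (Suc a)) *
      ((?f * (-1) ^ ipar (i a)) ^ \<pi> * (\<Sum>b\<in>Idx n. X (i (Suc a)) b *
      (((-1) ^ ipar b) ^ ipar (i a) * v (i(Suc a := b)))))"
    by (simp add: app_swap app_pos e upd_transpose)
  also have "(\<Sum>b\<in>Idx n. X (i (Suc a)) b * (((-1) ^ ipar b) ^ ipar (i a) * v (i(Suc a := b)))) =
    (\<Sum>b\<in>Idx n. X (i (Suc a)) b * (((-1) ^ \<pi> * (-1) ^ ipar (i (Suc a))) ^ ipar (i a) * v (i(Suc a := b))))"
    by (rule sum_cong_homog [OF X]) simp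
  also have "\<dots> = ((-1) ^ \<pi>) ^ ipar (i a) * ((-1) ^ ipar (i (Suc a))) ^ ipar (i a) *
       (\<Sum>b\<in>Idx n. X (i (Suc a)) b * v (i(Suc a := b)))"
    by (simp add: sum_distrib_left power_mult_distrib mult_ac)
  also have "((-1) ^ \<pi>) ^ ipar (i a) = (((-1) ^ ipar (i a)) ^ \<pi> :: complex)"
    by (rule sgn_pow_swap)
  also have "((-1) ^ ipar (i (Suc a))) ^ ipar (i a) = (((-1) ^ ipar (i a)) ^ ipar (i (Suc a)) :: complex)"
    by (rule sgn_pow_swap)
  also have "((-1) ^ ipar (i a)) ^ ipar (i (Suc a)) * ((?f * (-1) ^ ipar (i a)) ^ \<pi> *
      (((-1) ^ ipar (i a)) ^ \<pi> * ((-1) ^ ipar (i a)) ^ ipar (i (Suc a)) *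
       (\<Sum>b\<in>Idx n. X (i (Suc a)) b * v (i(Suc a := b))))) = app (pos_op n r \<pi> X (Suc a)) v i"
    unfolding app_pos by (simp add: power_mult_distrib mult_ac)
  finally show "app (swap_op a * (pos_op n r \<pi> X a * swap_op a)) v i = app (pos_op n r \<pi> X (Suc a)) v i" .
qed

lemma swap_pos:
  assumes "Suc a < r" and X: "homog \<pi> X"
  shows "swap_op a * (pos_op n r \<pi> X m * swap_op a) = pos_op n r \<pi> X (transpose a (Suc a) m)"
proof -
  consider "m = a" | "m = Suc a" | "m \<noteq> a" "m \<noteq> Suc a" by blast
  then show ?thesis
  proof cases
    case 1
    then show ?thesis using swap_pos_at [OF assms] by simp
  next
    case 2
    then show ?thesis unfolding 2 swap_pos_at [OF assms, symmetric] by (simp add: mult.assoc)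
  next
    case 3
    have "m < a \<longleftrightarrow> m < Suc a" using 3 by auto
    then have *: "par_sum {m<..<r} (i \<circ> transpose a (Suc a)) = par_sum {m<..<r} i" for i
      using assms(1) by (intro par_sum_transpose) auto
    show ?thesis
      by (rule lop_eqI) (use 3 in \<open>simp add: app_swap app_pos * upd_transpose sum_distrib_left mult_ac\<close>)
  qed
qed

text \<open>The flip changes the parity of a letter between the two swap signs. The resulting factor
  \<open>(-1) ^ ipar (i a)\<close> is exactly what the prefix sign for \<open>{..a}\<close> of the
  transposed tuple lacks compared with that for \<open>{..Suc a}\<close>.\<close>

lemma swap_cliff_at: "swap_op a * (cliff_op a * swap_op a) = cliff_op (Suc a)"
proof (rule lop_eqI)
  fix v i
  have "par_sum {..a} (i \<circ> transpose a (Suc a)) = par_sum {..<a} i + ipar (i (Suc a))"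
    using par_sum_transpose [of a "{..<a}" "Suc a" i] by (simp add: par_sum_def lessThan_Suc_atMost [symmetric])
  then have *: "(-1) ^ par_sum {..a} (i \<circ> transpose a (Suc a)) * (-1) ^ ipar (i a) = ((-1) ^ par_sum {..Suc a} i :: complex)"
    by (simp add: par_sum_def lessThan_Suc_atMost [symmetric] power_add)
  have "app (swap_op a * (cliff_op a * swap_op a)) v i = ((-1) ^ ipar (i a)) ^ ipar (i (Suc a)) * ((-1) ^ par_sum {..a} (i \<circ> transpose a (Suc a)) *
     (((-1) ^ ipar (flip (i (Suc a)))) ^ ipar (i a) * v (i(Suc a := flip (i (Suc a))))))"
    by (simp add: app_swap app_cliff upd_transpose)
  also have "((-1) ^ ipar (flip (i (Suc a)))) ^ ipar (i a) =
      (-1) ^ ipar (i a) * (((-1) ^ ipar (i a)) ^ ipar (i (Suc a)) :: complex)"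
    by (cases "i a"; cases "i (Suc a)") auto
  also have "((-1) ^ ipar (i a)) ^ ipar (i (Suc a)) * ((-1) ^ par_sum {..a} (i \<circ> transpose a (Suc a)) *
      ((-1) ^ ipar (i a) * ((-1) ^ ipar (i a)) ^ ipar (i (Suc a)) * v (i(Suc a := flip (i (Suc a)))))) =
      app (cliff_op (Suc a)) v i"
    unfolding app_cliff * [symmetric] by (simp only: mult_ac sgn_pow_sq)
  finally show "app (swap_op a * (cliff_op a * swap_op a)) v i = app (cliff_op (Suc a)) v i" .
qed

lemma swap_cliff: "swap_op a * (cliff_op m * swap_op a) = cliff_op (transpose a (Suc a) m)"
proof -
  consider "m = a" | "m = Suc a" | "m \<noteq> a" "m \<noteq> Suc a" by blast
  then show ?thesis
  proof cases
    case 1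
    then show ?thesis using swap_cliff_at by simp
  next
    case 2
    then show ?thesis unfolding 2 swap_cliff_at [symmetric] by (simp add: mult.assoc)
  next
    case 3
    have *: "par_sum {..m} (i \<circ> transpose a (Suc a)) = par_sum {..m} i" for i
      using 3 by (intro par_sum_transpose) auto
    show ?thesis
      by (rule lop_eqI) (use 3 in \<open>simp add: app_swap app_cliff * upd_transpose\<close>)
  qed
qed

text \<open>Conjugation by the odd involution \<open>flip\<close> in the super sense. For
  homogeneous \<open>X\<close> in \<open>gl n\<close>, being fixed by it means supercommuting with
  this involution, that is, lying in q(V).\<close>

definition sharp :: "nat \<Rightarrow> mat \<Rightarrow> mat" where
  "sharp \<pi> X = (\<lambda>i j. (-1) ^ \<pi> * X (flip i) (flip j))"

text \<open>For \<open>l < m\<close> the prefix sign of \<open>cliff_op m\<close> sees the letter at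
  \<open>l\<close>, and the Koszul sign of the operator at \<open>l\<close> sees the letter at
  \<open>m\<close>; both change by \<open>(-1) ^ \<pi>\<close> and cancel. For \<open>m < l\<close>
  neither sees the other.\<close>

lemma cliff_pos:
  assumes "m \<noteq> l" "m < r" and X: "homog \<pi> X"
  shows "cliff_op m * pos_op n r \<pi> X l = pos_op n r \<pi> X l * cliff_op m"
proof (rule lop_eqI)
  fix v i
  let ?d = "(if l < m then (-1) ^ \<pi> else 1 :: complex)" and ?e = "(-1) ^ par_sum {..m} i :: complex"
  have "app (cliff_op m * pos_op n r \<pi> X l) v i = ?e * ((((-1) ^ par_sum {l<..<r} i) ^ \<pi> * ?d) *
      (\<Sum>a\<in>Idx n. X (i l) a * v (i(l := a, m := flip (i m)))))"
    using assms by (simp add: app_cliff app_pos par_sum_upd sgn_flip fun_upd_twist power_mult_distrib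
        power_minus [of "(-1) ^ par_sum {l<..<r} i"])
  also have "\<dots> = ((-1) ^ par_sum {l<..<r} i) ^ \<pi> * (\<Sum>a\<in>Idx n. X (i l) a * (?e * (?d * v (i(l := a, m := flip (i m))))))"
    by (simp add: sum_distrib_left mult_ac)
  also have "(\<Sum>a\<in>Idx n. X (i l) a * (?e * (?d * v (i(l := a, m := flip (i m)))))) =
     (\<Sum>a\<in>Idx n. X (i l) a * ((-1) ^ par_sum {..m} (i(l := a)) * v (i(l := a, m := flip (i m)))))"
    by (rule sum_cong_homog [OF X]) (use assms(1) in \<open>auto simp: par_sum_upd\<close>)
  finally show "app (cliff_op m * pos_op n r \<pi> X l) v i = app (pos_op n r \<pi> X l * cliff_op m) v i"
    using assms(1) by (simp add: app_cliff app_pos)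
qed

lemma sum_flip: "(\<Sum>a\<in>Idx n. f (flip a)) = (\<Sum>a\<in>Idx n. f a)"
  by (rule sum.reindex_bij_witness [of _ flip flip]) auto

lemma cliff_pos_same:
  assumes X: "homog \<pi> X"
  shows "cliff_op m * pos_op n r \<pi> X m = pos_op n r \<pi> (sharp \<pi> X) m * cliff_op m"
proof (rule lop_eqI)
  fix v i
  let ?e = "(-1) ^ par_sum {..m} i :: complex" and ?f = "((-1) ^ par_sum {m<..<r} i) ^ \<pi> :: complex"
  have "app (cliff_op m * pos_op n r \<pi> X m) v i = ?f * (\<Sum>a\<in>Idx n. X (flip (i m)) a * (?e * v (i(m := a))))"
    by (simp add: app_cliff app_pos par_sum_upd sum_distrib_left mult_ac)
  \<comment> \<open>The inserted factor equals 1 wherever the entry of \<open>X\<close> is nonzero.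
    After the reindexing by \<open>flip\<close> it supplies the sign in \<open>sharp\<close> and the
    change of the prefix sign of \<open>cliff_op m\<close>.\<close>
  also have "(\<Sum>a\<in>Idx n. X (flip (i m)) a * (?e * v (i(m := a)))) =
     (\<Sum>a\<in>Idx n. X (flip (i m)) a * (- ((-1) ^ \<pi> * (-1) ^ ipar (i m) * (-1) ^ ipar a) * (?e * v (i(m := a)))))"
    by (rule sum_cong_homog [OF X]) (auto simp: sgn_flip simp flip: power_add)
  also have "\<dots> = (\<Sum>a\<in>Idx n. X (flip (i m)) (flip a) * (- ((-1) ^ \<pi> * (-1) ^ ipar (i m) * (-1) ^ ipar (flip a)) * (?e * v (i(m := flip a)))))"
    by (rule sum_flip [symmetric])
  also have "?f * \<dots> = app (pos_op n r \<pi> (sharp \<pi> X) m * cliff_op m) v i"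
    by (simp add: app_cliff app_pos par_sum_upd sgn_flip sharp_def mult_ac)
  finally show "app (cliff_op m * pos_op n r \<pi> X m) v i = app (pos_op n r \<pi> (sharp \<pi> X) m * cliff_op m) v i" .
qed


section \<open>Symmetrized products of elements of \<open>q(V)\<close>\<close>

text \<open>The homogeneous elements of q(V), described by matrix entries instead of by the tensor
  that q(V) preserves; \<open>q_homog_q_alg\<close> and \<open>q_alg_sharp\<close> compare the two
  descriptions.\<close>

definition q_homog :: "nat \<Rightarrow> nat \<Rightarrow> mat \<Rightarrow> bool" where
  "q_homog n \<pi> X \<longleftrightarrow> homog \<pi> X \<and> X \<in> gl n \<and> sharp \<pi> X = X"

lemma homog_mprod:
  assumes "homog \<pi> X" "homog \<rho> Y"
  shows "homog (\<pi> + \<rho>) (mprod n X Y)"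
  unfolding homog_def
proof (intro allI impI)
  fix i j assume "mprod n X Y i j \<noteq> 0"
  then obtain a where "X i a * Y a j \<noteq> 0"
    unfolding mprod_def by (meson sum.not_neutral_contains_not_neutral)
  then have "even (ipar i + ipar a) \<longleftrightarrow> even \<pi>" "even (ipar a + ipar j) \<longleftrightarrow> even \<rho>"
    using assms unfolding homog_def by auto
  then show "even (ipar i + ipar j) \<longleftrightarrow> even (\<pi> + \<rho>)" by simp blast
qed

text \<open>That q(V) is closed under the associative product, and not only under the bracket, is
  what keeps the merged factors in \<open>total_possum\<close> inside q(V).\<close>

lemma q_homog_mprod:
  assumes "q_homog n \<pi> X" "q_homog n \<rho> Y"
  shows "q_homog n (\<pi> + \<rho>) (mprod n X Y)"
proof -
  have X: "X i j = (-1) ^ \<pi> * X (flip i) (flip j)" and Y: "Y i j = (-1) ^ \<rho> * Y (flip i) (flip j)" for i j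
    using assms unfolding q_homog_def sharp_def by metis+
  have "sharp (\<pi> + \<rho>) (mprod n X Y) i j = mprod n X Y i j" for i j
  proof -
    have "mprod n X Y i j = (\<Sum>a\<in>Idx n. (-1) ^ (\<pi> + \<rho>) * (X (flip i) (flip a) * Y (flip a) (flip j)))"
      unfolding mprod_def by (subst X, subst Y) (simp add: power_add mult_ac)
    also have "\<dots> = (-1) ^ (\<pi> + \<rho>) * mprod n X Y (flip i) (flip j)"
      unfolding sum_distrib_left [symmetric] mprod_def by (subst sum_flip) (rule refl)
    finally show ?thesis by (simp add: sharp_def)
  qed
  moreover have "mprod n X Y \<in> gl n"
    using assms by (auto simp: q_homog_def gl_def mprod_def)
  ultimately show ?thesis using assms homog_mprod unfolding q_homog_def by blast
qed

definition total_op :: "nat \<Rightarrow> nat \<Rightarrow> nat \<Rightarrow> mat \<Rightarrow> midx lop" where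
  "total_op n r \<pi> X = (\<Sum>m<r. pos_op n r \<pi> X m)"

definition prodpos :: "nat \<Rightarrow> nat \<Rightarrow> (nat \<times> mat) list \<Rightarrow> nat list \<Rightarrow> midx lop" where
  "prodpos n r L ms = prod_list (map2 (\<lambda>x m. pos_op n r (fst x) (snd x) m) L ms)"

lemma prodpos_Cons: "prodpos n r (x # L) (m # ms) = pos_op n r (fst x) (snd x) m * prodpos n r L ms"
  by (simp add: prodpos_def)

definition positions :: "nat \<Rightarrow> nat \<Rightarrow> nat list set" where
  "positions r k = {ms. length ms = k \<and> distinct ms \<and> set ms \<subseteq> {..<r}}"

lemma finite_positions [simp]: "finite (positions r k)"
proof -
  have "positions r k \<subseteq> {ms. set ms \<subseteq> {..<r} \<and> length ms = k}" by (auto simp: positions_def)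
  then show ?thesis by (rule finite_subset) (simp add: finite_lists_length_eq)
qed

text \<open>The symmetrized product: the factors are multiplied in the given order and placed at
  distinct positions in all possible ways. Lists shorter than \<open>r\<close> leave the identity at
  the remaining positions; they arise as correction terms.\<close>

definition possum :: "nat \<Rightarrow> nat \<Rightarrow> (nat \<times> mat) list \<Rightarrow> midx lop" where
  "possum n r L = (\<Sum>ms\<in>positions r (length L). prodpos n r L ms)"

text \<open>The operator supercommutes past the first \<open>j\<close> factors, which sit at other
  positions, and is then multiplied into the factor at its own position.\<close>

lemma pos_absorb:
  assumes "homog \<pi> X"
  shows "j < length L \<Longrightarrow> length ms = length L \<Longrightarrow> distinct ms \<Longrightarrow> set ms \<subseteq> {..<r} \<Longrightarrow>
    \<forall>x\<in>set L. homog (fst x) (snd x) \<Longrightarrow>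
    pos_op n r \<pi> X (ms ! j) * prodpos n r L ms =
      scal ((-1) ^ (\<pi> * sum_list (map fst (take j L)))) *
      prodpos n r (L[j := (\<pi> + fst (L ! j), mprod n X (snd (L ! j)))]) ms"
proof (induction L arbitrary: j ms)
  case (Cons x L)
  then obtain m ms' where ms: "ms = m # ms'" by (cases ms) auto
  show ?case
  proof (cases j)
    case 0
    then show ?thesis by (simp add: ms prodpos_Cons pos_mult_same flip: mult.assoc)
  next
    case (Suc j')
    have j': "j' < length ms'" using Cons.prems Suc ms by simp
    have mem: "ms' ! j' \<in> set ms'" using j' by simp
    then have "m \<noteq> ms' ! j'" using Cons.prems(3) ms by auto
    moreover have "m < r" "ms' ! j' < r" using Cons.prems(4) mem unfolding ms by auto
    ultimately
    have "pos_op n r \<pi> X (ms ! j) * prodpos n r (x # L) ms = scal ((-1) ^ (\<pi> * fst x)) *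
       (pos_op n r (fst x) (snd x) m * (pos_op n r \<pi> X (ms' ! j') * prodpos n r L ms'))"
      using pos_commute [of "ms' ! j'" m r \<pi> X "fst x" "snd x" n] assms Cons.prems
      by (simp add: ms Suc prodpos_Cons mult.assoc [symmetric])
    also have "pos_op n r \<pi> X (ms' ! j') * prodpos n r L ms' =
      scal ((-1) ^ (\<pi> * sum_list (map fst (take j' L)))) *
      prodpos n r (L[j' := (\<pi> + fst (L ! j'), mprod n X (snd (L ! j')))]) ms'"
      using Cons.prems Suc ms by (intro Cons.IH) auto
    finally show ?thesis
      unfolding sc_commute' [of "pos_op n r (fst x) (snd x) m"] scal_fold
      by (simp add: ms Suc prodpos_Cons power_add distrib_left)
  qed
qed simp

text \<open>The position of the new operator is either free, which gives the longer symmetrized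
  product, or occupied, and then \<open>pos_absorb\<close> merges it with the factor found
  there.\<close>

lemma total_possum:
  assumes "homog \<pi> X" and L: "\<forall>x\<in>set L. homog (fst x) (snd x)"
  shows "total_op n r \<pi> X * possum n r L = possum n r ((\<pi>, X) # L) +
    (\<Sum>j<length L. scal ((-1) ^ (\<pi> * sum_list (map fst (take j L)))) *
      possum n r (L[j := (\<pi> + fst (L ! j), mprod n X (snd (L ! j)))]))"
proof -
  let ?D = "positions r (length L)"
  let ?g = "\<lambda>ms m. pos_op n r \<pi> X m * prodpos n r L ms"
  let ?h = "\<lambda>ms j. scal ((-1) ^ (\<pi> * sum_list (map fst (take j L)))) *
      prodpos n r (L[j := (\<pi> + fst (L ! j), mprod n X (snd (L ! j)))]) ms"
  have in_set: "(\<Sum>m\<in>set ms. ?g ms m) = (\<Sum>j<length L. ?h ms j)" if "ms \<in> ?D" for ms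
  proof -
    have ms: "length ms = length L" "distinct ms" "set ms \<subseteq> {..<r}" using that by (auto simp: positions_def)
    have "(\<Sum>j<length L. ?g ms (ms ! j)) = (\<Sum>m\<in>set ms. ?g ms m)"
      by (rule sum.reindex_bij_betw [OF bij_betw_nth]) (use ms in auto)
    moreover have "(\<Sum>j<length L. ?g ms (ms ! j)) = (\<Sum>j<length L. ?h ms j)"
      by (rule sum.cong [OF refl]) (use pos_absorb [OF assms(1)] ms L in auto)
    ultimately show ?thesis by simp
  qed
  have "total_op n r \<pi> X * possum n r L = (\<Sum>ms\<in>?D. \<Sum>m<r. ?g ms m)"
    unfolding total_op_def possum_def sum_distrib_left sum_distrib_right by (rule refl)
  also have "\<dots> = (\<Sum>ms\<in>?D. (\<Sum>m\<in>{..<r} - set ms. ?g ms m) + (\<Sum>j<length L. ?h ms j))"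
  proof (rule sum.cong [OF refl])
    fix ms assume ms: "ms \<in> ?D"
    then have "set ms \<subseteq> {..<r}" by (simp add: positions_def)
    then show "(\<Sum>m<r. ?g ms m) = (\<Sum>m\<in>{..<r} - set ms. ?g ms m) + (\<Sum>j<length L. ?h ms j)"
      unfolding in_set [OF ms, symmetric] by (intro sum.subset_diff) auto
  qed
  also have "\<dots> = (\<Sum>ms\<in>?D. \<Sum>m\<in>{..<r} - set ms. ?g ms m) + (\<Sum>j<length L. \<Sum>ms\<in>?D. ?h ms j)"
    unfolding sum.distrib by (subst (2) sum.swap) (rule refl)
  also have "(\<Sum>ms\<in>?D. \<Sum>m\<in>{..<r} - set ms. ?g ms m) = possum n r ((\<pi>, X) # L)"
  proof -
    have "(\<Sum>ms\<in>?D. \<Sum>m\<in>{..<r} - set ms. ?g ms m) =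
        (\<Sum>z\<in>Sigma ?D (\<lambda>ms. {..<r} - set ms). prodpos n r ((\<pi>, X) # L) (snd z # fst z))"
      by (simp add: sum.Sigma prodpos_Cons split_beta)
    also have "\<dots> = (\<Sum>ms\<in>(\<lambda>z. snd z # fst z) ` Sigma ?D (\<lambda>ms. {..<r} - set ms). prodpos n r ((\<pi>, X) # L) ms)"
      by (subst sum.reindex) (auto simp: inj_on_def)
    also have "(\<lambda>z. snd z # fst z) ` Sigma ?D (\<lambda>ms. {..<r} - set ms) = positions r (length ((\<pi>, X) # L))"
    proof (intro equalityI subsetI)
      fix ms assume *: "ms \<in> positions r (length ((\<pi>, X) # L))"
      then have "ms = hd ms # tl ms" by (cases ms) (auto simp: positions_def)
      with * show "ms \<in> (\<lambda>z. snd z # fst z) ` Sigma ?D (\<lambda>ms. {..<r} - set ms)"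
        by (intro image_eqI [of _ _ "(tl ms, hd ms)"]) (cases ms; auto simp: positions_def)+
    qed (auto simp: positions_def)
    finally show ?thesis unfolding possum_def .
  qed
  finally show ?thesis by (simp add: possum_def sum_distrib_left)
qed

text \<open>
  By the preceding identity the symmetrized products lie in the algebra generated by the total
  operators of \<open>q(V)\<close>: multiplying by one more total operator gives the longer symmetrized product
  plus shorter ones.
\<close>

lemma commute_possum:
  assumes T: "\<And>\<pi> X. q_homog n \<pi> X \<Longrightarrow> T * total_op n r \<pi> X = total_op n r \<pi> X * T"
  shows "\<forall>x\<in>set L. q_homog n (fst x) (snd x) \<Longrightarrow> T * possum n r L = possum n r L * T"
proof (induction "length L" arbitrary: L)
  case 0
  have "positions r 0 = {[]}" by (auto simp: positions_def)
  with 0 show ?case by (simp add: possum_def prodpos_def)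
next
  case (Suc k)
  then obtain \<pi> X L' where L: "L = (\<pi>, X) # L'" by (cases L) auto
  let ?L = "\<lambda>j. L'[j := (\<pi> + fst (L' ! j), mprod n X (snd (L' ! j)))]"
  let ?e = "\<lambda>j. scal ((-1) ^ (\<pi> * sum_list (map fst (take j L'))))"
  have X: "q_homog n \<pi> X" and L': "\<forall>x\<in>set L'. q_homog n (fst x) (snd x)" using Suc.prems L by auto
  have eq: "possum n r L = total_op n r \<pi> X * possum n r L' - (\<Sum>j<length L'. ?e j * possum n r (?L j))"
    unfolding L using X L' by (subst total_possum) (auto simp: q_homog_def)
  have "T * possum n r L' = possum n r L' * T"
    using Suc.hyps(1) [of L'] Suc.hyps(2) L L' by simp
  then have 1: "T * (total_op n r \<pi> X * possum n r L') = total_op n r \<pi> X * possum n r L' * T"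
    by (metis T [OF X] mult.assoc)
  have "T * possum n r (?L j) = possum n r (?L j) * T" if "j < length L'" for j
  proof (rule Suc.hyps(1))
    show "k = length (?L j)" using Suc.hyps(2) L by simp
    show "\<forall>x\<in>set (?L j). q_homog n (fst x) (snd x)"
    proof
      fix x assume "x \<in> set (?L j)"
      then have "x \<in> insert (\<pi> + fst (L' ! j), mprod n X (snd (L' ! j))) (set L')"
        by (rule subsetD [OF set_update_subset_insert])
      then show "q_homog n (fst x) (snd x)" using L' q_homog_mprod [OF X] that by auto
    qed
  qed
  then have 2: "T * (\<Sum>j<length L'. ?e j * possum n r (?L j)) = (\<Sum>j<length L'. ?e j * possum n r (?L j)) * T"
    by (simp add: sum_distrib_left sum_distrib_right sc_commute' [of T] mult.assoc)
  show ?case unfolding eq right_diff_distrib left_diff_distrib 1 2 ..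
qed


section \<open>The commutant of the Sergeev group\<close>

text \<open>The complex span, generated inductively because scalars act through
  \<open>scal\<close>.\<close>

inductive_set lspan :: "'i lop set \<Rightarrow> 'i lop set" for G where
  zero: "0 \<in> lspan G"
| step: "x \<in> G \<Longrightarrow> y \<in> lspan G \<Longrightarrow> scal c * x + y \<in> lspan G"

lemma lspan_base: "x \<in> G \<Longrightarrow> x \<in> lspan G"
  using lspan.step [of x G 0 1] by (simp add: lspan.zero)

lemma lspan_add: "x \<in> lspan G \<Longrightarrow> y \<in> lspan G \<Longrightarrow> x + y \<in> lspan G"
  by (induction x rule: lspan.induct) (auto simp: add.assoc intro: lspan.intros)

lemma lspan_scal: "x \<in> lspan G \<Longrightarrow> scal c * x \<in> lspan G"
proof (induction x rule: lspan.induct)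
  case (step x y d)
  then show ?case by (simp add: distrib_left scal_fold lspan.step)
qed (simp add: lspan.zero)

lemma lspan_uminus: "x \<in> lspan G \<Longrightarrow> - x \<in> lspan G"
  using lspan_scal [of x G "-1"] by (simp add: scal_minus)

lemma lspan_diff: "x \<in> lspan G \<Longrightarrow> y \<in> lspan G \<Longrightarrow> x - y \<in> lspan G"
  using lspan_add [of x G "- y"] by (simp add: lspan_uminus)

lemma lspan_sum: "(\<And>k. k \<in> K \<Longrightarrow> f k \<in> lspan G) \<Longrightarrow> (\<Sum>k\<in>K. f k) \<in> lspan G"
  by (induction K rule: infinite_finite_induct) (auto intro: lspan_add lspan.zero)

lemma lspan_linear:
  assumes "x \<in> lspan G" and "\<And>x. x \<in> G \<Longrightarrow> F x \<in> lspan H"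
    and "\<And>x y. F (x + y) = F x + F y" "\<And>c x. F (scal c * x) = scal c * F x"
  shows "F x \<in> lspan H"
  using assms(1)
proof (induction x rule: lspan.induct)
  case zero
  have "F 0 = 0" using assms(4) [of 0 0] by simp
  then show ?case by (simp add: lspan.zero)
next
  case (step x y c)
  then show ?case by (simp add: assms lspan_add lspan_scal)
qed

text \<open>Entries from \<open>r\<close> on are pinned to \<open>undefined\<close>, so that a tuple
  is determined by its entries below \<open>r\<close> and there are finitely many.\<close>

definition midxs :: "nat \<Rightarrow> nat \<Rightarrow> midx set" where
  "midxs n r = {..<r} \<rightarrow>\<^sub>E Idx n"

lemma finite_midxs [simp]: "finite (midxs n r)"
  by (simp add: midxs_def finite_PiE)

lemma midxs_iff: "i \<in> midxs n r \<longleftrightarrow> (\<forall>m<r. i m \<in> Idx n) \<and> (\<forall>m\<ge>r. i m = undefined)"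
  by (auto simp: midxs_def PiE_iff extensional_def)

lemma midxs_upd: "m < r \<Longrightarrow> a \<in> Idx n \<Longrightarrow> i \<in> midxs n r \<Longrightarrow> i(m := a) \<in> midxs n r"
  by (auto simp: midxs_iff)

lemma midxs_upd_iff: "m < r \<Longrightarrow> a \<in> Idx n \<Longrightarrow> i m \<in> Idx n \<Longrightarrow> i(m := a) \<in> midxs n r \<longleftrightarrow> i \<in> midxs n r"
  by (auto simp: midxs_iff)

lemma midxs_upd_flip: "m < r \<Longrightarrow> i(m := flip (i m)) \<in> midxs n r \<longleftrightarrow> i \<in> midxs n r"
  by (cases "i m \<in> Idx n") (auto simp: midxs_upd_iff midxs_iff)

lemma midxs_transpose: "Suc a < r \<Longrightarrow> i \<circ> transpose a (Suc a) \<in> midxs n r \<longleftrightarrow> i \<in> midxs n r"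
proof -
  assume "Suc a < r"
  then have "i \<circ> transpose a (Suc a) \<in> midxs n r" if "i \<in> midxs n r" for i
    using that by (auto simp: midxs_iff transpose_def)
  from this [of i] this [of "i \<circ> transpose a (Suc a)"] show ?thesis
    by (auto simp: comp_assoc)
qed

text \<open>The identity of the corner that models the tensor power. The operators of the form
  \<open>midx_proj n r * X * midx_proj n r\<close> make up the full matrix algebra spanned by the
  matrix units, see \<open>corner_expand\<close>.\<close>

definition midx_proj :: "nat \<Rightarrow> nat \<Rightarrow> midx lop" where
  "midx_proj n r = Lop (\<lambda>v i. if i \<in> midxs n r then v i else 0)"

definition mat_unit :: "midx \<Rightarrow> midx \<Rightarrow> midx lop" where
  "mat_unit p q = Lop (\<lambda>v i. if i = p then v q else 0)"

lemma app_midx_proj: "app (midx_proj n r) v i = (if i \<in> midxs n r then v i else 0)"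
  unfolding midx_proj_def by (subst app_Lop) auto

lemma app_mat_unit: "app (mat_unit p q) v i = (if i = p then v q else 0)"
  unfolding mat_unit_def by (subst app_Lop) auto

lemma midx_proj_idem [simp]: "midx_proj n r * midx_proj n r = midx_proj n r"
  by (rule lop_eqI) (simp add: app_midx_proj)

lemma cliff_midx_proj: "m < r \<Longrightarrow> cliff_op m * midx_proj n r = midx_proj n r * cliff_op m"
  by (rule lop_eqI) (simp add: app_midx_proj app_cliff midxs_upd_flip)

lemma swap_midx_proj: "Suc a < r \<Longrightarrow> swap_op a * midx_proj n r = midx_proj n r * swap_op a"
  by (rule lop_eqI) (simp add: app_midx_proj app_swap midxs_transpose)

definition ordered_prod :: "nat \<Rightarrow> nat \<Rightarrow> (nat \<Rightarrow> nat) \<Rightarrow> (nat \<Rightarrow> mat) \<Rightarrow> nat \<Rightarrow> midx lop" where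
  "ordered_prod n r \<pi> Y k = prod_list (map (\<lambda>m. pos_op n r (\<pi> m) (Y m) m) [k..<r])"

lemma ordered_prod_end [simp]: "ordered_prod n r \<pi> Y r = 1"
  by (simp add: ordered_prod_def)

lemma ordered_prod_rec: "k < r \<Longrightarrow> ordered_prod n r \<pi> Y k = pos_op n r (\<pi> k) (Y k) k * ordered_prod n r \<pi> Y (Suc k)"
  by (simp add: ordered_prod_def upt_conv_Cons)

lemma ordered_prod_cong: "(\<And>m. k \<le> m \<Longrightarrow> m < r \<Longrightarrow> Y m = Y' m) \<Longrightarrow> ordered_prod n r \<pi> Y k = ordered_prod n r \<pi> Y' k"
  unfolding ordered_prod_def by (intro arg_cong [where f = prod_list] map_cong) auto

definition elem_mat :: "idx \<Rightarrow> idx \<Rightarrow> mat" where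
  "elem_mat a b = (\<lambda>i j. if i = a \<and> j = b then 1 else 0)"

lemma homog_elem_mat: "homog (ipar a + ipar b) (elem_mat a b)"
  by (auto simp: homog_def elem_mat_def)

lemma elem_mat_gl: "a \<in> Idx n \<Longrightarrow> b \<in> Idx n \<Longrightarrow> elem_mat a b \<in> gl n"
  by (auto simp: elem_mat_def gl_def)

text \<open>On tuples that agree with \<open>p\<close> from \<open>k\<close> on, the Koszul signs
  depend on \<open>p\<close> alone, so they collect into one nonzero constant.\<close>

lemma app_ordered_prod_elem:
  assumes "\<And>m. m < r \<Longrightarrow> q m \<in> Idx n" "k \<le> r"
  shows "\<exists>c\<noteq>0. \<forall>v i. app (ordered_prod n r \<pi> (\<lambda>m. elem_mat (p m) (q m)) k) v i =
    (if \<forall>m\<in>{k..<r}. i m = p m then c * v (\<lambda>m. if m \<in> {k..<r} then q m else i m) else 0)"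
  using assms(2)
proof (induction k rule: inc_induct)
  case base
  show ?case by (intro exI [of _ 1]) simp
next
  case (step k)
  then obtain c where "c \<noteq> 0" and c: "\<And>v i. app (ordered_prod n r \<pi> (\<lambda>m. elem_mat (p m) (q m)) (Suc k)) v i =
    (if \<forall>m\<in>{Suc k..<r}. i m = p m then c * v (\<lambda>m. if m \<in> {Suc k..<r} then q m else i m) else 0)"
    by blast
  let ?e = "((-1) ^ par_sum {k<..<r} p) ^ \<pi> k :: complex"
  have "app (ordered_prod n r \<pi> (\<lambda>m. elem_mat (p m) (q m)) k) v i =
    (if \<forall>m\<in>{k..<r}. i m = p m then ?e * c * v (\<lambda>m. if m \<in> {k..<r} then q m else i m) else 0)" for v i
  proof (cases "\<forall>m\<in>{Suc k..<r}. i m = p m")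
    case True
    then have par_sum: "par_sum {k<..<r} i = par_sum {k<..<r} p"
      by (auto simp: par_sum_def intro!: sum.cong)
    have "{k..<r} = insert k {Suc k..<r}" using step by auto
    with True have eq: "(\<forall>m\<in>{k..<r}. i m = p m) \<longleftrightarrow> i k = p k" by simp
    have upd: "(\<lambda>m. if m \<in> {Suc k..<r} then q m else (i(k := q k)) m) = (\<lambda>m. if m \<in> {k..<r} then q m else i m)"
      using step by auto
    have "(\<Sum>a\<in>Idx n. elem_mat (p k) (q k) (i k) a * app (ordered_prod n r \<pi> (\<lambda>m. elem_mat (p m) (q m)) (Suc k)) v (i(k := a))) =
       (\<Sum>a\<in>Idx n. if a = q k then (if i k = p k then app (ordered_prod n r \<pi> (\<lambda>m. elem_mat (p m) (q m)) (Suc k)) v (i(k := q k)) else 0) else 0)"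
      by (rule sum.cong) (auto simp: elem_mat_def)
    also have "\<dots> = (if i k = p k then app (ordered_prod n r \<pi> (\<lambda>m. elem_mat (p m) (q m)) (Suc k)) v (i(k := q k)) else 0)"
      using assms(1) step by (simp add: sum.delta)
    also have "\<dots> = (if i k = p k then c * v (\<lambda>m. if m \<in> {k..<r} then q m else i m) else 0)"
      unfolding c upd using True by simp
    finally show ?thesis
      unfolding ordered_prod_rec [OF step(2)] app_simps app_pos par_sum eq by auto
  next
    case False
    then have "app (ordered_prod n r \<pi> (\<lambda>m. elem_mat (p m) (q m)) (Suc k)) v (i(k := a)) = 0" for a
      by (subst c) auto
    moreover have "\<not> (\<forall>m\<in>{k..<r}. i m = p m)" using False by auto
    ultimately show ?thesis by (simp only: ordered_prod_rec [OF step(2)] app_simps app_pos if_False) simp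
  qed
  moreover have "?e * c \<noteq> 0" using \<open>c \<noteq> 0\<close> by simp
  ultimately show ?case by blast
qed

text \<open>A product of elementary matrices fixes the entries below \<open>r\<close> only;
  \<open>midx_proj\<close> forces the remaining entries to agree with those of
  \<open>p\<close>.\<close>

lemma mat_unit_ordered_prod:
  assumes p: "p \<in> midxs n r" and q: "q \<in> midxs n r"
  shows "\<exists>c. mat_unit p q = scal c * (midx_proj n r * ordered_prod n r \<pi> (\<lambda>m. elem_mat (p m) (q m)) 0)"
proof -
  obtain c where "c \<noteq> 0" and c: "\<And>v i. app (ordered_prod n r \<pi> (\<lambda>m. elem_mat (p m) (q m)) 0) v i =
    (if \<forall>m\<in>{0..<r}. i m = p m then c * v (\<lambda>m. if m \<in> {0..<r} then q m else i m) else 0)"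
    using app_ordered_prod_elem [of r q n 0 \<pi> p] q by (auto simp: midxs_iff)
  have "mat_unit p q = scal (1 / c) * (midx_proj n r * ordered_prod n r \<pi> (\<lambda>m. elem_mat (p m) (q m)) 0)"
  proof (rule lop_eqI)
    fix v i
    have 1: "i = p" if "i \<in> midxs n r" "\<forall>m\<in>{0..<r}. i m = p m"
    proof
      fix m show "i m = p m"
        using that p by (cases "m < r") (auto simp: midxs_iff)
    qed
    have 2: "(\<lambda>m. if m \<in> {0..<r} then q m else p m) = q"
      using p q by (auto simp: midxs_iff)
    show "app (mat_unit p q) v i = app (scal (1 / c) * (midx_proj n r * ordered_prod n r \<pi> (\<lambda>m. elem_mat (p m) (q m)) 0)) v i"
      using \<open>c \<noteq> 0\<close> 1 2 p by (auto simp: app_midx_proj app_mat_unit c)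
  qed
  then show ?thesis ..
qed

lemma cliff_ordered_prod:
  assumes Y: "\<And>m. m < r \<Longrightarrow> homog (\<pi> m) (Y m)" and "k < r" "a \<le> r"
  shows "cliff_op k * ordered_prod n r \<pi> Y a = ordered_prod n r \<pi> (Y(k := sharp (\<pi> k) (Y k))) a * cliff_op k"
  using assms(3)
proof (induction a rule: inc_induct)
  case (step a)
  let ?Y = "Y(k := sharp (\<pi> k) (Y k))"
  have *: "cliff_op k * pos_op n r (\<pi> a) (Y a) a = pos_op n r (\<pi> a) (?Y a) a * cliff_op k"
    using Y [of a] step assms(2) by (cases "k = a") (auto simp: cliff_pos cliff_pos_same)
  have "cliff_op k * ordered_prod n r \<pi> Y a = (cliff_op k * pos_op n r (\<pi> a) (Y a) a) * ordered_prod n r \<pi> Y (Suc a)"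
    using step by (simp add: ordered_prod_rec mult.assoc)
  also have "\<dots> = pos_op n r (\<pi> a) (?Y a) a * (cliff_op k * ordered_prod n r \<pi> Y (Suc a))"
    unfolding * by (rule mult.assoc)
  also have "\<dots> = ordered_prod n r \<pi> ?Y a * cliff_op k"
    using step unfolding step.IH by (simp add: ordered_prod_rec mult.assoc)
  finally show ?case .
qed simp

lemma pos_lincomb: "pos_op n r \<pi> (\<lambda>i j. c * (X i j + X' i j)) m = scal c * (pos_op n r \<pi> X m + pos_op n r \<pi> X' m)"
  by (rule lop_eqI) (simp add: app_pos algebra_simps sum.distrib sum_distrib_left)

text \<open>Linearity in one factor, in the shape needed for the average of a matrix and its
  \<open>sharp\<close>.\<close>

lemma ordered_prod_lincomb:
  assumes "k < r" "a \<le> k"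
  shows "ordered_prod n r \<pi> (Y(k := \<lambda>i j. c * (X i j + X' i j))) a =
    scal c * (ordered_prod n r \<pi> (Y(k := X)) a + ordered_prod n r \<pi> (Y(k := X')) a)"
  using assms(2)
proof (induction a rule: inc_induct)
  case base
  have *: "ordered_prod n r \<pi> (Y(k := Z)) (Suc k) = ordered_prod n r \<pi> Y (Suc k)" for Z
    by (rule ordered_prod_cong) auto
  show ?case unfolding ordered_prod_rec [OF assms(1)] * fun_upd_same pos_lincomb
    by (simp only: distrib_right mult.assoc distrib_left)
next
  case (step a)
  then have a: "a < r" and ak: "a \<noteq> k" using assms(1) by auto
  show ?case unfolding ordered_prod_rec [OF a] fun_upd_other [OF ak] step.IH
    by (simp only: sc_commute' [of "pos_op _ _ _ _ _"] distrib_left)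
qed

lemma homog_sharp: "homog \<pi> X \<Longrightarrow> homog \<pi> (sharp \<pi> X)"
  unfolding homog_def sharp_def
proof (intro allI impI)
  fix i j assume X: "\<forall>i j. X i j \<noteq> 0 \<longrightarrow> even (ipar i + ipar j) = even \<pi>"
    and "(-1) ^ \<pi> * X (flip i) (flip j) \<noteq> 0"
  then have "even (ipar (flip i) + ipar (flip j)) = even \<pi>" by simp
  then show "even (ipar i + ipar j) = even \<pi>" by (cases i; cases j) auto
qed

lemma q_homog_average:
  assumes X: "homog \<pi> X" "X \<in> gl n"
  shows "q_homog n \<pi> (\<lambda>i j. (1 / 2) * (X i j + sharp \<pi> X i j))"
  unfolding q_homog_def
proof (intro conjI)
  show "homog \<pi> (\<lambda>i j. (1 / 2) * (X i j + sharp \<pi> X i j))"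
  proof (unfold homog_def, intro allI impI)
    fix i j assume "(1 / 2) * (X i j + sharp \<pi> X i j) \<noteq> 0"
    then have "X i j \<noteq> 0 \<or> sharp \<pi> X i j \<noteq> 0" by auto
    then show "even (ipar i + ipar j) = even \<pi>"
      using X homog_sharp [OF X(1)] unfolding homog_def by blast
  qed
  show "(\<lambda>i j. (1 / 2) * (X i j + sharp \<pi> X i j)) \<in> gl n"
    using X by (auto simp: gl_def sharp_def)
  show "sharp \<pi> (\<lambda>i j. (1 / 2) * (X i j + sharp \<pi> X i j)) = (\<lambda>i j. (1 / 2) * (X i j + sharp \<pi> X i j))"
    by (auto simp: sharp_def fun_eq_iff algebra_simps)
qed

text \<open>Interpolates between all products of homogeneous matrices, for \<open>k = 0\<close>, and
  products with every factor in q(V), for \<open>k = r\<close>; the first \<open>k\<close> positions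
  have already been averaged.\<close>

definition qprods :: "nat \<Rightarrow> nat \<Rightarrow> nat \<Rightarrow> midx lop set" where
  "qprods n r k = {midx_proj n r * ordered_prod n r \<pi> Y 0 | \<pi> Y.
     (\<forall>m<r. homog (\<pi> m) (Y m) \<and> Y m \<in> gl n) \<and> (\<forall>m<k. q_homog n (\<pi> m) (Y m))}"

lemma mat_unit_qprods:
  assumes "p \<in> midxs n r" "q \<in> midxs n r"
  shows "mat_unit p q \<in> lspan (qprods n r 0)"
proof -
  obtain c where "mat_unit p q = scal c * (midx_proj n r * ordered_prod n r (\<lambda>m. ipar (p m) + ipar (q m)) (\<lambda>m. elem_mat (p m) (q m)) 0)"
    using mat_unit_ordered_prod [OF assms] by blast
  moreover have "midx_proj n r * ordered_prod n r (\<lambda>m. ipar (p m) + ipar (q m)) (\<lambda>m. elem_mat (p m) (q m)) 0 \<in> qprods n r 0"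
    unfolding qprods_def using assms
    by (intro CollectI exI conjI refl) (auto simp: homog_elem_mat elem_mat_gl midxs_iff)
  ultimately show ?thesis by (simp add: lspan_scal lspan_base)
qed

text \<open>Averaging over conjugation by \<open>cliff_op k\<close> moves the \<open>k\<close>-th factor into \<open>q(V)\<close>; \<open>cliff_op k\<close> squares to \<open>-1\<close>.\<close>

lemma qprods_average:
  assumes "k < r" and E: "E \<in> lspan (qprods n r k)" and "cliff_op k * E = E * cliff_op k"
  shows "E \<in> lspan (qprods n r (Suc k))"
proof -
  define F where "F = (\<lambda>x. scal (1 / 2) * (x - cliff_op k * (x * cliff_op k)))"
  have "F E = scal (1 / 2) * (E + E)"
    using assms(3) by (simp add: F_def cliff_cliff mult.assoc flip: assms(3)) (simp add: cliff_cliff mult.assoc [symmetric])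
  also have "E + E = scal 2 * E"
    by (rule lop_eqI) simp
  also have "scal (1 / 2) * (scal 2 * E) = E" by (simp add: scal_fold)
  finally have "F E = E" .
  moreover have "F E \<in> lspan (qprods n r (Suc k))"
  proof (rule lspan_linear [OF E])
    fix x assume "x \<in> qprods n r k"
    then obtain \<pi> Y where x: "x = midx_proj n r * ordered_prod n r \<pi> Y 0" and
      Y: "\<And>m. m < r \<Longrightarrow> homog (\<pi> m) (Y m)" "\<And>m. m < r \<Longrightarrow> Y m \<in> gl n" "\<And>m. m < k \<Longrightarrow> q_homog n (\<pi> m) (Y m)"
      by (auto simp: qprods_def)
    let ?Z = "\<lambda>i j. (1 / 2) * (Y k i j + sharp (\<pi> k) (Y k) i j)"
    have "cliff_op k * (x * cliff_op k) = midx_proj n r * (cliff_op k * ordered_prod n r \<pi> Y 0 * cliff_op k)"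
      unfolding x by (metis cliff_midx_proj [OF assms(1)] mult.assoc)
    also have "\<dots> = - (midx_proj n r * ordered_prod n r \<pi> (Y(k := sharp (\<pi> k) (Y k))) 0)"
      by (subst cliff_ordered_prod [OF Y(1) assms(1)]) (simp_all add: mult.assoc cliff_cliff)
    finally have "F x = midx_proj n r * (scal (1 / 2) * (ordered_prod n r \<pi> (Y(k := Y k)) 0 + ordered_prod n r \<pi> (Y(k := sharp (\<pi> k) (Y k))) 0))"
      by (simp add: F_def x distrib_left sc_commute' [of "midx_proj n r"])
    also have "\<dots> = midx_proj n r * ordered_prod n r \<pi> (Y(k := ?Z)) 0"
      by (subst ordered_prod_lincomb [OF assms(1)]) simp_all
    also have "\<dots> \<in> qprods n r (Suc k)"
      unfolding qprods_def using Y q_homog_average [OF Y(1,2) [OF assms(1)]] assms(1)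
      by (intro CollectI exI [of _ \<pi>] exI [of _ "Y(k := ?Z)"] conjI refl) (auto simp: q_homog_def less_Suc_eq)
    finally show "F x \<in> lspan (qprods n r (Suc k))" by (rule lspan_base)
  qed (simp_all add: F_def algebra_simps sc_commute' [of "cliff_op k"] scal_fold)
  ultimately show ?thesis by simp
qed


section \<open>Permutations of the tensor factors\<close>

inductive_set swaps :: "nat \<Rightarrow> midx lop set" for r where
  one: "1 \<in> swaps r"
| step: "g \<in> swaps r \<Longrightarrow> Suc a < r \<Longrightarrow> swap_op a * g \<in> swaps r"

lemma swaps_mult: "g \<in> swaps r \<Longrightarrow> h \<in> swaps r \<Longrightarrow> g * h \<in> swaps r"
  by (induction g rule: swaps.induct) (auto simp: mult.assoc intro: swaps.step)

lemma swaps_commute: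
  assumes "g \<in> swaps r" "\<And>a. Suc a < r \<Longrightarrow> swap_op a * E = E * swap_op a"
  shows "g * E = E * g"
  using assms(1)
proof (induction g rule: swaps.induct)
  case (step g a)
  then show ?case by (metis assms(2) mult.assoc)
qed simp

text \<open>The operator of a permutation carries signs and has no short formula. What is recorded
  is its effect on operators at one position, together with an inverse.\<close>

definition realizes :: "nat \<Rightarrow> (nat \<Rightarrow> nat) \<Rightarrow> midx lop \<Rightarrow> midx lop \<Rightarrow> bool" where
  "realizes r p g g' \<longleftrightarrow> g \<in> swaps r \<and> g' \<in> swaps r \<and> g * g' = 1 \<and> g' * g = 1 \<and>
     (\<forall>n \<pi> X m. homog \<pi> X \<longrightarrow> g * pos_op n r \<pi> X m = pos_op n r \<pi> X (p m) * g)"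

lemma realizes_id: "realizes r id 1 1"
  by (simp add: realizes_def swaps.one)

lemma realizes_comp:
  assumes "realizes r p g g'" "realizes r q h h'"
  shows "realizes r (p \<circ> q) (g * h) (h' * g')"
  unfolding realizes_def
proof (intro conjI allI impI)
  show "g * h \<in> swaps r" "h' * g' \<in> swaps r"
    using assms by (auto simp: realizes_def intro: swaps_mult)
  show "g * h * (h' * g') = 1" "h' * g' * (g * h) = 1"
    using assms unfolding realizes_def by (metis mult.assoc mult.right_neutral)+
  fix n \<pi> X m assume "homog \<pi> (X :: mat)"
  then have "g * pos_op n r \<pi> X (q m) = pos_op n r \<pi> X (p (q m)) * g" "h * pos_op n r \<pi> X m = pos_op n r \<pi> X (q m) * h"
    using assms unfolding realizes_def by blast+
  then show "g * h * pos_op n r \<pi> X m = pos_op n r \<pi> X ((p \<circ> q) m) * (g * h)"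
    by (metis comp_apply mult.assoc)
qed

lemma realizes_adjacent:
  assumes "Suc a < r"
  shows "realizes r (transpose a (Suc a)) (swap_op a) (swap_op a)"
proof -
  have "swap_op a * pos_op n r \<pi> X m = pos_op n r \<pi> X (transpose a (Suc a) m) * swap_op a" if "homog \<pi> X" for n \<pi> X m
    unfolding swap_pos [OF assms that, symmetric] by (simp add: mult.assoc)
  then show ?thesis
    using swaps.step [OF swaps.one assms] by (simp add: realizes_def)
qed

lemma realizes_transpose_less: "a < b \<Longrightarrow> b < r \<Longrightarrow> \<exists>g g'. realizes r (transpose a b) g g'"
proof (induction b)
  case (Suc b)
  show ?case
  proof (cases "a = b")
    case True
    then show ?thesis using realizes_adjacent Suc.prems by blast
  next
    case False
    then obtain g g' where "realizes r (transpose a b) g g'" using Suc by auto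
    note realizes_comp [OF realizes_comp [OF realizes_adjacent this] realizes_adjacent, OF Suc.prems(2) Suc.prems(2)]
    moreover have "transpose b (Suc b) \<circ> transpose a b \<circ> transpose b (Suc b) = transpose a (Suc b)"
      using False Suc.prems by (auto simp: fun_eq_iff transpose_def)
    ultimately show ?thesis by auto
  qed
qed simp

lemma realizes_permutes:
  assumes "p permutes {..<r}"
  shows "\<exists>g g'. realizes r p g g'"
  using assms finite_lessThan [of r]
proof (induction p rule: permutes_induct)
  case (swap a b p)
  from swap.IH obtain g g' where g: "realizes r p g g'" by blast
  have "\<exists>h h'. realizes r (transpose a b) h h'"
    using realizes_transpose_less [of a b r] realizes_transpose_less [of b a r] swap.hyps(1,2) realizes_id [of r]
    by (cases a b rule: linorder_cases) (auto simp: transpose_commute)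
  then show ?case using realizes_comp g by blast
qed (use realizes_id in blast)

lemma realizes_positions:
  assumes "ms \<in> positions r r"
  shows "\<exists>p g g'. realizes r p g g' \<and> (\<forall>m<r. p m = ms ! m)"
proof -
  have ms: "length ms = r" "distinct ms" "set ms \<subseteq> {..<r}" using assms by (auto simp: positions_def)
  then have set: "set ms = {..<r}"
    by (metis card_lessThan card_subset_eq distinct_card finite_lessThan)
  let ?p = "\<lambda>m. if m < r then ms ! m else m"
  have "bij_betw (\<lambda>m. ms ! m) {..<r} {..<r}"
    by (rule bij_betw_nth) (simp_all only: ms(1,2) set)
  moreover have "bij_betw ?p {..<r} {..<r} \<longleftrightarrow> bij_betw (\<lambda>m. ms ! m) {..<r} {..<r}"
    by (rule bij_betw_cong) simp
  ultimately have "bij_betw ?p {..<r} {..<r}" by blast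
  then have "?p permutes {..<r}" by (intro bij_imp_permutes) auto
  from realizes_permutes [OF this] obtain g g' where "realizes r ?p g g'" by blast
  then show ?thesis by (intro exI [of _ ?p] exI [of _ g] exI [of _ g']) simp
qed

definition mat_units :: "nat \<Rightarrow> nat \<Rightarrow> midx lop set" where
  "mat_units n r = {mat_unit p q | p q. p \<in> midxs n r \<and> q \<in> midxs n r}"

text \<open>Conjugation moves each factor to its new position but keeps the order of multiplication,
  so no reordering sign appears.\<close>

lemma realizes_ordered_prod:
  assumes "realizes r p g g'" "\<And>m. m < r \<Longrightarrow> p m = ms ! m" "length ms = r"
    "\<And>m. m < r \<Longrightarrow> homog (\<pi> m) (Y m)"
  shows "g * (ordered_prod n r \<pi> Y 0 * g') = prodpos n r (map (\<lambda>m. (\<pi> m, Y m)) [0..<r]) ms"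
proof -
  have "g * ordered_prod n r \<pi> Y k = prodpos n r (map (\<lambda>m. (\<pi> m, Y m)) [k..<r]) (drop k ms) * g" if "k \<le> r" for k
    using that
  proof (induction k rule: inc_induct)
    case base
    then show ?case using assms(3) by (simp add: prodpos_def)
  next
    case (step k)
    have "g * ordered_prod n r \<pi> Y k = (g * pos_op n r (\<pi> k) (Y k) k) * ordered_prod n r \<pi> Y (Suc k)"
      using step by (simp add: ordered_prod_rec mult.assoc)
    also have "g * pos_op n r (\<pi> k) (Y k) k = pos_op n r (\<pi> k) (Y k) (ms ! k) * g"
      using assms(1,2,4) step unfolding realizes_def by metis
    finally show ?case
      using step assms(3) by (simp add: mult.assoc upt_conv_Cons Cons_nth_drop_Suc [symmetric] prodpos_Cons)
  qed
  from this [of 0] have "g * ordered_prod n r \<pi> Y 0 * g' = prodpos n r (map (\<lambda>m. (\<pi> m, Y m)) [0..<r]) ms * (g * g')"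
    by (simp add: mult.assoc)
  then show ?thesis using assms(1) by (simp add: realizes_def mult.assoc)
qed

lemma commute_lspan:
  assumes "x \<in> lspan G" "\<And>x. x \<in> G \<Longrightarrow> T * x = x * T"
  shows "T * x = x * T"
  using assms(1)
proof (induction x rule: lspan.induct)
  case (step x y c)
  then show ?case by (simp add: distrib_left distrib_right sc_commute' [of T] assms(2) mult.assoc)
qed simp

lemma sum_const_lop: "(\<Sum>k\<in>K. x) = scal (of_nat (card K)) * x"
  by (rule lop_eqI) (simp only: app_sum app_simps, simp)

text \<open>Averaging over the operators \<open>cliff_op k\<close>, one position at a time, writes
  \<open>E\<close> through products of elements of q(V). Averaging over permutations then turns
  these products into symmetrized ones, with which \<open>T\<close> commutes.\<close>

lemma commute_commutant:
  assumes T: "\<And>\<pi> X. q_homog n \<pi> X \<Longrightarrow> T * total_op n r \<pi> X = total_op n r \<pi> X * T"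
    and "T * midx_proj n r = midx_proj n r * T"
    and E: "E \<in> lspan (mat_units n r)"
    and cliff_op: "\<And>m. m < r \<Longrightarrow> cliff_op m * E = E * cliff_op m"
    and swap_op: "\<And>a. Suc a < r \<Longrightarrow> swap_op a * E = E * swap_op a"
  shows "T * E = E * T"
proof -
  have E0: "E \<in> lspan (qprods n r k)" if "k \<le> r" for k
    using that
  proof (induction k)
    case 0
    show ?case
      by (rule lspan_linear [OF E, of "\<lambda>x. x"]) (use mat_unit_qprods in \<open>auto simp: mat_units_def\<close>)
  next
    case (Suc k)
    then show ?case using qprods_average cliff_op by simp
  qed
  \<comment> \<open>One conjugating operator has to be fixed for each list of positions,
    independently of the product it is applied to; \<open>R\<close> states what this choice must
    satisfy.\<close>
  define R where "R = (\<lambda>ms (g, g'). g \<in> swaps r \<and> g * g' = 1 \<and> (\<forall>\<pi> Y. (\<forall>m<r. homog (\<pi> m) (Y m)) \<longrightarrow>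
      g * (ordered_prod n r \<pi> Y 0 * g') = prodpos n r (map (\<lambda>m. (\<pi> m, Y m)) [0..<r]) ms))"
  have "\<exists>z. R ms z" if ms: "ms \<in> positions r r" for ms
  proof -
    obtain p g g' where g: "realizes r p g g'" and "\<forall>m<r. p m = ms ! m"
      using realizes_positions [OF ms] by blast
    then have p: "\<And>m. m < r \<Longrightarrow> p m = ms ! m" by blast
    have "length ms = r" using ms by (simp add: positions_def)
    then have "\<forall>\<pi> Y. (\<forall>m<r. homog (\<pi> m) (Y m)) \<longrightarrow>
      g * (ordered_prod n r \<pi> Y 0 * g') = prodpos n r (map (\<lambda>m. (\<pi> m, Y m)) [0..<r]) ms"
      by (intro allI impI realizes_ordered_prod [OF g p]) auto
    moreover have "g \<in> swaps r \<and> g * g' = 1" using g by (simp add: realizes_def)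
    ultimately show ?thesis by (intro exI [of _ "(g, g')"]) (simp add: R_def)
  qed
  then obtain z where z: "\<And>ms. ms \<in> positions r r \<Longrightarrow> R ms (z ms)" by metis
  define g g' where "g ms = fst (z ms)" and "g' ms = snd (z ms)" for ms
  have R: "R ms (g ms, g' ms)" if "ms \<in> positions r r" for ms
    using z [OF that] by (simp add: g_def g'_def)
  have gg: "g ms \<in> swaps r" "g ms * g' ms = 1" if "ms \<in> positions r r" for ms
    using R [OF that] unfolding R_def by blast+
  have conj: "g ms * (ordered_prod n r \<pi> Y 0 * g' ms) = prodpos n r (map (\<lambda>m. (\<pi> m, Y m)) [0..<r]) ms"
    if "ms \<in> positions r r" "\<And>m. m < r \<Longrightarrow> homog (\<pi> m) (Y m)" for ms \<pi> Y
    using R [OF that(1)] that(2) unfolding R_def by blast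
  \<comment> \<open>The sum over all conjugates multiplies \<open>E\<close> by the number of
    arrangements, since \<open>E\<close> commutes with the swaps, and sends a product of elements of
    q(V) to a symmetrized product.\<close>
  define F where "F = (\<lambda>x. \<Sum>ms\<in>positions r r. g ms * (x * g' ms))"
  have "F E = (\<Sum>ms\<in>positions r r. E)"
    unfolding F_def
  proof (rule sum.cong [OF refl])
    fix ms assume ms: "ms \<in> positions r r"
    have "g ms * (E * g' ms) = E * (g ms * g' ms)"
      by (metis swaps_commute [OF gg(1) [OF ms] swap_op] mult.assoc)
    then show "g ms * (E * g' ms) = E" by (simp add: gg(2) [OF ms])
  qed
  then have FE: "F E = scal (of_nat (card (positions r r))) * E"
    by (simp only: sum_const_lop)
  let ?Q = "{midx_proj n r * possum n r L | L. \<forall>x\<in>set L. q_homog n (fst x) (snd x)}"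
  have "F E \<in> lspan ?Q"
  proof (rule lspan_linear [OF E0 [OF order_refl]])
    fix x assume "x \<in> qprods n r r"
    then obtain \<pi> Y where x: "x = midx_proj n r * ordered_prod n r \<pi> Y 0" and
      Y: "\<And>m. m < r \<Longrightarrow> homog (\<pi> m) (Y m)" "\<And>m. m < r \<Longrightarrow> q_homog n (\<pi> m) (Y m)"
      by (auto simp: qprods_def)
    let ?L = "map (\<lambda>m. (\<pi> m, Y m)) [0..<r]"
    have "F x = (\<Sum>ms\<in>positions r r. midx_proj n r * prodpos n r ?L ms)"
      unfolding F_def
    proof (rule sum.cong [OF refl])
      fix ms assume ms: "ms \<in> positions r r"
      have "g ms * midx_proj n r = midx_proj n r * g ms"
        by (rule swaps_commute [OF gg(1) [OF ms]]) (rule swap_midx_proj)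
      then have "g ms * (x * g' ms) = midx_proj n r * (g ms * (ordered_prod n r \<pi> Y 0 * g' ms))"
        unfolding x by (metis mult.assoc)
      then show "g ms * (x * g' ms) = midx_proj n r * prodpos n r ?L ms"
        using conj [OF ms Y(1)] by simp
    qed
    also have "\<dots> = midx_proj n r * possum n r ?L"
      by (simp add: possum_def sum_distrib_left)
    also have "\<dots> \<in> ?Q" using Y by force
    finally show "F x \<in> lspan ?Q" by (rule lspan_base)
  qed (simp_all add: F_def distrib_left distrib_right sum.distrib mult.assoc sc_commute' [of "g _"] sum_distrib_left)
  then have "T * F E = F E * T"
  proof (rule commute_lspan)
    fix x assume "x \<in> ?Q"
    then obtain L where "x = midx_proj n r * possum n r L" "\<forall>x\<in>set L. q_homog n (fst x) (snd x)" by blast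
    then show "T * x = x * T" using commute_possum [OF T] assms(2) by (metis mult.assoc)
  qed
  moreover have "card (positions r r) \<noteq> 0"
  proof -
    have "[0..<r] \<in> positions r r" by (auto simp: positions_def)
    then show ?thesis by auto
  qed
  then have "E = scal (1 / of_nat (card (positions r r))) * F E"
    unfolding FE by (simp add: scal_fold)
  ultimately show ?thesis by (metis mult.assoc scal_commute)
qed


section \<open>The double commutant\<close>

definition delta :: "midx \<Rightarrow> midx \<Rightarrow> complex" where
  "delta q = (\<lambda>i. if i = q then 1 else 0)"

lemma mat_unit_sandwich: "mat_unit k p * X * mat_unit q l = scal (app X (delta q) p) * mat_unit k l"
proof (rule lop_eqI)
  fix v i
  have "app (mat_unit q l) v = (\<lambda>i. v l * delta q i)"
    by (auto simp: app_mat_unit delta_def)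
  then show "app (mat_unit k p * X * mat_unit q l) v i = app (scal (app X (delta q) p) * mat_unit k l) v i"
    by (simp add: app_mat_unit app_scale)
qed

lemma midx_proj_eq_sum: "midx_proj n r = (\<Sum>k\<in>midxs n r. mat_unit k k)"
  by (rule lop_eqI) (simp add: app_midx_proj app_mat_unit)

lemma midx_proj_mat_unit: "p \<in> midxs n r \<Longrightarrow> midx_proj n r * mat_unit p q = mat_unit p q"
  by (rule lop_eqI) (auto simp: app_midx_proj app_mat_unit)

lemma mat_unit_midx_proj: "q \<in> midxs n r \<Longrightarrow> mat_unit p q * midx_proj n r = mat_unit p q"
  by (rule lop_eqI) (auto simp: app_midx_proj app_mat_unit)

lemma corner_expand:
  "midx_proj n r * X * midx_proj n r = (\<Sum>p\<in>midxs n r. \<Sum>q\<in>midxs n r. scal (app X (delta q) p) * mat_unit p q)"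
proof -
  have "midx_proj n r * X * midx_proj n r = (\<Sum>p\<in>midxs n r. mat_unit p p * X) * (\<Sum>q\<in>midxs n r. mat_unit q q)"
    unfolding midx_proj_eq_sum sum_distrib_right ..
  then show ?thesis unfolding sum_product mat_unit_sandwich .
qed

lemma corner_lspan: "midx_proj n r * X * midx_proj n r \<in> lspan (mat_units n r)"
  unfolding corner_expand
  by (intro lspan_sum lspan_scal lspan_base) (auto simp: mat_units_def)

lemma lspan_fixed:
  assumes "x \<in> lspan G" "\<And>x. x \<in> G \<Longrightarrow> F x = x"
    and "\<And>x y. F (x + y) = F x + F y" "\<And>c x. F (scal c * x) = scal c * F x"
  shows "F x = x"
  using assms(1)
proof (induction x rule: lspan.induct)
  case zero
  show ?case using assms(4) [of 0 0] by simp
next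
  case (step x y c)
  then show ?case by (simp add: assms)
qed

lemma lspan_midx_proj:
  assumes "x \<in> lspan (mat_units n r)"
  shows "midx_proj n r * x = x" "x * midx_proj n r = x"
proof -
  show "midx_proj n r * x = x"
    by (rule lspan_fixed [OF assms])
      (auto simp: mat_units_def midx_proj_mat_unit distrib_left sc_commute' [of "midx_proj n r"])
  show "x * midx_proj n r = x"
    by (rule lspan_fixed [OF assms])
      (auto simp: mat_units_def mat_unit_midx_proj distrib_right mult.assoc)
qed

text \<open>
  Maps \<open>X \<mapsto> (\<Sum>k. y\<^sub>k X z\<^sub>k)\<close>. Averaging such a map over the group replaces each \<open>y\<^sub>k\<close> by an element of the
  commutant of the group.
\<close>

inductive bimod :: "nat \<Rightarrow> nat \<Rightarrow> (midx lop \<Rightarrow> midx lop) \<Rightarrow> bool" for n r where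
  zero: "bimod n r (\<lambda>X. 0)"
| add: "bimod n r F \<Longrightarrow> bimod n r G \<Longrightarrow> bimod n r (\<lambda>X. F X + G X)"
| base: "y \<in> lspan (mat_units n r) \<Longrightarrow> bimod n r (\<lambda>X. y * X * z)"

lemma bimod_mult: "bimod n r F \<Longrightarrow> y \<in> lspan (mat_units n r) \<Longrightarrow> bimod n r (\<lambda>X. y * F X * z)"
proof (induction F rule: bimod.induct)
  case zero
  then show ?case by (simp add: bimod.zero)
next
  case (add F G)
  then show ?case by (simp add: distrib_left distrib_right bimod.add)
next
  case (base y' z')
  have "y * y' = midx_proj n r * (y * y') * midx_proj n r"
    using lspan_midx_proj [OF base(1)] lspan_midx_proj [OF base(2)] by (metis mult.assoc)
  then have "y * y' \<in> lspan (mat_units n r)" by (metis corner_lspan)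
  from bimod.base [OF this, of "z' * z"] show ?case by (simp add: mult.assoc)
qed

lemma bimod_comp: "bimod n r F \<Longrightarrow> bimod n r G \<Longrightarrow> bimod n r (\<lambda>X. F (G X))"
  by (induction F rule: bimod.induct) (simp_all add: bimod.zero bimod.add bimod_mult)

lemma bimod_sum: "finite K \<Longrightarrow> (\<And>k. k \<in> K \<Longrightarrow> bimod n r (F k)) \<Longrightarrow> bimod n r (\<lambda>X. \<Sum>k\<in>K. F k X)"
  by (induction K rule: finite_induct) (simp_all add: bimod.zero bimod.add)

text \<open>Summing \<open>mat_unit k p * X * mat_unit q k\<close> over \<open>k\<close> gives the
  entry of \<open>X\<close> at \<open>(p, q)\<close> times the identity of the corner, so reading
  off a matrix entry is itself a map of the required form.\<close>

lemma bimod_entry: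
  assumes \<gamma>: "\<gamma> \<in> lspan (mat_units n r)" and q: "q \<in> midxs n r" and p: "p \<in> midxs n r"
  shows "bimod n r (\<lambda>X. scal (app X (delta q) p) * \<gamma>)"
proof -
  have "bimod n r (\<lambda>X. \<Sum>k\<in>midxs n r. \<gamma> * mat_unit k p * X * mat_unit q k)"
  proof (rule bimod_sum [OF finite_midxs])
    fix k assume k: "k \<in> midxs n r"
    have "\<gamma> * mat_unit k p = midx_proj n r * (\<gamma> * mat_unit k p) * midx_proj n r"
      using lspan_midx_proj [OF \<gamma>] mat_unit_midx_proj [OF p] by (metis mult.assoc)
    then have "\<gamma> * mat_unit k p \<in> lspan (mat_units n r)" by (metis corner_lspan)
    then show "bimod n r (\<lambda>X. \<gamma> * mat_unit k p * X * mat_unit q k)" by (rule bimod.base)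
  qed
  moreover have "(\<Sum>k\<in>midxs n r. \<gamma> * mat_unit k p * X * mat_unit q k) = scal (app X (delta q) p) * \<gamma>" for X
  proof -
    have "(\<Sum>k\<in>midxs n r. \<gamma> * mat_unit k p * X * mat_unit q k) =
        (\<Sum>k\<in>midxs n r. scal (app X (delta q) p) * (\<gamma> * mat_unit k k))"
      using mat_unit_sandwich by (metis (no_types, opaque_lifting) mult.assoc sc_commute')
    also have "\<dots> = scal (app X (delta q) p) * (\<gamma> * midx_proj n r)"
      unfolding midx_proj_eq_sum sum_distrib_left ..
    finally show ?thesis by (simp add: lspan_midx_proj [OF \<gamma>])
  qed
  ultimately show ?thesis by simp
qed

lemma corner_eq_0:
  assumes x: "x \<in> lspan (mat_units n r)" and "\<And>p q. p \<in> midxs n r \<Longrightarrow> q \<in> midxs n r \<Longrightarrow> app x (delta q) p = 0"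
  shows "x = 0"
proof -
  have "x = midx_proj n r * x * midx_proj n r" using lspan_midx_proj [OF x] by simp
  also have "\<dots> = 0" unfolding corner_expand using assms(2) by simp
  finally show ?thesis .
qed

lemma lspan_mono: "G \<subseteq> H \<Longrightarrow> x \<in> lspan G \<Longrightarrow> x \<in> lspan H"
  by (rule lspan_linear [of x G "\<lambda>x. x"]) (auto intro: lspan_base)

text \<open>Gram-Schmidt with matrix entries as functionals. If \<open>e\<close> does not fix the
  new element, the remainder \<open>\<gamma>'\<close> has a nonzero entry. Reading off this entry
  from the remainder of \<open>X\<close> yields a correction term that vanishes on the elements
  already fixed.\<close>

lemma projection_exists:
  assumes "finite \<Gamma>" "\<Gamma> \<subseteq> lspan (mat_units n r)"
  shows "\<exists>e. bimod n r e \<and> (\<forall>X. e X \<in> lspan \<Gamma>) \<and> (\<forall>x\<in>\<Gamma>. e x = x)"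
  using assms
proof (induction \<Gamma> rule: finite_induct)
  case empty
  then show ?case using bimod.zero [of n r] lspan.zero by blast
next
  case (insert \<gamma> \<Gamma>)
  then obtain e where e: "bimod n r e" "\<And>X. e X \<in> lspan \<Gamma>" "\<And>x. x \<in> \<Gamma> \<Longrightarrow> e x = x" by auto
  have mono: "lspan \<Gamma> \<subseteq> lspan (insert \<gamma> \<Gamma>)" using lspan_mono by blast
  show ?case
  proof (cases "e \<gamma> = \<gamma>")
    case True
    then show ?thesis using e mono by blast
  next
    case False
    define \<gamma>' where "\<gamma>' = \<gamma> - e \<gamma>"
    have "lspan \<Gamma> \<subseteq> lspan (mat_units n r)"
      using lspan_linear [of _ \<Gamma> "\<lambda>x. x" "mat_units n r"] insert.prems by blast
    then have corner: "\<gamma>' \<in> lspan (mat_units n r)"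
      unfolding \<gamma>'_def using e(2) insert.prems by (intro lspan_diff) auto
    obtain p q where pq: "p \<in> midxs n r" "q \<in> midxs n r" and nz: "app \<gamma>' (delta q) p \<noteq> 0"
      using corner_eq_0 [OF corner] False unfolding \<gamma>'_def by auto
    define \<phi> where "\<phi> = (\<lambda>X. app X (delta q) p)"
    define \<gamma>'' where "\<gamma>'' = scal (1 / \<phi> \<gamma>') * \<gamma>'"
    have b: "bimod n r (\<lambda>X. scal (\<phi> X) * y)" if "y \<in> lspan (mat_units n r)" for y
      unfolding \<phi>_def using bimod_entry [OF that pq(2,1)] .
    have c: "\<gamma>'' \<in> lspan (mat_units n r)" "- \<gamma>'' \<in> lspan (mat_units n r)"
      unfolding \<gamma>''_def using corner by (auto intro: lspan_scal lspan_uminus)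
    \<comment> \<open>This is \<open>e X + scal (\<phi> (X - e X)) * \<gamma>''\<close>, split into
      summands that are visibly of the form \<open>bimod\<close>.\<close>
    let ?e = "\<lambda>X. e X + (scal (\<phi> X) * \<gamma>'' + scal (\<phi> (e X)) * - \<gamma>'')"
    have *: "?e X = e X + scal (\<phi> (X - e X)) * \<gamma>''" for X
      unfolding \<phi>_def app_simps diff_conv_add_uminus scal_add scal_minus distrib_right by simp
    have "bimod n r ?e"
      by (intro bimod.add e(1) b c bimod_comp [OF b e(1)])
    moreover have "?e X \<in> lspan (insert \<gamma> \<Gamma>)" for X
      unfolding \<gamma>''_def \<gamma>'_def using e(2) mono
      by (intro lspan_add lspan_scal lspan_uminus lspan_diff) (auto intro: lspan_base)
    moreover have "?e x = x" if "x \<in> insert \<gamma> \<Gamma>" for x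
    proof (cases "x = \<gamma>")
      case True
      have "scal (\<phi> \<gamma>') * \<gamma>'' = \<gamma>'"
        using nz by (simp add: \<gamma>''_def scal_fold \<phi>_def)
      then show ?thesis unfolding * True by (simp add: \<gamma>'_def)
    next
      case False
      then have "e x = x" using that e(3) by blast
      then show ?thesis unfolding * by (simp add: \<phi>_def)
    qed
    ultimately show ?thesis by blast
  qed
qed

section \<open>The Sergeev group\<close>

inductive_set cliffords :: "nat \<Rightarrow> midx lop set" for r where
  one: "1 \<in> cliffords r"
| step: "c \<in> cliffords r \<Longrightarrow> m < r \<Longrightarrow> cliff_op m * c \<in> cliffords r"

text \<open>Swaps stand to the left of the Clifford part. This normal form is preserved under
  products, by \<open>sergeev_cliff\<close>, and it lets \<open>group_tensor_sergeev\<close> strip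
  off the swaps until only Clifford operators remain.\<close>

inductive_set sergeev :: "nat \<Rightarrow> midx lop set" for r where
  base: "c \<in> cliffords r \<Longrightarrow> c \<in> sergeev r"
| step: "h \<in> sergeev r \<Longrightarrow> Suc a < r \<Longrightarrow> swap_op a * h \<in> sergeev r"

lemma sergeev_cliff: "h \<in> sergeev r \<Longrightarrow> m < r \<Longrightarrow> cliff_op m * h \<in> sergeev r"
proof (induction h arbitrary: m rule: sergeev.induct)
  case (base c)
  then show ?case by (auto intro: sergeev.base cliffords.step)
next
  case (step h a)
  have "transpose a (Suc a) m < r" using step by (auto simp: transpose_def)
  then have "swap_op a * (cliff_op (transpose a (Suc a) m) * h) \<in> sergeev r"
    using step by (intro sergeev.step) auto
  also have "swap_op a * (cliff_op (transpose a (Suc a) m) * h) = cliff_op m * (swap_op a * h)"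
    unfolding swap_cliff [symmetric] by (simp add: mult.assoc)
  finally show ?case .
qed

lemma sergeev_mult: "g \<in> sergeev r \<Longrightarrow> h \<in> sergeev r \<Longrightarrow> g * h \<in> sergeev r"
proof (induction g rule: sergeev.induct)
  case (base c)
  then show ?case
    by (induction c rule: cliffords.induct) (auto simp: mult.assoc intro: sergeev_cliff)
next
  case (step g a)
  then show ?case by (auto simp: mult.assoc intro: sergeev.step)
qed

lemma sergeev_inverse: "g \<in> sergeev r \<Longrightarrow> \<exists>g'\<in>sergeev r. g * g' = 1 \<and> g' * g = 1"
proof (induction g rule: sergeev.induct)
  case (base c)
  then show ?case
  proof (induction c rule: cliffords.induct)
    case one
    then show ?case using sergeev.base cliffords.one by auto
  next
    case (step c m)
    then obtain c' where c': "c' \<in> sergeev r" "c * c' = 1" "c' * c = 1" by blast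
    \<comment> \<open>The square of \<open>cliff_op m\<close> is -1, so its inverse
      \<open>- cliff_op m\<close> is its cube and lies in the group.\<close>
    have "cliff_op m * (cliff_op m * (cliff_op m * 1)) \<in> sergeev r"
      using step by (intro sergeev.base cliffords.intros)
    then have m: "- cliff_op m \<in> sergeev r" by (simp add: cl_cl')
    have "cliff_op m * c * (c' * - cliff_op m) = - (cliff_op m * (c * c') * cliff_op m)" by (simp add: mult.assoc)
    moreover have "c' * - cliff_op m * (cliff_op m * c) = - (c' * (cliff_op m * cliff_op m) * c)" by (simp add: mult.assoc)
    ultimately show ?case using sergeev_mult [OF c'(1) m] c' by (intro bexI [of _ "c' * - cliff_op m"]) (simp_all add: cliff_cliff)
  qed
next
  case (step g a)
  then obtain g' where g': "g' \<in> sergeev r" "g * g' = 1" "g' * g = 1" by blast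
  have "swap_op a * 1 \<in> sergeev r" using step by (intro sergeev.intros cliffords.intros)
  then have "g' * swap_op a \<in> sergeev r" using sergeev_mult g' by simp
  moreover have "swap_op a * g * (g' * swap_op a) = 1" "g' * swap_op a * (swap_op a * g) = 1"
    using g' by (metis mult.assoc mult.left_neutral swap_swap, metis mult.assoc sw_sw')
  ultimately show ?case by blast
qed

lemma sergeev_midx_proj: "g \<in> sergeev r \<Longrightarrow> g * midx_proj n r = midx_proj n r * g"
proof (induction g rule: sergeev.induct)
  case (base c)
  then show ?case
  proof (induction c rule: cliffords.induct)
    case (step c m)
    then show ?case by (metis cliff_midx_proj mult.assoc)
  qed simp
next
  case (step g a)
  then show ?case by (metis swap_midx_proj mult.assoc)
qed

text \<open>On the corner a group element is determined by a sign and a target for each tuple, hence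
  there are only finitely many restrictions.\<close>

lemma sergeev_signed_map:
  "g \<in> sergeev r \<Longrightarrow> \<exists>\<epsilon> \<phi>. (\<forall>i\<in>midxs n r. \<epsilon> i \<in> {1, -1 :: complex} \<and> \<phi> i \<in> midxs n r \<and> (\<forall>v. app g v i = \<epsilon> i * v (\<phi> i)))"
proof (induction g rule: sergeev.induct)
  case (base c)
  then show ?case
  proof (induction c rule: cliffords.induct)
    case one
    then show ?case by (intro exI [of _ "\<lambda>_. 1"] exI [of _ "\<lambda>i. i"]) simp
  next
    case (step c m)
    then obtain \<epsilon> \<phi> where *: "\<forall>i\<in>midxs n r. \<epsilon> i \<in> {1, -1 :: complex} \<and> \<phi> i \<in> midxs n r \<and> (\<forall>v. app c v i = \<epsilon> i * v (\<phi> i))"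
      by blast
    show ?case
      by (rule exI [of _ "\<lambda>i. (-1) ^ par_sum {..m} i * \<epsilon> (i(m := flip (i m)))"],
          rule exI [of _ "\<lambda>i. \<phi> (i(m := flip (i m)))"])
        (use * step(2) midxs_upd_flip [of m r _ n] in \<open>auto simp: app_cliff minus_one_power_iff\<close>)
  qed
next
  case (step g a)
  then obtain \<epsilon> \<phi> where *: "\<forall>i\<in>midxs n r. \<epsilon> i \<in> {1, -1 :: complex} \<and> \<phi> i \<in> midxs n r \<and> (\<forall>v. app g v i = \<epsilon> i * v (\<phi> i))"
    by blast
  show ?case
    by (rule exI [of _ "\<lambda>i. ((-1) ^ ipar (i a)) ^ ipar (i (Suc a)) * \<epsilon> (i \<circ> transpose a (Suc a))"],
        rule exI [of _ "\<lambda>i. \<phi> (i \<circ> transpose a (Suc a))"])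
      (use * step(2) midxs_transpose [of a r _ n] in \<open>auto simp: app_swap minus_one_power_iff\<close>)
qed

definition sergeev_ops :: "nat \<Rightarrow> nat \<Rightarrow> midx lop set" where
  "sergeev_ops n r = (\<lambda>g. midx_proj n r * g) ` sergeev r"

lemma finite_sergeev_ops: "finite (sergeev_ops n r)"
proof -
  let ?S = "midxs n r"
  let ?f = "\<lambda>(\<epsilon>, \<phi>). Lop (\<lambda>v i. if i \<in> ?S then \<epsilon> i * v (\<phi> i) else 0 :: complex)"
  have "sergeev_ops n r \<subseteq> ?f ` ((?S \<rightarrow>\<^sub>E {1, -1}) \<times> (?S \<rightarrow>\<^sub>E ?S))"
  proof
    fix x assume "x \<in> sergeev_ops n r"
    then obtain g where g: "g \<in> sergeev r" "x = midx_proj n r * g" by (auto simp: sergeev_ops_def)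
    obtain \<epsilon> \<phi> where *: "\<And>i. i \<in> ?S \<Longrightarrow> \<epsilon> i \<in> {1, -1 :: complex} \<and> \<phi> i \<in> ?S \<and> (\<forall>v. app g v i = \<epsilon> i * v (\<phi> i))"
      using sergeev_signed_map [OF g(1), of n] by blast
    have "x = ?f (restrict \<epsilon> ?S, restrict \<phi> ?S)"
      unfolding split_conv
      by (rule lop_eqI, subst app_Lop) (use * in \<open>auto simp: g(2) app_midx_proj algebra_simps\<close>)
    moreover have "(restrict \<epsilon> ?S, restrict \<phi> ?S) \<in> (?S \<rightarrow>\<^sub>E {1, -1}) \<times> (?S \<rightarrow>\<^sub>E ?S)"
      using * by auto
    ultimately show "x \<in> ?f ` ((?S \<rightarrow>\<^sub>E {1, -1}) \<times> (?S \<rightarrow>\<^sub>E ?S))" by (rule image_eqI)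
  qed
  then show ?thesis by (rule finite_subset) (intro finite_imageI finite_cartesian_product finite_PiE; simp)
qed

lemma sergeev_ops_lspan: "sergeev_ops n r \<subseteq> lspan (mat_units n r)"
proof
  fix x assume "x \<in> sergeev_ops n r"
  then obtain g where "g \<in> sergeev r" "x = midx_proj n r * g" by (auto simp: sergeev_ops_def)
  then have "x = midx_proj n r * g * midx_proj n r" using sergeev_midx_proj by (metis mult.assoc midx_proj_idem)
  then show "x \<in> lspan (mat_units n r)" by (metis corner_lspan)
qed

lemma sergeev_mult_sergeev_ops: "h \<in> sergeev r \<Longrightarrow> x \<in> sergeev_ops n r \<Longrightarrow> h * x \<in> sergeev_ops n r"
  unfolding sergeev_ops_def using sergeev_mult sergeev_midx_proj by (smt (verit) image_iff mult.assoc)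

text \<open>Averages run over the restrictions to the corner, of which there are finitely many; each
  is kept together with the restriction of an inverse.\<close>

definition invpairs :: "nat \<Rightarrow> nat \<Rightarrow> (midx lop \<times> midx lop) set" where
  "invpairs n r = {(midx_proj n r * g, midx_proj n r * g') | g g'. g \<in> sergeev r \<and> g' \<in> sergeev r \<and> g * g' = 1 \<and> g' * g = 1}"

lemma finite_invpairs: "finite (invpairs n r)"
proof -
  have "invpairs n r \<subseteq> sergeev_ops n r \<times> sergeev_ops n r" by (auto simp: invpairs_def sergeev_ops_def)
  then show ?thesis by (rule finite_subset) (simp add: finite_sergeev_ops)
qed

text \<open>Multiplication by \<open>h\<close> and its inverse maps the finite set of pairs
  injectively into itself, hence permutes it, so conjugation by \<open>h\<close> fixes the
  sum.\<close>

lemma invpairs_sum_commute: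
  assumes h: "h \<in> sergeev r"
  shows "h * (\<Sum>z\<in>invpairs n r. fst z * y * snd z) = (\<Sum>z\<in>invpairs n r. fst z * y * snd z) * h"
proof -
  obtain h' where h': "h' \<in> sergeev r" "h * h' = 1" "h' * h = 1" using sergeev_inverse [OF h] by blast
  let ?f = "\<lambda>z. (h * fst z, snd z * h')" and ?P = "invpairs n r"
  have "?f ` ?P \<subseteq> ?P"
  proof clarify
    fix x x' assume "(x, x') \<in> ?P"
    then obtain g g' where g: "x = midx_proj n r * g" "x' = midx_proj n r * g'" "g \<in> sergeev r" "g' \<in> sergeev r" "g * g' = 1" "g' * g = 1"
      by (auto simp: invpairs_def)
    have "h * x = midx_proj n r * (h * g)" "x' * h' = midx_proj n r * (g' * h')"
      using g sergeev_midx_proj [OF h] by (metis mult.assoc)+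
    moreover have "h * g * (g' * h') = 1" "g' * h' * (h * g) = 1"
      using g h' by (metis mult.assoc mult.right_neutral)+
    ultimately show "(h * fst (x, x'), snd (x, x') * h') \<in> ?P"
      unfolding invpairs_def using sergeev_mult g(3,4) h h'(1)
      by (intro CollectI exI [of _ "h * g"] exI [of _ "g' * h'"]) auto
  qed
  moreover have inj: "inj_on ?f ?P"
  proof (rule inj_onI)
    fix z w assume "?f z = ?f w"
    then have "h' * (h * fst z) = h' * (h * fst w)" "snd z * h' * h = snd w * h' * h" by auto
    then show "z = w" using h' by (simp add: mult.assoc prod_eq_iff) (simp flip: mult.assoc)
  qed
  ultimately have "?f ` ?P = ?P"
    using endo_inj_surj [OF finite_invpairs] by blast
  then have "(\<Sum>z\<in>?P. fst z * y * snd z) = (\<Sum>z\<in>?P. fst (?f z) * y * snd (?f z))"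
    using sum.reindex [OF inj, of "\<lambda>z. fst z * y * snd z"] by (simp add: comp_def)
  also have "\<dots> = h * (\<Sum>z\<in>?P. fst z * y * snd z) * h'"
    by (simp add: sum_distrib_left sum_distrib_right mult.assoc)
  finally have "(\<Sum>z\<in>?P. fst z * y * snd z) * h = h * (\<Sum>z\<in>?P. fst z * y * snd z) * h' * h"
    by (rule arg_cong [where f = "\<lambda>x. x * h"])
  then show ?thesis by (simp only: mult.assoc h' mult.right_neutral)
qed

text \<open>
  A projection \<open>e\<close> onto the span of the group is made equivariant for left multiplication. Then
  \<open>e X = (\<Sum>k. a\<^sub>k X z\<^sub>k)\<close> with \<open>a\<^sub>k\<close> in the commutant of the group, so \<open>e T = T (e 1) = T\<close>.
\<close>

theorem commutant_lspan:
  assumes T: "\<And>\<pi> X. q_homog n \<pi> X \<Longrightarrow> T * total_op n r \<pi> X = total_op n r \<pi> X * T"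
    and TS: "T \<in> lspan (mat_units n r)"
  shows "T \<in> lspan (sergeev_ops n r)"
proof -
  let ?P = "invpairs n r" and ?o = "midx_proj n r"
  obtain e where e: "bimod n r e" "\<And>X. e X \<in> lspan (sergeev_ops n r)" "\<And>x. x \<in> sergeev_ops n r \<Longrightarrow> e x = x"
    using projection_exists [OF finite_sergeev_ops sergeev_ops_lspan] by blast
  define av where "av F X = (\<Sum>z\<in>?P. fst z * F (snd z * X))" for F X
  have P: "midx_proj n r * fst z = fst z" "fst z * midx_proj n r = fst z" "midx_proj n r * snd z = snd z" "snd z * midx_proj n r = snd z"
    "fst z * snd z = midx_proj n r" "snd z \<in> sergeev_ops n r" "\<exists>g\<in>sergeev r. fst z = midx_proj n r * g" if "z \<in> ?P" for z
  proof -
    obtain g g' where g: "fst z = midx_proj n r * g" "snd z = midx_proj n r * g'" "g \<in> sergeev r" "g' \<in> sergeev r" "g * g' = 1"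
      using \<open>z \<in> ?P\<close> by (auto simp: invpairs_def)
    note c = sergeev_midx_proj [OF g(3), of n] sergeev_midx_proj [OF g(4), of n]
    show "midx_proj n r * fst z = fst z" "fst z * midx_proj n r = fst z" "midx_proj n r * snd z = snd z" "snd z * midx_proj n r = snd z"
      using g c by (metis mult.assoc midx_proj_idem)+
    show "fst z * snd z = midx_proj n r" using g c by (metis mult.assoc mult.right_neutral midx_proj_idem)
    show "snd z \<in> sergeev_ops n r" "\<exists>g\<in>sergeev r. fst z = midx_proj n r * g" using g by (auto simp: sergeev_ops_def)
  qed
  have T_o: "?o * T = T" "T * ?o = T" using lspan_midx_proj [OF TS] by auto
  have "av F T = T * av F ?o" if "bimod n r F" for F
    using that
  proof (induction F rule: bimod.induct)
    case zero
    then show ?case by (simp add: av_def)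
  next
    case (add F G)
    then show ?case by (simp add: av_def distrib_left sum.distrib)
  next
    case (base y z)
    define a where "a = (\<Sum>w\<in>?P. fst w * y * snd w)"
    have "a = ?o * a * ?o"
      unfolding a_def by (simp add: sum_distrib_left sum_distrib_right mult.assoc P)
        (simp add: P flip: mult.assoc)
    then have a: "a \<in> lspan (mat_units n r)" by (metis corner_lspan)
    have "T * a = a * T"
    proof (rule commute_commutant [OF T _ a])
      fix m assume "m < r"
      then have "cliff_op m * 1 \<in> sergeev r" by (intro sergeev.base cliffords.intros)
      then show "cliff_op m * a = a * cliff_op m" unfolding a_def using invpairs_sum_commute by simp
    next
      fix b assume "Suc b < r"
      then have "swap_op b * 1 \<in> sergeev r" by (intro sergeev.intros cliffords.intros)
      then show "swap_op b * a = a * swap_op b" unfolding a_def using invpairs_sum_commute by simp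
    qed (use T_o in auto)
    moreover have "av (\<lambda>X. y * X * z) X = a * X * z" for X
      by (simp add: av_def a_def sum_distrib_right mult.assoc)
    moreover have "a * ?o = a" using lspan_midx_proj [OF a] by simp
    ultimately show ?case by (metis mult.assoc)
  qed
  from this [OF e(1)] have "av e T = T * av e ?o" .
  also have "av e ?o = (\<Sum>z\<in>?P. ?o)"
    unfolding av_def using P e(3) by (intro sum.cong) auto
  also have "T * \<dots> = scal (of_nat (card ?P)) * T"
    unfolding sum_const_lop sc_commute' [of T] T_o ..
  finally have av: "av e T = scal (of_nat (card ?P)) * T" .
  have "av e T \<in> lspan (sergeev_ops n r)"
    unfolding av_def
  proof (rule lspan_sum)
    fix z assume z: "z \<in> ?P"
    then obtain g where g: "g \<in> sergeev r" "fst z = ?o * g" using P by blast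
    show "fst z * e (snd z * T) \<in> lspan (sergeev_ops n r)"
    proof (rule lspan_linear [OF e(2)])
      fix x assume x: "x \<in> sergeev_ops n r"
      then have "?o * x = x" by (auto simp: sergeev_ops_def simp flip: mult.assoc)
      then have "fst z * x = g * x" unfolding g(2) using sergeev_midx_proj [OF g(1), of n] by (metis mult.assoc)
      then show "fst z * x \<in> lspan (sergeev_ops n r)" using sergeev_mult_sergeev_ops [OF g(1) x] by (simp add: lspan_base)
    qed (simp_all add: distrib_left sc_commute' [of "fst z"])
  qed
  moreover have "card ?P \<noteq> 0"
  proof -
    have "(?o * 1, ?o * 1) \<in> ?P" unfolding invpairs_def
      by (intro CollectI exI [of _ 1]) (auto intro: sergeev.base cliffords.one)
    then show ?thesis using finite_invpairs by auto
  qed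
  then have "T = scal (1 / of_nat (card ?P)) * av e T" unfolding av by (simp add: scal_fold)
  ultimately show ?thesis by (metis lspan_scal)
qed


section \<open>Supersymmetrization\<close>

definition lin_ext :: "(gen list \<Rightarrow> tensor) \<Rightarrow> tensor \<Rightarrow> tensor" where
  "lin_ext h f = (\<Sum>w\<in>Poly_Mapping.keys f. tconst (coeff f w) * h w)"

lemma lin_ext_add: "lin_ext h (f + g) = lin_ext h f + lin_ext h g"
  unfolding lin_ext_def by (rule linear_extension_add)

lemma lin_ext_single: "lin_ext h (Poly_Mapping.single w c) = tconst c * h w"
  unfolding lin_ext_def by (rule linear_extension_single)

lemma lin_ext_word [simp]: "lin_ext h (tword w) = h w"
  by (simp add: tword_def lin_ext_single)

lemma lin_ext_0 [simp]: "lin_ext h 0 = 0"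
  by (simp add: lin_ext_def)

lemma lin_ext_one: "lin_ext h 1 = h []"
  using lin_ext_word [of h "[]"] by (simp add: tword_Nil)

lemma tconst_single: "tconst c * Poly_Mapping.single w a = Poly_Mapping.single w (c * a)"
  by (simp add: tconst_def single_mult)

lemma lin_ext_smult: "lin_ext h (tconst c * f) = tconst c * lin_ext h f"
proof (induction f rule: tensor_induct)
  case (single w a)
  show ?case by (simp add: tconst_single lin_ext_single tconst_fold)
qed (simp_all add: lin_ext_add distrib_left)

lemma lin_ext_minus: "lin_ext h (- f) = - lin_ext h f"
  using lin_ext_smult [of h "-1" f] by (simp add: tconst_minus)

lemma lin_ext_diff: "lin_ext h (f - g) = lin_ext h f - lin_ext h g"
  using lin_ext_add [of h f "- g"] by (simp add: lin_ext_minus)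

lemma lin_ext_sum: "lin_ext h (\<Sum>i\<in>K. f i) = (\<Sum>i\<in>K. lin_ext h (f i))"
  by (induction K rule: infinite_finite_induct) (simp_all add: lin_ext_add)

lemma tensor_word_induct [case_names zero word add smult]:
  assumes "P 0" "\<And>w. P (tword w)" "\<And>f g. P f \<Longrightarrow> P g \<Longrightarrow> P (f + g)" "\<And>c f. P f \<Longrightarrow> P (tconst c * f)"
  shows "P f"
  by (induction f rule: tensor_induct) (use assms in \<open>auto simp: single_eq\<close>)

text \<open>
  \<open>ins x\<close> is the signed shuffle product with the letter \<open>x\<close>. Since these operators supercommute,
  symmetrization factors through the symmetric superalgebra.
\<close>

fun ins_word :: "gen \<Rightarrow> gen list \<Rightarrow> tensor" where
  "ins_word x [] = tword [x]"
| "ins_word x (y # w) = tword (x # y # w) + tconst ((-1) ^ (gpar x * gpar y)) * (tword [y] * ins_word x w)"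

definition ins :: "gen \<Rightarrow> tensor \<Rightarrow> tensor" where
  "ins x = lin_ext (ins_word x)"

lemma tword_Cons: "tword (x # w) = tword [x] * tword w"
  using tword_append [of "[x]" w] by simp

lemma ins_linear: "ins x (f + g) = ins x f + ins x g" "ins x (tconst c * f) = tconst c * ins x f" "ins x 0 = 0"
  "ins x (f - g) = ins x f - ins x g"
  by (simp_all add: ins_def lin_ext_add lin_ext_smult lin_ext_diff)

lemma ins_tword: "ins x (tword w) = ins_word x w"
  by (simp add: ins_def)

lemma ins_lmult: "ins x (tword [y] * f) =
    tword [x] * (tword [y] * f) + tconst ((-1) ^ (gpar x * gpar y)) * (tword [y] * ins x f)"
proof (induction f rule: tensor_word_induct)
  case (word w)
  have "tword [y] * tword w = tword (y # w)" by (metis tword_Cons)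
  then show ?case by (simp add: ins_tword) (metis tword_Cons)
next
  case (smult c f)
  then show ?case
    by (simp add: ins_linear tconst_commute' [of "tword _"] distrib_left tconst_fold mult.commute)
qed (simp_all add: ins_linear distrib_left add_ac)

text \<open>Of the five ways to insert two letters into \<open>z # w\<close>, the one with both
  behind \<open>z\<close> is covered by induction; exchanging \<open>x\<close> and \<open>y\<close>
  interchanges the other four in pairs.\<close>

lemma ins_commute: "ins x (ins y f) = tconst ((-1) ^ (gpar x * gpar y)) * ins y (ins x f)"
proof (induction f rule: tensor_word_induct)
  case (word w)
  show ?case
  proof (induction w)
    case Nil
    show ?case
      by (simp add: ins_tword distrib_left tconst_fold tword_Cons [of x "[y]"] tword_Cons [of y "[x]"]
          mult.commute [of "gpar y"] flip: power_mult_distrib)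
  next
    case (Cons z w)
    have *: "ins a (ins b (tword (z # w))) = tword [a] * (tword [b] * tword (z # w))
      + tconst ((-1) ^ (gpar a * gpar b)) * (tword [b] * (tword [a] * tword (z # w)))
      + tconst ((-1) ^ (gpar a * gpar b + gpar a * gpar z)) * (tword [b] * (tword [z] * ins_word a w))
      + tconst ((-1) ^ (gpar b * gpar z)) * (tword [a] * (tword [z] * ins_word b w))
      + tconst ((-1) ^ (gpar b * gpar z + gpar a * gpar z)) * (tword [z] * ins a (ins b (tword w)))" for a b
      unfolding ins_tword ins_word.simps ins_linear tword_Cons [of b "z # w"] tword_Cons [of z w] ins_lmult
      by (simp add: distrib_left tconst_fold tconst_commute' [of "tword _"] power_add ins_tword mult_ac)
    show ?case
      unfolding * [of x y] * [of y x] Cons.IH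
      by (simp add: distrib_left tconst_fold power_add mult.commute [of "gpar y" "gpar x"] mult.left_commute
          tconst_commute' [of "tword [z]"] mult.commute [of "(-1) ^ (gpar x * gpar z)"])
        (simp add: mult_ac)
  qed
next
  case (smult c f)
  then show ?case by (simp add: ins_linear tconst_fold mult.commute)
qed (simp_all add: ins_linear distrib_left)

definition ins_list :: "gen list \<Rightarrow> tensor \<Rightarrow> tensor" where
  "ins_list w = foldr ins w"

lemma ins_list_simps [simp]: "ins_list [] g = g" "ins_list (x # w) g = ins x (ins_list w g)" "ins_list (u @ v) g = ins_list u (ins_list v g)"
  by (simp_all add: ins_list_def)

lemma ins_list_linear: "ins_list w (f + g) = ins_list w f + ins_list w g" "ins_list w (tconst c * f) = tconst c * ins_list w f" "ins_list w 0 = 0"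
  "ins_list w (f - g) = ins_list w f - ins_list w g"
  by (induction w) (simp_all add: ins_linear)

text \<open>Each word goes to the signed sum of all its rearrangements, without division by the
  factorial of its length.\<close>

definition supersym :: "tensor \<Rightarrow> tensor" where
  "supersym = lin_ext (\<lambda>w. ins_list w 1)"

lemma supersym_linear: "supersym (f + g) = supersym f + supersym g" "supersym (tconst c * f) = tconst c * supersym f" "supersym 0 = 0"
  "supersym (f - g) = supersym f - supersym g" "supersym (- f) = - supersym f"
  by (simp_all add: supersym_def lin_ext_add lin_ext_smult lin_ext_diff lin_ext_minus)

lemma supersym_tword: "supersym (tword w) = ins_list w 1"
  by (simp add: supersym_def)

lemma supersym_word_mult: "supersym (tword w * f) = ins_list w (supersym f)"
proof (induction f rule: tensor_word_induct)
  case (word v)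
  then show ?case by (simp add: supersym_tword flip: tword_append)
qed (simp_all add: supersym_linear ins_list_linear distrib_left tconst_commute' [of "tword w"])

lemma supersym_relator: "supersym (g * (tword [x] * tword [y] - tconst ((-1) ^ (gpar x * gpar y)) * tword [y] * tword [x]) * h) = 0"
proof (induction g rule: tensor_word_induct)
  case (word w)
  show ?case
    by (simp add: left_diff_distrib right_diff_distrib mult.assoc supersym_linear supersym_word_mult ins_list_linear
        tconst_commute' [of "tword w"] ins_commute [of x y])
qed (simp_all add: supersym_linear distrib_right mult.assoc)

lemma supersym_super_ideal:
  assumes "f \<in> super_ideal n k p"
  shows "supersym f = 0"
proof -
  let ?R = "tensor_ring n k p"
  \<comment> \<open>Allowing arbitrary factors on both sides makes this set an ideal, so it is
    enough to test the relators.\<close>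
  define K where "K = {f \<in> carrier ?R. \<forall>g h. supersym (g * f * h) = 0}"
  have "ideal K ?R"
  proof (rule idealI [OF ring_tensor_ring])
    show "subgroup K (add_monoid ?R)"
    proof (rule tensor.add.subgroupI)
      show "K \<subseteq> carrier ?R" by (auto simp: K_def)
      show "K \<noteq> {}" by (auto simp: K_def supersym_linear intro!: exI [of _ 0])
    next
      fix f assume f: "f \<in> K"
      then have *: "\<ominus>\<^bsub>?R\<^esub> f = 0 - f"
        using tensor_minus [of f n k p 0] tensor.minus_closed
        by (simp add: K_def a_minus_def)
      have "\<ominus>\<^bsub>?R\<^esub> f \<in> carrier ?R" using f by (auto simp: K_def)
      with f * show "\<ominus>\<^bsub>?R\<^esub> f \<in> K"
        by (auto simp: K_def right_diff_distrib left_diff_distrib supersym_linear)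
    qed (auto simp: K_def tensor_ring_add_closed distrib_left distrib_right supersym_linear)
  qed (auto simp: K_def mult.assoc tensor_ring_mult_closed, simp_all flip: mult.assoc)
  moreover have "{tword [x] * tword [y] - tconst ((-1) ^ (gpar x * gpar y)) * tword [y] * tword [x] | x y.
        x \<in> gens n k p \<and> y \<in> gens n k p} \<subseteq> K"
    using relators_carrier [of n k p] by (auto simp: K_def supersym_relator)
  ultimately have "super_ideal n k p \<subseteq> K"
    unfolding super_ideal_def by (rule tensor.genideal_minimal)
  with assms have "f \<in> K" by blast
  then have "supersym (1 * f * 1) = 0" unfolding K_def by blast
  then show ?thesis by simp
qed

section \<open>Equivariance of supersymmetrization\<close>

lemma hom_act_sum: "hom_act n \<pi> A (\<Sum>i\<in>K. f i) = (\<Sum>i\<in>K. hom_act n \<pi> A (f i))"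
  by (induction K rule: infinite_finite_induct) (simp_all add: hom_act_add)

lemma ins_sum: "ins x (\<Sum>i\<in>K. f i) = (\<Sum>i\<in>K. ins x (f i))"
  by (simp add: ins_def lin_ext_sum)

lemma parity_sgn:
  assumes "(b + c) mod 2 = \<pi>"
  shows "(-1) ^ (a * b) = ((-1) ^ (\<pi> * a) * (-1) ^ (a * c) :: complex)"
proof -
  have "even \<pi> \<longleftrightarrow> even (b + c)" using assms by (metis even_mod_2_iff)
  then have "even (a * b) \<longleftrightarrow> even (\<pi> * a + a * c)" by auto
  then show ?thesis by (simp add: minus_one_power_iff flip: power_add)
qed

text \<open>The Leibniz rule for the shuffle with one letter. The image of \<open>x\<close> enters
  through an expansion with coefficients \<open>c\<close> and letters \<open>h\<close>, so vectors
  and covectors are treated alike.\<close>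

lemma hom_act_ins:
  assumes x: "gen_act n \<pi> A x = (\<Sum>i\<in>Idx n. tconst (c i) * tword [h i])"
    and h: "\<And>i. c i \<noteq> 0 \<Longrightarrow> (gpar (h i) + gpar x) mod 2 = \<pi>"
    and A: "\<And>i j. A i j \<noteq> 0 \<Longrightarrow> (ipar i + ipar j) mod 2 = \<pi>"
    and f: "f \<in> carrier (tensor_ring n k p)"
  shows "hom_act n \<pi> A (ins x f) = (\<Sum>i\<in>Idx n. tconst (c i) * ins (h i) f)
    + tconst ((-1) ^ (\<pi> * gpar x)) * ins x (hom_act n \<pi> A f)"
proof -
  have word: "hom_act n \<pi> A (ins x (tword w)) = (\<Sum>i\<in>Idx n. tconst (c i) * ins (h i) (tword w))
    + tconst ((-1) ^ (\<pi> * gpar x)) * ins x (hom_act n \<pi> A (tword w))" if "set w \<subseteq> gens n k p" for w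
    using that
  proof (induction w)
    case Nil
    show ?case using hom_act_tconst [of n \<pi> A 1]
      by (simp add: tword_Nil ins_def lin_ext_one hom_act_word x)
  next
    case (Cons y w)
    let ?D = "hom_act n \<pi> A" and ?w = "tword w"
    have "y \<in> gens n k p" using Cons.prems by simp
    from gen_act_expand [of y n k p A \<pi>, OF this A] obtain d g where
      y: "gen_act n \<pi> A y = (\<Sum>i\<in>Idx n. tconst (d i) * tword [g i])" and
      "\<And>i. i \<in> Idx n \<Longrightarrow> g i \<in> gens n k p" and
      g: "\<And>i. d i \<noteq> 0 \<Longrightarrow> (gpar (g i) + gpar y) mod 2 = \<pi>"
      by blast
    have D: "?D (tword [z] * t) = gen_act n \<pi> A z * t + tconst ((-1) ^ (\<pi> * gpar z)) * (tword [z] * ?D t)" for z t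
      by (simp add: hom_act_mult hom_act_word par_aut_word wpar_def tword_Nil mult.assoc)
    define s where "s = (\<lambda>a b. tconst ((-1) ^ (a * b)))"
    have s: "s a b * (s a b * t) = t" "s a b = s b a" for a b t
      by (simp_all add: s_def tconst_fold mult.commute)
    \<comment> \<open>Each image \<open>h i\<close> of \<open>x\<close> has the parity of
      \<open>x\<close> shifted by \<pi>, so its sign against \<open>y\<close> splits into the sign
      of the derivation and the sign of \<open>x\<close> against \<open>y\<close>.\<close>
    have X: "(\<Sum>i\<in>Idx n. tconst (c i) * ins (h i) (tword [y] * ?w)) =
        gen_act n \<pi> A x * (tword [y] * ?w) + s \<pi> (gpar y) * (s (gpar y) (gpar x) * (tword [y] * (\<Sum>i\<in>Idx n. tconst (c i) * ins (h i) ?w)))"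
      unfolding x sum_distrib_left sum_distrib_right sum.distrib [symmetric]
    proof (rule sum.cong [OF refl])
      fix i
      show "tconst (c i) * ins (h i) (tword [y] * ?w) = tconst (c i) * tword [h i] * (tword [y] * ?w) +
         s \<pi> (gpar y) * (s (gpar y) (gpar x) * (tword [y] * (tconst (c i) * ins (h i) ?w)))"
      proof (cases "c i = 0")
        case False
        have "tconst ((-1) ^ (gpar (h i) * gpar y)) = s \<pi> (gpar y) * s (gpar y) (gpar x)"
          using parity_sgn [OF h [OF False], of "gpar y"] by (simp add: s_def tconst_mult mult.commute)
        then show ?thesis
          by (simp add: ins_lmult distrib_left mult.assoc s_def tconst_commute' [of "tword _"] tconst_fold mult_ac)
      qed simp
    qed
    have Y: "ins x (gen_act n \<pi> A y * ?w) = tword [x] * (gen_act n \<pi> A y * ?w)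
        + s \<pi> (gpar x) * (s (gpar x) (gpar y) * (gen_act n \<pi> A y * ins x ?w))"
      unfolding y sum_distrib_left sum_distrib_right ins_sum sum.distrib [symmetric]
    proof (rule sum.cong [OF refl])
      fix i
      show "ins x (tconst (d i) * tword [g i] * ?w) = tword [x] * (tconst (d i) * tword [g i] * ?w) +
         s \<pi> (gpar x) * (s (gpar x) (gpar y) * (tconst (d i) * tword [g i] * ins x ?w))"
      proof (cases "d i = 0")
        case False
        have "tconst ((-1) ^ (gpar x * gpar (g i))) = s \<pi> (gpar x) * s (gpar x) (gpar y)"
          using parity_sgn [OF g [OF False], of "gpar x"] by (simp add: s_def tconst_mult)
        then show ?thesis
          by (simp add: ins_linear ins_lmult distrib_left mult.assoc s_def tconst_commute' [of "tword _"] tconst_fold mult_ac)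
      qed (simp add: ins_linear)
    qed
    have IH: "?D (ins x ?w) = (\<Sum>i\<in>Idx n. tconst (c i) * ins (h i) ?w) + s \<pi> (gpar x) * ins x (?D ?w)"
      using Cons by (simp add: s_def)
    have "?D (ins x (tword (y # w))) = gen_act n \<pi> A x * (tword [y] * ?w)
       + s \<pi> (gpar x) * (tword [x] * (gen_act n \<pi> A y * ?w + s \<pi> (gpar y) * (tword [y] * ?D ?w)))
       + s (gpar x) (gpar y) * (gen_act n \<pi> A y * ins x ?w + s \<pi> (gpar y) * (tword [y] * ?D (ins x ?w)))"
      unfolding tword_Cons [of y w] ins_lmult hom_act_add hom_act_smult D s_def ..
    moreover have "s \<pi> (gpar x) * ins x (?D (tword (y # w))) = s \<pi> (gpar x) * (tword [x] * (gen_act n \<pi> A y * ?w))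
       + s (gpar x) (gpar y) * (gen_act n \<pi> A y * ins x ?w)
       + s \<pi> (gpar x) * (s \<pi> (gpar y) * (tword [x] * (tword [y] * ?D ?w)))
       + s \<pi> (gpar x) * (s \<pi> (gpar y) * (s (gpar x) (gpar y) * (tword [y] * ins x (?D ?w))))"
      unfolding tword_Cons [of y w] D ins_linear Y
      by (simp add: s_def [symmetric] s(1) distrib_left)
         (simp add: s_def ins_linear ins_lmult distrib_left tconst_commute' [of "tword _"] tconst_fold mult_ac)
    ultimately show ?case
      unfolding IH tword_Cons [of y w] X
      by (simp add: s_def distrib_left tconst_commute' [of "tword _"] tconst_fold mult_ac)
  qed
  have "hom_act n \<pi> A (ins x f') = (\<Sum>i\<in>Idx n. tconst (c i) * ins (h i) f')
    + tconst ((-1) ^ (\<pi> * gpar x)) * ins x (hom_act n \<pi> A f')" (is "?L f' = ?R f'")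
    if f': "f' = (\<Sum>w\<in>K. Poly_Mapping.single w (coeff f w))" "K \<subseteq> lists (gens n k p)" for f' K
  proof -
    have "?L (\<Sum>w\<in>K. tconst (coeff f w) * tword w) = ?R (\<Sum>w\<in>K. tconst (coeff f w) * tword w)"
      using f'(2)
    proof (induction K rule: infinite_finite_induct)
      case (insert w K)
      have "set w \<subseteq> gens n k p" using insert.prems by auto
      note word [OF this]
      moreover have "?L (t + t') = ?R (t + t')" if "?L t = ?R t" "?L t' = ?R t'" for t t'
        using that by (simp add: ins_linear hom_act_add distrib_left sum.distrib)
      moreover have "?L (tconst e * t) = ?R (tconst e * t)" if "?L t = ?R t" for t e
        using that by (simp add: ins_linear hom_act_smult distrib_left sum_distrib_left tconst_fold mult.commute)
      ultimately show ?case using insert by simp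
    qed (simp_all add: ins_linear)
    then show ?thesis unfolding f'(1) by (simp add: single_eq)
  qed
  from this [OF tensor_expand] f show ?thesis by (simp add: tensor_ring_def)
qed


lemma ins_word_keys: "v \<in> Poly_Mapping.keys (ins_word x w) \<Longrightarrow> \<exists>u1 u2. v = u1 @ x # u2 \<and> w = u1 @ u2"
proof (induction w arbitrary: v)
  case Nil
  then have "v = [x]" by (simp add: tword_def split: if_splits)
  then show ?case by (intro exI [of _ "[]"]) auto
next
  case (Cons y w)
  have "v \<in> Poly_Mapping.keys (tword (x # y # w)) \<union>
      Poly_Mapping.keys (tconst ((-1) ^ (gpar x * gpar y)) * (tword [y] * ins_word x w))"
    using Cons.prems Poly_Mapping.keys_add by fastforce
  then consider "v = x # y # w" | "v \<in> Poly_Mapping.keys (Poly_Mapping.single [y] ((-1) ^ (gpar x * gpar y)) * ins_word x w)"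
    by (auto simp: tword_def single_mult tconst_def mult.assoc [symmetric] split: if_splits)
  then show ?case
  proof cases
    case 1
    then show ?thesis by (intro exI [of _ "[]"] exI [of _ "y # w"]) simp
  next
    case 2
    then obtain v' where "v = y # v'" "v' \<in> Poly_Mapping.keys (ins_word x w)"
      using keys_mult [of "Poly_Mapping.single [y] ((-1) ^ (gpar x * gpar y))" "ins_word x w"]
      by (auto simp: plus_list_def split: if_splits)
    with Cons.IH obtain u1 u2 where "v' = u1 @ x # u2" "w = u1 @ u2" by blast
    then show ?thesis using \<open>v = y # v'\<close> by (intro exI [of _ "y # u1"] exI [of _ u2]) auto
  qed
qed

lemma ins_carrier:
  assumes x: "x \<in> gens n k p" and f: "f \<in> carrier (tensor_ring n k p)"
  shows "ins x f \<in> carrier (tensor_ring n k p)"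
  unfolding ins_def lin_ext_def
proof (intro tensor_ring_sum_closed tensor_ring_mult_closed tconst_carrier)
  fix w assume "w \<in> Poly_Mapping.keys f"
  then have "set w \<subseteq> gens n k p" using f by (auto simp: tensor_ring_def)
  then show "ins_word x w \<in> carrier (tensor_ring n k p)"
    using ins_word_keys [of _ x w] x by (fastforce simp: tensor_ring_def)
qed

lemma carrier_induct [consumes 1, case_names zero word add smult]:
  assumes "f \<in> carrier (tensor_ring n k p)"
    and "P 0" "\<And>w. set w \<subseteq> gens n k p \<Longrightarrow> P (tword w)" "\<And>f g. P f \<Longrightarrow> P g \<Longrightarrow> P (f + g)"
    "\<And>c f. P f \<Longrightarrow> P (tconst c * f)"
  shows "P f"
proof -
  have "P (\<Sum>w\<in>K. Poly_Mapping.single w (coeff f w))" if "K \<subseteq> lists (gens n k p)" for K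
    using that
  proof (induction K rule: infinite_finite_induct)
    case (insert w K)
    then have "set w \<subseteq> gens n k p" by auto
    then show ?case using insert by (simp add: single_eq assms(3-5))
  qed (simp_all add: assms(2))
  from this [of "Poly_Mapping.keys f"] show ?thesis
    using assms(1) by (simp add: tensor_ring_def flip: tensor_expand)
qed

lemma ins_list_carrier: "set w \<subseteq> gens n k p \<Longrightarrow> ins_list w 1 \<in> carrier (tensor_ring n k p)"
  using tconst_carrier [of 1] by (induction w) (auto intro: ins_carrier)

text \<open>A symmetrized word is built by inserting its letters one after another, and
  \<open>hom_act_ins\<close> carries the action through each insertion.\<close>

lemma hom_act_supersym:
  assumes A: "\<And>i j. A i j \<noteq> 0 \<Longrightarrow> (ipar i + ipar j) mod 2 = \<pi>"
    and f: "f \<in> carrier (tensor_ring n k p)"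
  shows "hom_act n \<pi> A (supersym f) = supersym (hom_act n \<pi> A f)"
  using f
proof (induction rule: carrier_induct)
  case (word w)
  then show ?case
  proof (induction w)
    case Nil
    show ?case using hom_act_tconst [of n \<pi> A 1] by (simp add: supersym_tword hom_act_word supersym_linear)
  next
    case (Cons x w)
    then have "x \<in> gens n k p" by simp
    from gen_act_expand [of x n k p A \<pi>, OF this A] obtain c h where
      x: "gen_act n \<pi> A x = (\<Sum>i\<in>Idx n. tconst (c i) * tword [h i])" and
      "\<And>i. i \<in> Idx n \<Longrightarrow> h i \<in> gens n k p" and
      h: "\<And>i. c i \<noteq> 0 \<Longrightarrow> (gpar (h i) + gpar x) mod 2 = \<pi>"
      by blast
    have "hom_act n \<pi> A (supersym (tword (x # w))) = (\<Sum>i\<in>Idx n. tconst (c i) * ins (h i) (ins_list w 1))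
        + tconst ((-1) ^ (\<pi> * gpar x)) * ins x (hom_act n \<pi> A (ins_list w 1))"
    proof -
      have "ins_list w 1 \<in> carrier (tensor_ring n k p)" using Cons.prems by (simp add: ins_list_carrier)
      from hom_act_ins [OF x h A this] show ?thesis by (simp add: supersym_tword)
    qed
    also have "hom_act n \<pi> A (ins_list w 1) = supersym (word_act n \<pi> A w)"
      using Cons by (simp add: supersym_tword hom_act_word)
    also have "(\<Sum>i\<in>Idx n. tconst (c i) * ins (h i) (ins_list w 1)) = supersym (gen_act n \<pi> A x * tword w)"
      unfolding x sum_distrib_right supersym_def lin_ext_sum mult.assoc
      by (simp add: lin_ext_smult flip: tword_append)
    also have "ins x (supersym (word_act n \<pi> A w)) = supersym (tword [x] * word_act n \<pi> A w)"
      by (simp add: supersym_word_mult)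
    finally show ?case
      by (simp add: hom_act_word supersym_linear mult.assoc)
  qed
qed (simp_all add: supersym_linear hom_act_add hom_act_smult)


subsection \<open>Recovering an element from its ordered part\<close>

fun isvec :: "gen \<Rightarrow> bool" where
  "isvec (Vec t i) = True"
| "isvec (Dual i s) = False"

text \<open>Only the type counts: all vectors come before all covectors, in any order among
  themselves.\<close>

definition ordered :: "gen list \<Rightarrow> bool" where
  "ordered = sorted_wrt (\<lambda>x y. isvec y \<longrightarrow> isvec x)"

definition ordered_part :: "tensor \<Rightarrow> tensor" where
  "ordered_part = lin_ext (\<lambda>w. if ordered w then tword w else 0)"

lemma ordered_part_linear: "ordered_part (f + g) = ordered_part f + ordered_part g" "ordered_part (tconst c * f) = tconst c * ordered_part f" "ordered_part 0 = 0"
  by (simp_all add: ordered_part_def lin_ext_add lin_ext_smult)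

lemma ordered_part_tword: "ordered_part (tword w) = (if ordered w then tword w else 0)"
  by (simp add: ordered_part_def)

lemma ordered_part_unordered: "(\<And>w. w \<in> Poly_Mapping.keys f \<Longrightarrow> \<not> ordered w) \<Longrightarrow> ordered_part f = 0"
  unfolding ordered_part_def lin_ext_def by (intro sum.neutral) simp

lemma lin_ext_tword: "lin_ext tword f = f"
  by (induction f rule: tensor_word_induct) (simp_all add: lin_ext_add lin_ext_smult)

lemma ordered_part_ordered: "(\<And>w. w \<in> Poly_Mapping.keys f \<Longrightarrow> ordered w) \<Longrightarrow> ordered_part f = f"
proof -
  assume "\<And>w. w \<in> Poly_Mapping.keys f \<Longrightarrow> ordered w"
  then have "ordered_part f = lin_ext tword f"
    unfolding ordered_part_def lin_ext_def by (intro sum.cong) auto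
  then show ?thesis by (simp add: lin_ext_tword)
qed

lemma ordered_part_Vec: "isvec y \<Longrightarrow> ordered_part (tword [y] * f) = tword [y] * ordered_part f"
proof (induction f rule: tensor_word_induct)
  case (word w)
  then show ?case by (simp add: ordered_part_tword ordered_def flip: tword_Cons)
qed (simp_all add: ordered_part_linear distrib_left tconst_commute' [of "tword _"])

text \<open>Deleting a letter from an ordered word leaves an ordered word, so inserting a letter
  into an unordered word never makes it ordered.\<close>

lemma ordered_part_ins: "ordered_part (ins x f) = ordered_part (ins x (ordered_part f))"
proof (induction f rule: tensor_word_induct)
  case (word w)
  have "ordered_part (ins_word x w) = 0" if "\<not> ordered w"
  proof (rule ordered_part_unordered)
    fix v assume "v \<in> Poly_Mapping.keys (ins_word x w)"
    then obtain u1 u2 where "v = u1 @ x # u2" "w = u1 @ u2" using ins_word_keys by blast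
    with that show "\<not> ordered v" by (auto simp: ordered_def sorted_wrt_append)
  qed
  then show ?case by (simp add: ordered_part_tword ins_linear ordered_part_linear ins_tword)
qed (simp_all add: ordered_part_linear ins_linear)

definition nsame :: "gen \<Rightarrow> gen list \<Rightarrow> nat" where
  "nsame x w = length (filter (\<lambda>y. isvec y = isvec x) w)"

lemma keys_lmult_word: "v \<in> Poly_Mapping.keys (tword u * f) \<Longrightarrow> \<exists>v'\<in>Poly_Mapping.keys f. v = u @ v'"
  using keys_mult [of "tword u" f] by (auto simp: tword_def plus_list_def)

lemma swap_mod_ideal:
  assumes "x \<in> gens n k p" "y \<in> gens n k p" "f \<in> carrier (tensor_ring n k p)"
  shows "tconst ((-1) ^ (gpar x * gpar y)) * (tword [y] * (tword [x] * f)) - tword [x] * (tword [y] * f) \<in> super_ideal n k p"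
proof -
  have "- ((tword [x] * tword [y] - tconst ((-1) ^ (gpar x * gpar y)) * tword [y] * tword [x]) * f) \<in> super_ideal n k p"
    using assms by (intro super_ideal_minus super_ideal_rmult super_ideal_relator)
  then show ?thesis by (simp add: left_diff_distrib mult.assoc)
qed

text \<open>The letter \<open>x\<close> can be inserted at \<open>Suc (nsame x w)\<close> places,
  before, between and after the letters of its own type, without destroying the order. Modulo the
  ideal each result equals \<open>x\<close> in front of \<open>w\<close>.\<close>

lemma ordered_part_ins_word:
  assumes x: "x \<in> gens n k p"
  shows "set w \<subseteq> gens n k p \<Longrightarrow> ordered w \<Longrightarrow>
    ordered_part (ins_word x w) - tconst (of_nat (Suc (nsame x w))) * (tword [x] * tword w) \<in> super_ideal n k p"
proof (induction w)
  case Nil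
  show ?case by (simp add: ordered_part_tword nsame_def ordered_def tword_Nil)
next
  case (Cons y w)
  let ?s = "tconst ((-1) ^ (gpar x * gpar y))" and ?J = "super_ideal n k p"
  let ?N = "tconst (of_nat (Suc (nsame x w)))"
  have w: "set w \<subseteq> gens n k p" "ordered w" and y: "y \<in> gens n k p" using Cons.prems by (auto simp: ordered_def)
  have tw: "tword w \<in> carrier (tensor_ring n k p)" using w by (simp add: tword_carrier)
  have yc: "tword [y] \<in> carrier (tensor_ring n k p)" using y by (simp add: tword_carrier)
  have step: "?s * (tword [y] * f) - ?N * (tword [x] * (tword [y] * tword w)) \<in> ?J"
    if "f - ?N * (tword [x] * tword w) \<in> ?J" for f
  proof -
    have "?s * (tword [y] * (f - ?N * (tword [x] * tword w))) +
        ?N * (?s * (tword [y] * (tword [x] * tword w)) - tword [x] * (tword [y] * tword w)) \<in> ?J"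
      using that by (intro super_ideal_add super_ideal_smult super_ideal_lmult yc swap_mod_ideal x y tw)
    then show ?thesis
      by (simp add: right_diff_distrib tconst_commute' [of "tword _"] tconst_fold mult.commute)
  qed
  let ?P = "tword [x] * (tword [y] * tword w)"
  have xyw: "tword (x # y # w) = ?P" "tword (y # w) = tword [y] * tword w"
    by (metis tword_Cons)+
  have split: "ordered_part (ins_word x (y # w)) = (if ordered (x # y # w) then ?P else 0) + ?s * ordered_part (tword [y] * ins_word x w)"
    using ordered_part_tword [of "x # y # w"] by (simp add: ordered_part_linear xyw)
  have Suc: "tconst (of_nat (Suc m)) * P = P + tconst (of_nat m) * P" for m P
    by (simp add: tconst_add distrib_right)
  have IH: "ordered_part (ins_word x w) - ?N * (tword [x] * tword w) \<in> ?J" using Cons.IH w by blast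
  consider (VV) "isvec x" "isvec y" | (VD) "isvec x" "\<not> isvec y" | (DV) "\<not> isvec x" "isvec y" | (DD) "\<not> isvec x" "\<not> isvec y"
    by blast
  then show ?case
  proof cases
    case VV
    then have "ordered (x # y # w)" "nsame x (y # w) = Suc (nsame x w)"
      using Cons.prems by (auto simp: ordered_def nsame_def)
    then show ?thesis unfolding split xyw using step [OF IH] VV
      by (simp only: ordered_part_Vec if_True Suc [of "Suc _"] add_diff_add diff_self add_0)
  next
    case VD
    then have dual: "\<forall>z\<in>set w. \<not> isvec z" using Cons.prems by (auto simp: ordered_def)
    have "ordered_part (tword [y] * ins_word x w) = 0"
    proof (rule ordered_part_unordered)
      fix v assume "v \<in> Poly_Mapping.keys (tword [y] * ins_word x w)"
      then show "\<not> ordered v" using VD ins_word_keys [of _ x w] keys_lmult_word [of v "[y]" "ins_word x w"]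
        by (fastforce simp: ordered_def)
    qed
    moreover have "ordered (x # y # w)" "nsame x (y # w) = 0"
      using VD dual Cons.prems by (auto simp: ordered_def nsame_def filter_empty_conv)
    ultimately show ?thesis unfolding split xyw by simp
  next
    case DV
    then have "\<not> ordered (x # y # w)" "nsame x (y # w) = nsame x w"
      using Cons.prems by (auto simp: ordered_def nsame_def)
    then show ?thesis unfolding split xyw using step [OF IH] DV by (simp add: ordered_part_Vec)
  next
    case DD
    then have dual: "\<forall>z\<in>set w. \<not> isvec z" using Cons.prems by (auto simp: ordered_def)
    have o: "ordered v" if "set v \<subseteq> insert x (insert y (set w))" for v
      using that DD dual by (induction v) (auto simp: ordered_def)
    have "ordered_part (tword [y] * ins_word x w) = tword [y] * ins_word x w"
    proof (rule ordered_part_ordered)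
      fix v assume "v \<in> Poly_Mapping.keys (tword [y] * ins_word x w)"
      then show "ordered v" using ins_word_keys [of _ x w] keys_lmult_word [of v "[y]" "ins_word x w"]
        by (intro o) fastforce
    qed
    moreover have "ordered_part (ins_word x w) = ins_word x w"
    proof (rule ordered_part_ordered)
      fix v assume "v \<in> Poly_Mapping.keys (ins_word x w)"
      then show "ordered v" using ins_word_keys [of v x w] by (intro o) fastforce
    qed
    moreover have "ordered (x # y # w)" by (rule o) auto
    moreover have "nsame x (y # w) = Suc (nsame x w)" using DD by (simp add: nsame_def)
    ultimately show ?thesis unfolding split xyw using step [OF IH]
      by (simp only: if_True Suc [of "Suc _"] add_diff_add diff_self add_0)
  qed
qed

definition counts :: "gen list \<Rightarrow> nat \<times> nat" where
  "counts w = (length (filter isvec w), length (filter (\<lambda>y. \<not> isvec y) w))"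

text \<open>The number of arrangements of the letters, counted as distinct, that put the vectors
  before the covectors. It is the scalar by which symmetrizing and keeping the ordered words acts
  modulo the ideal.\<close>

definition fact2 :: "gen list \<Rightarrow> complex" where
  "fact2 w = fact (fst (counts w)) * fact (snd (counts w))"

lemma fact2_Cons: "fact2 (x # w) = of_nat (Suc (nsame x w)) * fact2 w"
  by (cases x) (simp_all add: fact2_def counts_def nsame_def)

lemma fact2_nonzero: "fact2 w \<noteq> 0"
  by (simp add: fact2_def)

lemma keys_tconst_mult: "Poly_Mapping.keys (tconst c * f) \<subseteq> Poly_Mapping.keys f"
  using keys_mult [of "tconst c" f] by (auto simp: tconst_def plus_list_def split: if_splits)

lemma keys_lin_ext: "v \<in> Poly_Mapping.keys (lin_ext h f) \<Longrightarrow> \<exists>u\<in>Poly_Mapping.keys f. v \<in> Poly_Mapping.keys (h u)"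
proof -
  assume "v \<in> Poly_Mapping.keys (lin_ext h f)"
  then have "(\<Sum>w\<in>Poly_Mapping.keys f. coeff (tconst (coeff f w) * h w) v) \<noteq> 0"
    by (simp add: lin_ext_def lookup_sum in_keys_iff)
  then obtain w where "w \<in> Poly_Mapping.keys f" "coeff (tconst (coeff f w) * h w) v \<noteq> 0"
    by (meson sum.not_neutral_contains_not_neutral)
  then have "v \<in> Poly_Mapping.keys (tconst (coeff f w) * h w)" by (simp add: in_keys_iff)
  then show ?thesis using keys_tconst_mult \<open>w \<in> Poly_Mapping.keys f\<close> by blast
qed

lemma counts_ins_list: "v \<in> Poly_Mapping.keys (ins_list w 1) \<Longrightarrow> counts v = counts w"
proof (induction w arbitrary: v)
  case Nil
  then have "v = []" by (simp add: zero_list_def)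
  then show ?case by simp
next
  case (Cons x w)
  then obtain u where u: "u \<in> Poly_Mapping.keys (ins_list w 1)" "v \<in> Poly_Mapping.keys (ins_word x u)"
    using keys_lin_ext unfolding ins_list_simps ins_def by blast
  then have "counts u = counts w" using Cons.IH by blast
  moreover obtain u1 u2 where "v = u1 @ x # u2" "u = u1 @ u2" using ins_word_keys [OF u(2)] by blast
  ultimately show ?case by (auto simp: counts_def)
qed

lemma ordered_part_ins_list:
  "set w \<subseteq> gens n k p \<Longrightarrow> ordered_part (ins_list w 1) - tconst (fact2 w) * tword w \<in> super_ideal n k p"
proof (induction w)
  case Nil
  show ?case using ordered_part_tword [of "[]"] by (simp add: tword_Nil ordered_def fact2_def counts_def)
next
  case (Cons x w)
  let ?J = "super_ideal n k p" and ?R = "carrier (tensor_ring n k p)"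
  have x: "x \<in> gens n k p" and w: "set w \<subseteq> gens n k p" using Cons.prems by auto
  define g where "g = ordered_part (ins_list w 1)"
  let ?N = "tconst (of_nat (Suc (nsame x w)))"
  \<comment> \<open>The words of a symmetrized word all have the same number of letters of each
    type, so one insertion count serves for all of them.\<close>
  have *: "ordered_part (ins x (ordered_part f)) - tconst (of_nat (Suc (nsame x w))) * (tword [x] * ordered_part f) \<in> ?J"
    if "f \<in> ?R" "\<And>v. v \<in> Poly_Mapping.keys f \<Longrightarrow> counts v = counts w" for f
  proof -
    let ?h = "\<lambda>v. ordered_part (ins x (if ordered v then tword v else 0)) - ?N * (tword [x] * (if ordered v then tword v else 0))"
    have "ordered_part (ins x (lin_ext h f)) - ?N * (tword [x] * lin_ext h f) =
        lin_ext (\<lambda>v. ordered_part (ins x (h v)) - ?N * (tword [x] * h v)) f" for h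
      by (induction f rule: tensor_word_induct)
        (simp_all add: lin_ext_add lin_ext_smult ordered_part_linear ins_linear algebra_simps tconst_commute' [of "tword _"] tconst_fold mult.commute
          tconst_commute' [of ?N])
    then have "ordered_part (ins x (ordered_part f)) - ?N * (tword [x] * ordered_part f) = lin_ext ?h f" by (simp add: ordered_part_def)
    also have "\<dots> \<in> ?J"
      unfolding lin_ext_def
    proof (intro super_ideal_sum super_ideal_smult)
      fix v assume v: "v \<in> Poly_Mapping.keys f"
      then have "nsame x v = nsame x w"
        using that(2) [OF v] by (cases x) (auto simp: nsame_def counts_def)
      moreover have "set v \<subseteq> gens n k p" using that(1) v by (auto simp: tensor_ring_def)
      ultimately show "?h v \<in> ?J"
        using ordered_part_ins_word [OF x, of v] by (simp add: ins_tword ins_linear ordered_part_linear)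
    qed
    finally show ?thesis .
  qed
  from * [OF ins_list_carrier [OF w] counts_ins_list]
  have "ordered_part (ins_list (x # w) 1) - ?N * (tword [x] * g) \<in> ?J"
    unfolding g_def by (simp flip: ordered_part_ins)
  moreover have "?N * (tword [x] * (g - tconst (fact2 w) * tword w)) \<in> ?J"
    unfolding g_def using Cons.IH [OF w] x by (intro super_ideal_smult super_ideal_lmult tword_carrier) auto
  ultimately have "ordered_part (ins_list (x # w) 1) - ?N * (tword [x] * g) + ?N * (tword [x] * (g - tconst (fact2 w) * tword w)) \<in> ?J"
    by (rule super_ideal_add)
  also have "ordered_part (ins_list (x # w) 1) - ?N * (tword [x] * g) + ?N * (tword [x] * (g - tconst (fact2 w) * tword w)) =
      ordered_part (ins_list (x # w) 1) - tconst (fact2 (x # w)) * tword (x # w)"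
    unfolding fact2_Cons tword_Cons [of x w]
    by (simp only: right_diff_distrib tconst_commute' [of "tword _"] tconst_fold) simp
  finally show ?case .
qed

text \<open>All words in the symmetrization of \<open>w\<close> have the same \<open>fact2\<close>,
  so dividing word by word cancels the scalar of \<open>ordered_part_ins_list\<close>.\<close>

lemma supersym_reconstruct:
  assumes f: "f \<in> carrier (tensor_ring n k p)"
  shows "f - lin_ext (\<lambda>w. if ordered w then tconst (1 / fact2 w) * tword w else 0) (supersym f) \<in> super_ideal n k p"
    (is "f - lin_ext ?h (supersym f) \<in> ?J")
  using f
proof (induction rule: carrier_induct)
  case (word w)
  have "lin_ext ?h (ins_list w 1) = tconst (1 / fact2 w) * ordered_part (ins_list w 1)"
  proof -
    have "lin_ext ?h (ins_list w 1) = (\<Sum>v\<in>Poly_Mapping.keys (ins_list w 1). tconst (1 / fact2 w) *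
        (tconst (coeff (ins_list w 1) v) * (if ordered v then tword v else 0)))"
      unfolding lin_ext_def
      by (intro sum.cong refl) (use counts_ins_list in \<open>simp add: fact2_def tconst_fold mult.commute\<close>)
    then show ?thesis by (simp add: ordered_part_def lin_ext_def sum_distrib_left)
  qed
  moreover have "tconst (1 / fact2 w) * (ordered_part (ins_list w 1) - tconst (fact2 w) * tword w) \<in> ?J"
    using ordered_part_ins_list [OF word] by (rule super_ideal_smult)
  ultimately have "lin_ext ?h (ins_list w 1) - tword w \<in> ?J"
    using fact2_nonzero [of w] by (simp add: right_diff_distrib tconst_fold)
  then have "- (lin_ext ?h (ins_list w 1) - tword w) \<in> ?J" by (rule super_ideal_minus)
  then show ?case by (simp add: supersym_tword)
next
  case (add f g)
  then have "(f - lin_ext ?h (supersym f)) + (g - lin_ext ?h (supersym g)) \<in> ?J" by (intro super_ideal_add)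
  then show ?case by (simp add: supersym_linear lin_ext_add add_diff_add)
next
  case (smult c f)
  then have "tconst c * (f - lin_ext ?h (supersym f)) \<in> ?J" by (rule super_ideal_smult)
  then show ?case by (simp add: supersym_linear lin_ext_smult right_diff_distrib)
qed (simp add: supersym_linear)

lemma supersym_carrier: "f \<in> carrier (tensor_ring n k p) \<Longrightarrow> supersym f \<in> carrier (tensor_ring n k p)"
  by (induction rule: carrier_induct)
    (auto simp: supersym_linear supersym_tword ins_list_carrier intro: tensor_ring_add_closed tensor_ring_mult_closed)


subsection \<open>The action in coordinates\<close>

fun relab :: "gen \<Rightarrow> idx \<Rightarrow> gen" where
  "relab (Vec t i) a = Vec t a"
| "relab (Dual i s) a = Dual a s"

text \<open>The action read backwards: the coefficient of the letter \<open>z\<close> in the image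
  of \<open>relab z a\<close>. Coefficients at a given word are thus computed from the words that
  differ from it in one index.\<close>

fun cocoeff :: "nat \<Rightarrow> mat \<Rightarrow> gen \<Rightarrow> idx \<Rightarrow> complex" where
  "cocoeff \<pi> A (Vec t i) a = A i a"
| "cocoeff \<pi> A (Dual i s) a = - ((-1) ^ (\<pi> * ipar a)) * A a i"

lemma lookup_tconst_mult: "coeff (tconst c * f) w = c * coeff f w"
proof (induction f rule: tensor_induct)
  case (single v a)
  show ?case by (simp add: tconst_single lookup_single when_def)
qed (simp_all add: lookup_add distrib_left)

lemma lookup_tword: "coeff (tword w) v = (if v = w then 1 else 0)"
  by (auto simp: tword_def lookup_single when_def)

lemma lookup_tword_mult:
  "coeff (tword [y] * f) [] = 0"
  "coeff (tword [y] * f) (z # v) = (if z = y then coeff f v else 0)"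
  by (induction f rule: tensor_word_induct)
    (auto simp: lookup_add distrib_left lookup_tword tconst_commute' [of "tword _"] lookup_tconst_mult simp flip: tword_Cons)

lemma lookup_gen_act_mult:
  assumes "A \<in> gl n"
  shows "coeff (gen_act n \<pi> A g * f) [] = 0"
    "coeff (gen_act n \<pi> A g * f) (z # v) =
      (\<Sum>a\<in>Idx n. cocoeff \<pi> A z a * (if relab z a = g then coeff f v else 0))"
proof -
  show "coeff (gen_act n \<pi> A g * f) [] = 0"
    by (cases g) (simp_all add: sum_distrib_right lookup_sum mult.assoc lookup_tconst_mult lookup_tword_mult)
  have gl: "A i j = 0" if "i \<notin> Idx n \<or> j \<notin> Idx n" for i j
    using assms that by (auto simp: gl_def)
  show "coeff (gen_act n \<pi> A g * f) (z # v) =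
      (\<Sum>a\<in>Idx n. cocoeff \<pi> A z a * (if relab z a = g then coeff f v else 0))"
  proof (cases g; cases z)
    fix t j t' l assume g: "g = Vec t j" "z = Vec t' l"
    have "(\<Sum>i\<in>Idx n. A i j * (if t' = t \<and> l = i then coeff f v else 0)) =
        (\<Sum>i\<in>Idx n. if i = l then (if t' = t then A l j * coeff f v else 0) else 0)"
      by (rule sum.cong) auto
    moreover have "(\<Sum>a\<in>Idx n. A l a * (if t' = t \<and> a = j then coeff f v else 0)) =
        (\<Sum>a\<in>Idx n. if a = j then (if t' = t then A l j * coeff f v else 0) else 0)"
      by (rule sum.cong) auto
    ultimately show ?thesis using gl [of l j] g
      by (simp add: sum_distrib_right lookup_sum mult.assoc lookup_tconst_mult lookup_tword_mult)
  next
    fix i s l s' assume g: "g = Dual i s" "z = Dual l s'"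
    let ?e = "- ((-1) ^ (\<pi> * ipar i)) :: complex"
    have "(\<Sum>j\<in>Idx n. ?e * A i j * (if l = j \<and> s' = s then coeff f v else 0)) =
        (\<Sum>j\<in>Idx n. if j = l then (if s' = s then ?e * A i l * coeff f v else 0) else 0)"
      by (rule sum.cong) auto
    moreover have "(\<Sum>a\<in>Idx n. - ((-1) ^ (\<pi> * ipar a)) * A a l * (if a = i \<and> s' = s then coeff f v else 0)) =
        (\<Sum>a\<in>Idx n. if a = i then (if s' = s then ?e * A i l * coeff f v else 0) else 0)"
      by (rule sum.cong) auto
    ultimately show ?thesis using gl [of i l] g
      by (simp add: sum_distrib_right lookup_sum mult.assoc lookup_tconst_mult lookup_tword_mult del: mult_minus_left)
  qed (simp_all add: sum_distrib_right lookup_sum mult.assoc lookup_tconst_mult lookup_tword_mult)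
qed

lemma wpar_Cons: "wpar (z # v) = gpar z + wpar v"
  by (simp add: wpar_def)

lemma lookup_word_act:
  assumes "A \<in> gl n"
  shows "coeff (word_act n \<pi> A u) w =
    (\<Sum>m<length w. (-1) ^ (\<pi> * wpar (take m w)) *
      (\<Sum>a\<in>Idx n. cocoeff \<pi> A (w ! m) a * (if w[m := relab (w ! m) a] = u then 1 else 0)))"
proof (induction u arbitrary: w)
  case Nil
  have "w[m := z] \<noteq> []" if "m < length w" for m z using that by auto
  then show ?case by simp
next
  case (Cons g u)
  show ?case
  proof (cases w)
    case Nil
    then show ?thesis
      by (simp add: lookup_add lookup_gen_act_mult [OF assms] mult.assoc lookup_tconst_mult lookup_tword_mult)
  next
    case w: (Cons z v)
    have "coeff (word_act n \<pi> A (g # u)) w =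
       (\<Sum>a\<in>Idx n. cocoeff \<pi> A z a * (if relab z a = g then (if v = u then 1 else 0) else 0)) +
       (-1) ^ (\<pi> * gpar g) * (if z = g then coeff (word_act n \<pi> A u) v else 0)"
      unfolding lookup_tword [symmetric] by (simp add: w lookup_add lookup_gen_act_mult [OF assms] mult.assoc lookup_tconst_mult lookup_tword_mult)
    also have "(\<Sum>a\<in>Idx n. cocoeff \<pi> A z a * (if relab z a = g then (if v = u then 1 else 0) else 0)) =
        (\<Sum>a\<in>Idx n. cocoeff \<pi> A (w ! 0) a * (if w[0 := relab (w ! 0) a] = g # u then 1 else 0))"
      by (rule sum.cong) (auto simp: w)
    also have "(-1) ^ (\<pi> * gpar g) * (if z = g then coeff (word_act n \<pi> A u) v else 0) =
       (\<Sum>m<length v. (-1) ^ (\<pi> * wpar (take (Suc m) w)) *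
      (\<Sum>a\<in>Idx n. cocoeff \<pi> A (w ! Suc m) a * (if w[Suc m := relab (w ! Suc m) a] = g # u then 1 else 0)))"
      unfolding Cons.IH by (auto simp: w sum_distrib_left wpar_Cons distrib_left power_add mult.assoc)
    finally show ?thesis
      by (simp add: w sum.lessThan_Suc_shift wpar_def del: sum.lessThan_Suc)
  qed
qed

lemma lookup_hom_act:
  assumes "A \<in> gl n"
  shows "coeff (hom_act n \<pi> A f) w =
    (\<Sum>m<length w. (-1) ^ (\<pi> * wpar (take m w)) *
      (\<Sum>a\<in>Idx n. cocoeff \<pi> A (w ! m) a * coeff f (w[m := relab (w ! m) a])))"
proof (induction f rule: tensor_word_induct)
  case (word u)
  show ?case by (simp add: hom_act_word lookup_word_act [OF assms] lookup_tword)
next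
  case (smult c f)
  have "(\<Sum>m<length w. (-1) ^ (\<pi> * wpar (take m w)) *
      (\<Sum>a\<in>Idx n. cocoeff \<pi> A (w ! m) a * (c * coeff f (w[m := relab (w ! m) a])))) =
      c * (\<Sum>m<length w. (-1) ^ (\<pi> * wpar (take m w)) *
      (\<Sum>a\<in>Idx n. cocoeff \<pi> A (w ! m) a * coeff f (w[m := relab (w ! m) a])))"
    unfolding sum_distrib_left by (intro sum.cong refl) (simp add: mult_ac)
  with smult show ?case by (simp add: hom_act_smult lookup_tconst_mult)
qed (simp_all add: hom_act_add lookup_add distrib_left sum.distrib)


section \<open>Invariance of the inner products\<close>

lemma sum_Idx: "(\<Sum>i\<in>Idx n. f i) = (\<Sum>i\<in>{1..n}. f (Ev i)) + (\<Sum>i\<in>{1..n}. f (Od i))"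
proof -
  have "Ev ` {1..n} \<inter> Od ` {1..n} = {}" by auto
  then show ?thesis
    unfolding Idx_def by (subst sum.union_disjoint) (auto simp: sum.reindex inj_on_def)
qed

lemma odd_tensor_flip: "odd_tensor n t s = (\<Sum>i\<in>Idx n. tword [Vec t i] * tword [Dual (flip i) s])"
  by (simp add: odd_tensor_def sum_Idx sum.distrib)

lemma hom_act_pair:
  "hom_act n \<pi> X (tword [Vec t i] * tword [Dual j s]) =
    (\<Sum>l\<in>Idx n. tconst (X l i) * (tword [Vec t l] * tword [Dual j s])) -
    (\<Sum>b\<in>Idx n. tconst ((-1) ^ (\<pi> * ipar i) * (-1) ^ (\<pi> * ipar j) * X j b) * (tword [Vec t i] * tword [Dual b s]))"
  by (simp add: hom_act_mult hom_act_word par_aut_word wpar_def tword_Nil sum_distrib_left sum_distrib_right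
      mult.assoc tconst_commute' [of "tword _"] tconst_fold tconst_minus sum_negf)

text \<open>This tensor is the identity operator of the superspace. The two halves of the Leibniz
  rule differ only by the names of the summation indices, for every matrix \<open>X\<close>.\<close>

lemma hom_act_even_tensor: "hom_act n \<pi> X (even_tensor n t s) = 0"
proof -
  have "hom_act n \<pi> X (even_tensor n t s) =
    (\<Sum>i\<in>Idx n. \<Sum>l\<in>Idx n. tconst (X l i) * (tword [Vec t l] * tword [Dual i s])) -
    (\<Sum>i\<in>Idx n. \<Sum>b\<in>Idx n. tconst (X i b) * (tword [Vec t i] * tword [Dual b s]))"
    by (simp add: even_tensor_def hom_act_sum hom_act_pair sum_subtractf)
  then show ?thesis by (subst (asm) sum.swap) simp
qed

lemma ipar_add_flip: "ipar i + ipar (flip i) = 1"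
  by (cases i) auto

text \<open>After reindexing by \<open>flip\<close>, the two halves of the Leibniz rule compare
  \<open>X l (flip i)\<close> with \<open>(-1) ^ \<pi> * X (flip l) i\<close>, which agree because
  \<open>X\<close> is fixed by \<open>sharp\<close>.\<close>

lemma hom_act_odd_tensor:
  assumes X: "sharp \<pi> X = X"
  shows "hom_act n \<pi> X (odd_tensor n t s) = 0"
proof -
  have X': "X l (flip i) = (-1) ^ \<pi> * X (flip l) i" for l i
    by (subst X [symmetric]) (simp add: sharp_def)
  have s: "(-1) ^ (\<pi> * ipar i) * (-1) ^ (\<pi> * ipar (flip i)) = ((-1) ^ \<pi> :: complex)" for i
    using ipar_add_flip [of i] by (simp add: power_add [symmetric] distrib_left [symmetric])
  have "hom_act n \<pi> X (odd_tensor n t s) =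
    (\<Sum>i\<in>Idx n. \<Sum>l\<in>Idx n. tconst (X l i) * (tword [Vec t l] * tword [Dual (flip i) s])) -
    (\<Sum>i\<in>Idx n. \<Sum>b\<in>Idx n. tconst ((-1) ^ \<pi> * X (flip i) b) * (tword [Vec t i] * tword [Dual b s]))"
    by (simp add: odd_tensor_flip hom_act_sum hom_act_pair sum_subtractf s)
  also have "(\<Sum>i\<in>Idx n. \<Sum>l\<in>Idx n. tconst (X l i) * (tword [Vec t l] * tword [Dual (flip i) s])) =
      (\<Sum>i\<in>Idx n. \<Sum>l\<in>Idx n. tconst (X l (flip i)) * (tword [Vec t l] * tword [Dual i s]))"
    by (subst sum_flip [symmetric]) simp
  also have "\<dots> = (\<Sum>l\<in>Idx n. \<Sum>i\<in>Idx n. tconst (X l (flip i)) * (tword [Vec t l] * tword [Dual i s]))"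
    by (rule sum.swap)
  finally show ?thesis by (simp only: X' diff_self)
qed

lemma homog_mod_2: "homog \<pi> X \<Longrightarrow> \<pi> < 2 \<Longrightarrow> X i j \<noteq> 0 \<Longrightarrow> (ipar i + ipar j) mod 2 = \<pi>"
  unfolding homog_def by (auto simp: less_2_cases_iff even_iff_mod_2_eq_zero odd_iff_mod_2_eq_one)

lemma hom_part_gl: "A \<in> gl n \<Longrightarrow> hom_part \<pi> A \<in> gl n"
  by (auto simp: gl_def hom_part_def)

lemma lookup_odd_tensor:
  "coeff (odd_tensor n t s) [Vec t a, Dual b s] = (if a \<in> Idx n \<and> b = flip a then 1 else 0)"
proof -
  have "coeff (odd_tensor n t s) [Vec t a, Dual b s] = (\<Sum>i\<in>Idx n. if i = a then (if b = flip a then 1 else 0) else 0)"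
    unfolding odd_tensor_flip lookup_sum
    by (rule sum.cong [OF refl]) (auto simp: lookup_tword simp flip: tword_append)
  then show ?thesis by simp
qed

lemma lookup_hom_act_odd_tensor:
  assumes "X \<in> gl n" "l \<in> Idx n" "j \<in> Idx n"
  shows "coeff (hom_act n \<rho> X (odd_tensor n t s)) [Vec t l, Dual j s] =
    X l (flip j) - (-1) ^ \<rho> * X (flip l) j"
proof -
  have 1: "(\<Sum>a\<in>Idx n. X l a * (if a \<in> Idx n \<and> j = flip a then 1 else 0)) = X l (flip j)"
  proof -
    have "(\<Sum>a\<in>Idx n. X l a * (if a \<in> Idx n \<and> j = flip a then 1 else 0)) = (\<Sum>a\<in>Idx n. if a = flip j then X l (flip j) else 0)"
      by (rule sum.cong) auto
    then show ?thesis using assms by simp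
  qed
  have 2: "(\<Sum>a\<in>Idx n. - ((-1) ^ (\<rho> * ipar a)) * X a j * (if l \<in> Idx n \<and> a = flip l then 1 else 0)) =
      - ((-1) ^ (\<rho> * ipar (flip l))) * X (flip l) j"
  proof -
    have "(\<Sum>a\<in>Idx n. - ((-1) ^ (\<rho> * ipar a)) * X a j * (if l \<in> Idx n \<and> a = flip l then 1 else 0)) =
        (\<Sum>a\<in>Idx n. if a = flip l then - ((-1) ^ (\<rho> * ipar (flip l))) * X (flip l) j else 0)"
      using assms by (intro sum.cong) auto
    then show ?thesis using assms by simp
  qed
  have 3: "(-1) ^ (\<rho> * ipar l) * (-1) ^ (\<rho> * ipar (flip l)) = ((-1) ^ \<rho> :: complex)"
    using ipar_add_flip [of l] by (simp add: power_add [symmetric] distrib_left [symmetric])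
  have "coeff (hom_act n \<rho> X (odd_tensor n t s)) [Vec t l, Dual j s] =
    X l (flip j) + (-1) ^ (\<rho> * ipar l) * (- ((-1) ^ (\<rho> * ipar (flip l))) * X (flip l) j)"
    unfolding lookup_hom_act [OF assms(1)] 1 [symmetric] 2 [symmetric]
    by (simp add: lessThan_Suc numeral_2_eq_2 lookup_odd_tensor wpar_def)
  then show ?thesis by (simp add: mult.assoc [symmetric] 3)
qed

text \<open>The defining equation of q(V) adds contributions of the even and of the odd part of
  \<open>A\<close>, but at any given pair of indices only one part can be nonzero, so the equation
  splits.\<close>

lemma q_alg_sharp:
  assumes "A \<in> q_alg n" "\<pi> < 2"
  shows "sharp \<pi> (hom_part \<pi> A) = hom_part \<pi> A"
proof -
  have A: "A \<in> gl n" and z: "tensor_act n A (odd_tensor n 1 1) = 0" using assms by (auto simp: q_alg_def)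
  have "hom_part 0 A l (flip j) - hom_part 0 A (flip l) j + (hom_part 1 A l (flip j) + hom_part 1 A (flip l) j) = 0"
    if "l \<in> Idx n" "j \<in> Idx n" for l j
    using arg_cong [OF z, of "\<lambda>f. coeff f [Vec 1 l, Dual j 1]"] that
    by (simp add: tensor_act_def lookup_add lookup_hom_act_odd_tensor hom_part_gl A)
  from this [of _ "flip _"] have *: "hom_part 0 A l j - hom_part 0 A (flip l) (flip j) + (hom_part 1 A l j + hom_part 1 A (flip l) (flip j)) = 0"
    if "l \<in> Idx n" "j \<in> Idx n" for l j
    using that by (metis flip_Idx flip_flip)
  have "sharp \<pi> (hom_part \<pi> A) l j = hom_part \<pi> A l j" for l j
  proof (cases "l \<in> Idx n \<and> j \<in> Idx n")
    case True
    then have "hom_part 0 A l j - hom_part 0 A (flip l) (flip j) + (hom_part 1 A l j + hom_part 1 A (flip l) (flip j)) = 0"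
      using * by blast
    then show ?thesis using assms(2)
      by (cases l; cases j) (auto simp: less_2_cases_iff sharp_def hom_part_def eq_neg_iff_add_eq_0 neg_eq_iff_add_eq_0 add_ac)
  next
    case False
    then show ?thesis using hom_part_gl [OF A, of \<pi>] by (auto simp: gl_def sharp_def)
  qed
  then show ?thesis by blast
qed

lemma hom_act_zero_mat: "hom_act n \<pi> (\<lambda>i j. 0) f = 0"
proof -
  have "gen_act n \<pi> (\<lambda>i j. 0) g = 0" for g by (cases g) simp_all
  then have "word_act n \<pi> (\<lambda>i j. 0) w = 0" for w by (induction w) simp_all
  then show ?thesis by (simp add: hom_act_def)
qed

lemma tensor_act_homog:
  assumes "homog \<pi> X" "\<pi> < 2"
  shows "tensor_act n X f = hom_act n \<pi> X f"
proof -
  have "hom_part \<rho> X = (if \<rho> = \<pi> then X else (\<lambda>i j. 0))" for \<rho>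
    using homog_mod_2 [OF assms] by (auto simp: hom_part_def fun_eq_iff)
  then show ?thesis using assms(2)
    by (auto simp: tensor_act_def hom_act_zero_mat less_2_cases_iff)
qed

lemma q_homog_q_alg: "q_homog n \<pi> X \<Longrightarrow> \<pi> < 2 \<Longrightarrow> X \<in> q_alg n"
  by (simp add: q_alg_def q_homog_def tensor_act_homog [of \<pi> X] hom_act_odd_tensor)


section \<open>The generated subalgebra\<close>

definition inner_products :: "nat \<Rightarrow> nat \<Rightarrow> nat \<Rightarrow> tensor set set" where
  "inner_products n k p = {even_inner n k p t s | t s. t \<in> {1..k} \<and> s \<in> {1..p}} \<union>
     {odd_inner n k p t s | t s. t \<in> {1..k} \<and> s \<in> {1..p}}"

abbreviation subalg :: "nat \<Rightarrow> nat \<Rightarrow> nat \<Rightarrow> tensor set set" where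
  "subalg n k p \<equiv> generated_subalgebra n k p (inner_products n k p)"

lemma proj_hom: "proj n k p \<in> ring_hom (tensor_ring n k p) (sym_alg n k p)"
  using ideal.rcos_ring_hom [OF ideal_super_ideal [of n k p]]
  unfolding sym_alg_def proj_def by (simp add: fun_eq_iff [symmetric] eta_contract_eq)

lemma proj_add: "f \<in> carrier (tensor_ring n k p) \<Longrightarrow> g \<in> carrier (tensor_ring n k p) \<Longrightarrow>
    proj n k p (f + g) = proj n k p f \<oplus>\<^bsub>sym_alg n k p\<^esub> proj n k p g"
  and proj_mult: "f \<in> carrier (tensor_ring n k p) \<Longrightarrow> g \<in> carrier (tensor_ring n k p) \<Longrightarrow>
    proj n k p (f * g) = proj n k p f \<otimes>\<^bsub>sym_alg n k p\<^esub> proj n k p g"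
  and proj_one: "proj n k p 1 = \<one>\<^bsub>sym_alg n k p\<^esub>"
  using ring_hom_add [OF proj_hom] ring_hom_mult [OF proj_hom] ring_hom_one [OF proj_hom] by auto

lemma proj_zero: "\<zero>\<^bsub>sym_alg n k p\<^esub> = proj n k p 0"
  by (simp add: sym_alg_def FactRing_def proj_eq)

lemma proj_carrier: "f \<in> carrier (tensor_ring n k p) \<Longrightarrow> proj n k p f \<in> carrier (sym_alg n k p)"
  using ring_hom_closed [OF proj_hom] .

lemma carrier_proj: "F \<in> carrier (sym_alg n k p) \<Longrightarrow> \<exists>f\<in>carrier (tensor_ring n k p). F = proj n k p f"
proof -
  assume "F \<in> carrier (sym_alg n k p)"
  then have "F \<in> a_rcosets\<^bsub>tensor_ring n k p\<^esub> super_ideal n k p" by (simp add: sym_alg_def FactRing_def)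
  then obtain f where "f \<in> carrier (tensor_ring n k p)" "F = super_ideal n k p #>\<^bsub>add_monoid (tensor_ring n k p)\<^esub> f"
    unfolding A_RCOSETS_def RCOSETS_def by auto
  then show ?thesis by (intro bexI [of _ f]) (simp_all only: proj_def a_r_coset_def)
qed

lemma proj_uminus: "f \<in> carrier (tensor_ring n k p) \<Longrightarrow> \<ominus>\<^bsub>sym_alg n k p\<^esub> proj n k p f = proj n k p (- f)"
proof -
  assume f: "f \<in> carrier (tensor_ring n k p)"
  interpret R: ring "sym_alg n k p" by (rule ring_sym_alg)
  have "- f \<in> carrier (tensor_ring n k p)" using f by (simp add: tensor_ring_def)
  then show ?thesis
    using f proj_add [of "- f" n k p f]
    by (intro R.minus_equality) (simp_all add: proj_carrier proj_zero)
qed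

lemma tensors_carrier:
  assumes "t \<in> {1..k}" "s \<in> {1..p}"
  shows "even_tensor n t s \<in> carrier (tensor_ring n k p)" "odd_tensor n t s \<in> carrier (tensor_ring n k p)"
  unfolding even_tensor_def odd_tensor_flip using assms
  by (intro tensor_ring_sum_closed tensor_ring_mult_closed tword_carrier; force simp: gens_def)+

text \<open>Demanded of the even and the odd part of \<open>A\<close> separately, because the
  Leibniz rule, used for products, carries a sign depending on the parity.\<close>

definition killed :: "nat \<Rightarrow> nat \<Rightarrow> nat \<Rightarrow> tensor \<Rightarrow> bool" where
  "killed n k p f \<longleftrightarrow> f \<in> carrier (tensor_ring n k p) \<and>
     (\<forall>A\<in>q_alg n. \<forall>\<pi><2. hom_act n \<pi> (hom_part \<pi> A) f \<in> super_ideal n k p)"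

lemma subalg_killed: "F \<in> subalg n k p \<Longrightarrow> \<exists>f. F = proj n k p f \<and> killed n k p f"
  unfolding generated_subalgebra_def
proof (induction rule: generate_ring.induct)
  case one
  have "killed n k p (tconst 1)" by (simp add: killed_def del: tconst_1)
  then show ?case using proj_one by force
next
  case (incl F)
  then consider c where "F = proj n k p (tconst c)"
    | t s where "t \<in> {1..k}" "s \<in> {1..p}" "F = proj n k p (even_tensor n t s)"
    | t s where "t \<in> {1..k}" "s \<in> {1..p}" "F = proj n k p (odd_tensor n t s)"
    by (auto simp: inner_products_def even_inner_def odd_inner_def)
  then show ?case
  proof cases
    case 1
    then show ?thesis by (auto simp: killed_def)
  next
    case 2
    then show ?thesis using tensors_carrier by (auto simp: killed_def hom_act_even_tensor)
  next
    case 3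
    then show ?thesis using tensors_carrier by (auto simp: killed_def hom_act_odd_tensor q_alg_sharp)
  qed
next
  case (a_inv F)
  then obtain f where f: "F = proj n k p f" "killed n k p f" by blast
  moreover have "- f \<in> carrier (tensor_ring n k p)" using f by (simp add: killed_def tensor_ring_def)
  ultimately show ?case
    by (intro exI [of _ "- f"]) (auto simp: proj_uminus killed_def hom_act_minus super_ideal_minus)
next
  case (eng_add F G)
  then obtain f g where "F = proj n k p f" "killed n k p f" "G = proj n k p g" "killed n k p g" by blast
  then show ?case
    by (intro exI [of _ "f + g"]) (auto simp: proj_add killed_def hom_act_add intro: super_ideal_add tensor_ring_add_closed)
next
  case (eng_mult F G)
  then obtain f g where "F = proj n k p f" "killed n k p f" "G = proj n k p g" "killed n k p g" by blast
  moreover from this have "killed n k p (f * g)"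
    unfolding killed_def hom_act_mult
    by (intro conjI ballI allI impI super_ideal_add super_ideal_lmult super_ideal_rmult)
      (auto intro: tensor_ring_mult_closed par_aut_carrier)
  ultimately show ?case by (intro exI [of _ "f * g"]) (auto simp: proj_mult killed_def)
qed

lemma subalg_le_invariants: "subalg n k p \<subseteq> q_invariants n k p"
proof
  fix F assume "F \<in> subalg n k p"
  then obtain f where F: "F = proj n k p f" and f: "killed n k p f" using subalg_killed by blast
  have "sym_act n k p A F = \<zero>\<^bsub>sym_alg n k p\<^esub>" if "A \<in> q_alg n" for A
  proof -
    have "f \<in> carrier (tensor_ring n k p)" using f by (simp add: killed_def)
    moreover have "tensor_act n A f \<in> super_ideal n k p"
      using f that unfolding tensor_act_def killed_def by (intro super_ideal_add) auto
    ultimately show ?thesis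
      unfolding F proj_zero by (simp add: sym_act_proj proj_eq_iff tensor_act_carrier)
  qed
  then show "F \<in> q_invariants n k p"
    using f by (simp add: q_invariants_def F proj_carrier killed_def)
qed

text \<open>The preimage of the generated subalgebra, so that membership can be shown with tensors
  modulo the ideal.\<close>

definition gen_lift :: "nat \<Rightarrow> nat \<Rightarrow> nat \<Rightarrow> tensor set" where
  "gen_lift n k p = {f \<in> carrier (tensor_ring n k p). proj n k p f \<in> subalg n k p}"

lemma gen_lift_add: "f \<in> gen_lift n k p \<Longrightarrow> g \<in> gen_lift n k p \<Longrightarrow> f + g \<in> gen_lift n k p"
  by (auto simp: gen_lift_def proj_add tensor_ring_add_closed generated_subalgebra_def intro: generate_ring.eng_add)

lemma gen_lift_mult: "f \<in> gen_lift n k p \<Longrightarrow> g \<in> gen_lift n k p \<Longrightarrow> f * g \<in> gen_lift n k p"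
  by (auto simp: gen_lift_def proj_mult tensor_ring_mult_closed generated_subalgebra_def intro: generate_ring.eng_mult)

lemma gen_lift_tconst: "tconst c \<in> gen_lift n k p"
  by (auto simp: gen_lift_def generated_subalgebra_def intro: generate_ring.incl)

lemma gen_lift_smult: "f \<in> gen_lift n k p \<Longrightarrow> tconst c * f \<in> gen_lift n k p"
  by (intro gen_lift_mult gen_lift_tconst)

lemma gen_lift_sum: "(\<And>i. i \<in> K \<Longrightarrow> f i \<in> gen_lift n k p) \<Longrightarrow> (\<Sum>i\<in>K. f i) \<in> gen_lift n k p"
  using gen_lift_tconst [of 0] by (induction K rule: infinite_finite_induct) (auto intro: gen_lift_add)

lemma gen_lift_tensors:
  assumes "t \<in> {1..k}" "s \<in> {1..p}"
  shows "even_tensor n t s \<in> gen_lift n k p" "odd_tensor n t s \<in> gen_lift n k p"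
  using assms tensors_carrier [OF assms]
  by (auto simp: gen_lift_def generated_subalgebra_def inner_products_def even_inner_def odd_inner_def
      intro!: generate_ring.incl)

lemma gen_lift_cong:
  assumes "f \<in> gen_lift n k p" "g - f \<in> super_ideal n k p"
  shows "g \<in> gen_lift n k p"
proof -
  have f: "f \<in> carrier (tensor_ring n k p)" using assms by (simp add: gen_lift_def)
  have "g = (g - f) + f" by simp
  then have g: "g \<in> carrier (tensor_ring n k p)"
    using f super_ideal_carrier [OF assms(2)] tensor_ring_add_closed by metis
  then have "proj n k p g = proj n k p f" using f assms(2) by (simp add: proj_eq_iff)
  with assms g show ?thesis by (simp add: gen_lift_def)
qed


section \<open>The tensors of the centralizing group\<close>

text \<open>Vectors appear by decreasing and covectors by increasing position, so that partners are
  nested around the pair at position 0. This agrees with \<open>pos_op\<close>, for which the last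
  position is the leftmost factor.\<close>

definition pair_word :: "nat \<Rightarrow> nat \<Rightarrow> (nat \<Rightarrow> nat) \<Rightarrow> (nat \<Rightarrow> nat) \<Rightarrow> midx \<Rightarrow> midx \<Rightarrow> gen list" where
  "pair_word r r' t s i j = map (\<lambda>m. Vec (t m) (i m)) (rev [0..<r]) @ map (\<lambda>m. Dual (j m) (s m)) [0..<r']"

lemma pair_word_gens:
  assumes "\<And>m. m < r \<Longrightarrow> t m \<in> {1..k}" "\<And>m. m < r' \<Longrightarrow> s m \<in> {1..p}"
    and "\<And>m. m < r \<Longrightarrow> i m \<in> Idx n" "\<And>m. m < r' \<Longrightarrow> j m \<in> Idx n"
  shows "set (pair_word r r' t s i j) \<subseteq> gens n k p"
  using assms by (fastforce simp: pair_word_def gens_def)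

text \<open>
  The sign that turns supercommutation with \<open>q(V)\<close> of the matrix with entries indexed by \<open>i, j\<close> into
  ordinary commutation.
\<close>

definition twist :: "nat \<Rightarrow> midx \<Rightarrow> midx \<Rightarrow> complex" where
  "twist r i j = ((-1) ^ par_sum {..<r} j) ^ (par_sum {..<r} i + par_sum {..<r} j)"

text \<open>Reads the matrix of \<open>g\<close> as a tensor. Since \<open>twist\<close> is a sign,
  multiplying by it also undoes the twist built into \<open>twisted_op\<close>.\<close>

definition group_tensor :: "nat \<Rightarrow> nat \<Rightarrow> midx lop \<Rightarrow> (nat \<Rightarrow> nat) \<Rightarrow> (nat \<Rightarrow> nat) \<Rightarrow> tensor" where
  "group_tensor n r g t s = (\<Sum>i\<in>midxs n r. \<Sum>j\<in>midxs n r.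
     tconst (twist r i j * app g (delta j) i) * tword (pair_word r r t s i j))"

lemma swap_in_word:
  assumes "set u \<subseteq> gens n k p" "x \<in> gens n k p" "y \<in> gens n k p" "set v \<subseteq> gens n k p"
  shows "tconst ((-1) ^ (gpar x * gpar y)) * tword (u @ [y, x] @ v) - tword (u @ [x, y] @ v) \<in> super_ideal n k p"
proof -
  have "tword u * (tconst ((-1) ^ (gpar x * gpar y)) * (tword [y] * (tword [x] * tword v)) - tword [x] * (tword [y] * tword v))
      \<in> super_ideal n k p"
    using assms by (intro super_ideal_lmult swap_mod_ideal tword_carrier) auto
  then show ?thesis
    by (simp add: right_diff_distrib tconst_commute' [of "tword u"] flip: tword_append)
qed

lemma word_swap:
  assumes y: "y \<in> gens n k p"
  shows "set w \<subseteq> gens n k p \<Longrightarrow>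
    tword w * tword [y] - tconst ((-1) ^ (wpar w * gpar y)) * (tword [y] * tword w) \<in> super_ideal n k p"
proof (induction w)
  case Nil
  show ?case by (simp add: tword_Nil wpar_def)
next
  case (Cons x w)
  let ?J = "super_ideal n k p" and ?c = "tconst ((-1) ^ (wpar w * gpar y))"
  have x: "x \<in> gens n k p" and w: "set w \<subseteq> gens n k p" using Cons.prems by auto
  have 1: "tword [x] * (tword w * tword [y] - ?c * (tword [y] * tword w)) \<in> ?J"
    using Cons.IH [OF w] x by (intro super_ideal_lmult tword_carrier) auto
  have 2: "- (?c * (tconst ((-1) ^ (gpar x * gpar y)) * (tword [y] * (tword [x] * tword w)) - tword [x] * (tword [y] * tword w))) \<in> ?J"
    using x y w by (intro super_ideal_minus super_ideal_smult swap_mod_ideal tword_carrier) auto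
  have e: "((-1) ^ (wpar w * gpar y) * (-1) ^ (gpar x * gpar y) :: complex) = (-1) ^ (wpar (x # w) * gpar y)"
    by (simp add: wpar_Cons power_add [symmetric] algebra_simps)
  have "tword (x # w) * tword [y] - tconst ((-1) ^ (wpar (x # w) * gpar y)) * (tword [y] * tword (x # w)) =
    tword [x] * (tword w * tword [y] - ?c * (tword [y] * tword w)) +
    - (?c * (tconst ((-1) ^ (gpar x * gpar y)) * (tword [y] * (tword [x] * tword w)) - tword [x] * (tword [y] * tword w)))"
    unfolding tword_Cons [of x w] right_diff_distrib tconst_fold e
    by (simp add: mult.assoc tconst_commute' [of "tword _"])
  then show ?case using super_ideal_add [OF 1 2] by simp
qed

lemma upt_split: "Suc a < r \<Longrightarrow> rev [0..<r] = rev [Suc (Suc a)..<r] @ [Suc a, a] @ rev [0..<a]"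
proof -
  assume "Suc a < r"
  then have "[0..<r] = [0..<a] @ [a..<r]" "[a..<r] = a # Suc a # [Suc (Suc a)..<r]"
    using upt_add_eq_append [of 0 a "r - a"] by (simp_all add: upt_conv_Cons)
  then show ?thesis by simp
qed

text \<open>After reindexing, the sign of the swap is the sign for exchanging two adjacent vectors
  in the symmetric superalgebra, and \<open>twist\<close> sees only total parities. Hence a swap
  merely permutes the labels \<open>t\<close>.\<close>

lemma group_tensor_swap:
  assumes a: "Suc a < r" and t: "\<And>m. m < r \<Longrightarrow> t m \<in> {1..k}" and s: "\<And>m. m < r \<Longrightarrow> s m \<in> {1..p}"
  shows "group_tensor n r (swap_op a * h) t s - group_tensor n r h (t \<circ> transpose a (Suc a)) s \<in> super_ideal n k p"
proof -
  let ?\<tau> = "transpose a (Suc a)" and ?S = "midxs n r"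
  let ?e = "\<lambda>i. ((-1) ^ ipar (i a)) ^ ipar (i (Suc a)) :: complex"
  have twist: "twist r (i \<circ> ?\<tau>) j = twist r i j" for i j
    using a by (simp add: twist_def par_sum_transpose)
  have "group_tensor n r (swap_op a * h) t s =
     (\<Sum>i\<in>?S. \<Sum>j\<in>?S. tconst (twist r i j * (?e i * app h (delta j) (i \<circ> ?\<tau>))) * tword (pair_word r r t s i j))"
    by (simp add: group_tensor_def app_swap)
  also have "\<dots> = (\<Sum>i\<in>?S. \<Sum>j\<in>?S. tconst (twist r i j * (?e (i \<circ> ?\<tau>) * app h (delta j) i)) * tword (pair_word r r t s (i \<circ> ?\<tau>) j))"
    by (rule sum.reindex_bij_witness [of _ "\<lambda>i. i \<circ> ?\<tau>" "\<lambda>i. i \<circ> ?\<tau>"])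
      (use a twist midxs_transpose in \<open>simp_all add: comp_assoc\<close>)
  finally have "group_tensor n r (swap_op a * h) t s - group_tensor n r h (t \<circ> ?\<tau>) s =
      (\<Sum>i\<in>?S. \<Sum>j\<in>?S. tconst (twist r i j * app h (delta j) i) *
        (tconst (?e (i \<circ> ?\<tau>)) * tword (pair_word r r t s (i \<circ> ?\<tau>) j) - tword (pair_word r r (t \<circ> ?\<tau>) s i j)))"
    by (simp add: group_tensor_def right_diff_distrib sum_subtractf tconst_fold mult_ac)
  also have "\<dots> \<in> super_ideal n k p"
  proof (intro super_ideal_sum super_ideal_smult)
    fix i j assume ij: "i \<in> ?S" "j \<in> ?S"
    let ?v = "\<lambda>m. Vec (t m) (i m)"
    let ?U = "map ?v (rev [Suc (Suc a)..<r])"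
    let ?V = "map ?v (rev [0..<a]) @ map (\<lambda>m. Dual (j m) (s m)) [0..<r]"
    let ?x = "Vec (t a) (i (Suc a))" and ?y = "Vec (t (Suc a)) (i a)"
    have w: "pair_word r r t s (i \<circ> ?\<tau>) j = ?U @ [?y, ?x] @ ?V" "pair_word r r (t \<circ> ?\<tau>) s i j = ?U @ [?x, ?y] @ ?V"
      unfolding pair_word_def upt_split [OF a] by (auto simp: transpose_def)
    have e: "?e (i \<circ> ?\<tau>) = (-1) ^ (gpar ?x * gpar ?y)"
      by (simp add: power_mult)
    have g: "set ?U \<subseteq> gens n k p" "?x \<in> gens n k p" "?y \<in> gens n k p" "set ?V \<subseteq> gens n k p"
      using a t s ij by (auto simp: gens_def midxs_iff)
    show "tconst (?e (i \<circ> ?\<tau>)) * tword (pair_word r r t s (i \<circ> ?\<tau>) j) - tword (pair_word r r (t \<circ> ?\<tau>) s i j) \<in> super_ideal n k p"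
      unfolding w e by (rule swap_in_word [OF g])
  qed
  finally show ?thesis .
qed

definition flipset :: "nat set \<Rightarrow> midx \<Rightarrow> midx" where
  "flipset B i = (\<lambda>m. if m \<in> B then flip (i m) else i m)"

text \<open>One more flip at \<open>m\<close> negates the prefix signs of those flipped positions
  that are at least \<open>m\<close>. Their number does not depend on the tuple, so the change is
  absorbed into the constant.\<close>

lemma cliffords_form:
  "c \<in> cliffords r \<Longrightarrow> \<exists>B \<epsilon>. B \<subseteq> {..<r} \<and> (\<forall>v i. app c v i = \<epsilon> * (\<Prod>m\<in>B. (-1) ^ par_sum {..m} i) * v (flipset B i))"
proof (induction c rule: cliffords.induct)
  case one
  show ?case by (intro exI [of _ "{}"] exI [of _ 1]) (simp add: flipset_def)
next
  case (step c m)
  then obtain B \<epsilon> where B: "B \<subseteq> {..<r}" and c: "\<And>v i. app c v i = \<epsilon> * (\<Prod>m\<in>B. (-1) ^ par_sum {..m} i) * v (flipset B i)"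
    by blast
  have fin: "finite B" using B finite_subset by blast
  define B' where "B' = (if m \<in> B then B - {m} else insert m B)"
  define K where "K = (\<Prod>l\<in>B. if m \<le> l then -1 else 1 :: complex)"
  have "app (cliff_op m * c) v i = \<epsilon> * K * (\<Prod>m\<in>B'. (-1) ^ par_sum {..m} i) * v (flipset B' i)" for v i
  proof -
    have "flipset B (i(m := flip (i m))) = flipset B' i"
      by (auto simp: flipset_def B'_def fun_eq_iff)
    moreover have "(\<Prod>l\<in>B. (-1) ^ par_sum {..l} (i(m := flip (i m)))) = K * (\<Prod>l\<in>B. (-1) ^ par_sum {..l} i :: complex)"
      unfolding K_def prod.distrib [symmetric] by (rule prod.cong) (auto simp: par_sum_upd sgn_flip)
    moreover have "(-1) ^ par_sum {..m} i * (\<Prod>l\<in>B. (-1) ^ par_sum {..l} i) = (\<Prod>l\<in>B'. (-1) ^ par_sum {..l} i :: complex)"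
      using fin by (simp add: B'_def prod.remove [of B m])
    ultimately show ?thesis
      by (simp add: app_cliff c mult_ac)
  qed
  moreover have "B' \<subseteq> {..<r}" using B step by (auto simp: B'_def)
  ultimately show ?case by blast
qed

lemma sgn_sum: "(-1) ^ (\<Sum>m\<in>M. f m) = (\<Prod>m\<in>M. (-1) ^ f m :: complex)"
  by (induction M rule: infinite_finite_induct) (simp_all add: power_add)

lemma sgn_par_sum_flipset:
  "(-1) ^ par_sum {..<r} (flipset B i) = (-1) ^ card (B \<inter> {..<r}) * ((-1) ^ par_sum {..<r} i :: complex)"
proof -
  have "(-1) ^ par_sum {..<r} (flipset B i) = (\<Prod>m<r. (if m \<in> B then -1 else 1) * (-1) ^ ipar (i m) :: complex)"
    unfolding par_sum_def sgn_sum by (rule prod.cong) (auto simp: flipset_def sgn_flip)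
  also have "\<dots> = (\<Prod>m\<in>{..<r}. if m \<in> B then -1 else 1) * (-1) ^ par_sum {..<r} i"
    by (simp add: prod.distrib par_sum_def sgn_sum)
  also have "(\<Prod>m\<in>{..<r}. if m \<in> B then -1 else 1 :: complex) = (-1) ^ card (B \<inter> {..<r})"
    by (simp add: prod.If_cases Int_commute)
  finally show ?thesis .
qed

lemma wpar_pair_word: "wpar (pair_word r r t s i j) = par_sum {..<r} i + par_sum {..<r} j"
  by (simp add: wpar_def pair_word_def par_sum_def comp_def sum_list_rev flip: rev_map)
    (simp add: interv_sum_list_conv_sum_set_nat atLeast0LessThan)

lemma sum_midxs_Suc:
  "(\<Sum>i\<in>midxs n (Suc r). f i) = (\<Sum>a\<in>Idx n. \<Sum>i\<in>midxs n r. f (i(r := a)))"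
proof -
  have "(\<Sum>z\<in>Idx n \<times> midxs n r. f ((snd z)(r := fst z))) = (\<Sum>i\<in>midxs n (Suc r). f i)"
    by (rule sum.reindex_bij_witness [of _ "\<lambda>i. (i r, i(r := undefined))" "\<lambda>z. (snd z)(r := fst z)"])
      (auto simp: midxs_iff less_Suc_eq fun_eq_iff)
  then show ?thesis by (simp add: sum.cartesian_product split_beta)
qed

text \<open>
  The outermost pair of letters is \<open>e\<^sub>a\<close> and its partner. Moving the partner past the inner word
  produces a sign that, together with the one of \<open>a\<close> in the coefficient, does not depend on \<open>a\<close>.
\<close>

lemma nested_gen_lift:
  "(\<And>m. m < r \<Longrightarrow> t m \<in> {1..k} \<and> s m \<in> {1..p}) \<Longrightarrow>
   (\<Sum>i\<in>midxs n r. tconst (\<Prod>m\<in>B \<inter> {..<r}. (-1) ^ par_sum {m<..<r} i) * tword (pair_word r r t s i (flipset B i))) \<in> gen_lift n k p"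
proof (induction r)
  case 0
  have "midxs n 0 = {\<lambda>_. undefined}" by (auto simp: midxs_def)
  then show ?case using gen_lift_tconst [of 1] by (simp add: pair_word_def tword_Nil)
next
  case (Suc r)
  let ?J = "super_ideal n k p" and ?w = "\<lambda>i. pair_word r r t s i (flipset B i)" and ?c = "card (B \<inter> {..<r})"
  let ?P = "\<lambda>i. \<Prod>m\<in>B \<inter> {..<r}. (-1) ^ par_sum {m<..<r} i :: complex"
  let ?N = "\<Sum>i\<in>midxs n r. tconst (?P i) * tword (?w i)"
  let ?f = "\<lambda>a. if r \<in> B then flip a else a"
  let ?x = "\<lambda>a. Vec (t r) a" and ?y = "\<lambda>a. Dual (?f a) (s r)"
  have labels: "t r \<in> {1..k}" "s r \<in> {1..p}" using Suc.prems by auto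
  \<comment> \<open>If position \<open>r\<close> is flipped, the partner of \<open>a\<close> has the
    opposite parity, which leaves one sign for each flipped inner position; otherwise the two signs
    of \<open>a\<close> cancel.\<close>
  define K where "K = ((-1) ^ (if r \<in> B then ?c else 0) :: complex)"
  define Y where "Y = (\<Sum>a\<in>Idx n. tword [?x a] * tword [?y a])"
  have "Y \<in> gen_lift n k p"
    using gen_lift_tensors [OF labels, of n] unfolding Y_def even_tensor_def odd_tensor_flip
    by (cases "r \<in> B") simp_all
  then have mem: "tconst K * (Y * ?N) \<in> gen_lift n k p"
    using Suc by (intro gen_lift_smult gen_lift_mult) auto
  have sgn: "(\<Prod>m\<in>B \<inter> {..<Suc r}. (-1) ^ par_sum {m<..<Suc r} (i(r := a))) = ((-1) ^ ipar a) ^ ?c * ?P i" for a i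
  proof -
    have *: "par_sum {m<..<Suc r} (i(r := a)) = ipar a + par_sum {m<..<r} i" if "m < r" for m
    proof -
      have "{m<..<Suc r} = insert r {m<..<r}" using that by auto
      then show ?thesis by (simp add: par_sum_def)
    qed
    have "(\<Prod>m\<in>B \<inter> {..<Suc r}. (-1) ^ par_sum {m<..<Suc r} (i(r := a)) :: complex) =
        (\<Prod>m\<in>B \<inter> {..<r}. (-1) ^ par_sum {m<..<Suc r} (i(r := a)))"
    proof (rule prod.mono_neutral_right)
      have "{r<..<Suc r} = {}" by auto
      then show "\<forall>m\<in>B \<inter> {..<Suc r} - B \<inter> {..<r}. (-1) ^ par_sum {m<..<Suc r} (i(r := a)) = (1 :: complex)"
        by (auto simp: par_sum_def less_Suc_eq)
    qed auto
    also have "\<dots> = (\<Prod>m\<in>B \<inter> {..<r}. (-1) ^ ipar a * (-1) ^ par_sum {m<..<r} i)"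
      by (rule prod.cong) (auto simp: * power_add)
    finally show ?thesis by (simp add: prod.distrib)
  qed
  have word: "pair_word (Suc r) (Suc r) t s (i(r := a)) (flipset B (i(r := a))) = ?x a # ?w i @ [?y a]" for a i
    by (auto simp: pair_word_def flipset_def)
  have diff: "tconst (((-1) ^ ipar a) ^ ?c * ?P i) * tword (?x a # ?w i @ [?y a]) -
      tconst (K * ?P i) * (tword [?x a] * (tword [?y a] * tword (?w i))) \<in> ?J"
    if a: "a \<in> Idx n" and i: "i \<in> midxs n r" for a i
  proof -
    have "set (?w i) \<subseteq> gens n k p"
      using Suc.prems i by (intro pair_word_gens) (auto simp: midxs_iff flipset_def)
    moreover have "?x a \<in> gens n k p" "?y a \<in> gens n k p"
      using labels a by (auto simp: gens_def)
    ultimately have gens: "?x a \<in> gens n k p" "?y a \<in> gens n k p" "set (?w i) \<subseteq> gens n k p" by blast+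
    \<comment> \<open>A flipped pair is odd and an unflipped one even, so the parity of the inner
      word is that of the number of flips below \<open>r\<close>.\<close>
    have "(-1) ^ wpar (?w i) = ((-1) ^ ?c :: complex)"
      by (simp add: wpar_pair_word power_add sgn_par_sum_flipset)
    then have e: "(-1) ^ (wpar (?w i) * gpar (?y a)) = (((-1) ^ ipar (?f a)) ^ ?c :: complex)"
      by (simp add: power_mult sgn_pow_swap)
    have K: "((-1) ^ ipar a) ^ ?c * ((-1) ^ ipar (?f a)) ^ ?c = K"
      by (auto simp: K_def sgn_flip power_minus [of "(-1) ^ ipar a"])
    have "tconst (((-1) ^ ipar a) ^ ?c * ?P i) * (tword [?x a] *
        (tword (?w i) * tword [?y a] - tconst ((-1) ^ (wpar (?w i) * gpar (?y a))) * (tword [?y a] * tword (?w i)))) \<in> ?J"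
      using gens by (intro super_ideal_smult super_ideal_lmult word_swap tword_carrier) auto
    also have "tconst (((-1) ^ ipar a) ^ ?c * ?P i) * (tword [?x a] *
        (tword (?w i) * tword [?y a] - tconst ((-1) ^ (wpar (?w i) * gpar (?y a))) * (tword [?y a] * tword (?w i)))) =
        tconst (((-1) ^ ipar a) ^ ?c * ?P i) * tword (?x a # ?w i @ [?y a]) -
        tconst (((-1) ^ ipar a) ^ ?c * ((-1) ^ ipar (?f a)) ^ ?c * ?P i) * (tword [?x a] * (tword [?y a] * tword (?w i)))"
      unfolding e right_diff_distrib tconst_commute' [of "tword _"] tconst_fold
      by (simp add: mult_ac flip: tword_append)
    finally show ?thesis unfolding K .
  qed
  have "Y * ?N = (\<Sum>a\<in>Idx n. \<Sum>i\<in>midxs n r. (tword [?x a] * tword [?y a]) * (tconst (?P i) * tword (?w i)))"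
    unfolding Y_def by (rule sum_product)
  then have "tconst K * (Y * ?N) = (\<Sum>a\<in>Idx n. \<Sum>i\<in>midxs n r.
      tconst K * ((tword [?x a] * tword [?y a]) * (tconst (?P i) * tword (?w i))))"
    by (simp only: sum_distrib_left)
  also have "\<dots> = (\<Sum>a\<in>Idx n. \<Sum>i\<in>midxs n r. tconst (K * ?P i) * (tword [?x a] * (tword [?y a] * tword (?w i))))"
    by (intro sum.cong refl) (simp add: mult.assoc tconst_commute' [of "tword _"] tconst_fold)
  finally have KY: "tconst K * (Y * ?N) = (\<Sum>a\<in>Idx n. \<Sum>i\<in>midxs n r. tconst (K * ?P i) * (tword [?x a] * (tword [?y a] * tword (?w i))))" .
  have "(\<Sum>i\<in>midxs n (Suc r). tconst (\<Prod>m\<in>B \<inter> {..<Suc r}. (-1) ^ par_sum {m<..<Suc r} i) *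
       tword (pair_word (Suc r) (Suc r) t s i (flipset B i))) - tconst K * (Y * ?N) =
      (\<Sum>a\<in>Idx n. \<Sum>i\<in>midxs n r. tconst (((-1) ^ ipar a) ^ ?c * ?P i) * tword (?x a # ?w i @ [?y a]) -
      tconst (K * ?P i) * (tword [?x a] * (tword [?y a] * tword (?w i))))"
    unfolding KY sum_midxs_Suc sgn word sum_subtractf ..
  also have "\<dots> \<in> ?J" by (intro super_ideal_sum diff)
  finally show ?case by (rule gen_lift_cong [OF mem])
qed

text \<open>For \<open>j = flipset B i\<close> the twist contributes, up to a constant, the total
  sign of \<open>i\<close> once for each flipped position. It turns the prefix signs of the Clifford
  operators into the suffix signs that occur in the nested product.\<close>

lemma group_tensor_cliffords:
  assumes c: "c \<in> cliffords r" and t: "\<And>m. m < r \<Longrightarrow> t m \<in> {1..k} \<and> s m \<in> {1..p}"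
  shows "group_tensor n r c t s \<in> gen_lift n k p"
proof -
  obtain B \<epsilon> where B: "B \<subseteq> {..<r}" and cB: "\<And>v i. app c v i = \<epsilon> * (\<Prod>m\<in>B. (-1) ^ par_sum {..m} i) * v (flipset B i)"
    using cliffords_form [OF c] by blast
  let ?P = "\<lambda>i. \<Prod>m\<in>B \<inter> {..<r}. (-1) ^ par_sum {m<..<r} i :: complex"
  have BI: "B \<inter> {..<r} = B" using B by blast
  define K where "K = ((-1) ^ card B) ^ card B * \<epsilon>"
  have twist: "twist r i (flipset B i) * (\<epsilon> * (\<Prod>m\<in>B. (-1) ^ par_sum {..m} i)) = K * ?P i" for i
  proof -
    let ?i = "par_sum {..<r} i" and ?j = "par_sum {..<r} (flipset B i)"
    have j: "(-1) ^ ?j = (-1) ^ card B * ((-1) ^ ?i :: complex)"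
      by (simp add: sgn_par_sum_flipset BI)
    have "twist r i (flipset B i) = ((-1) ^ (?i + ?j)) ^ ?j"
      unfolding twist_def by (rule sgn_pow_swap)
    also have "(-1) ^ (?i + ?j) = ((-1) ^ card B :: complex)"
      by (simp add: power_add j)
    also have "((-1) ^ card B) ^ ?j = (((-1) ^ card B * (-1) ^ ?i) ^ card B :: complex)"
      unfolding j [symmetric] by (rule sgn_pow_swap)
    also have "\<dots> = ((-1) ^ card B) ^ card B * (\<Prod>m\<in>B. (-1) ^ ?i)"
      by (simp add: power_mult_distrib)
    finally have "twist r i (flipset B i) * (\<epsilon> * (\<Prod>m\<in>B. (-1) ^ par_sum {..m} i)) =
        K * (\<Prod>m\<in>B. (-1) ^ ?i * (-1) ^ par_sum {..m} i)"
      by (simp add: K_def prod.distrib mult_ac)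
    also have "(\<Prod>m\<in>B. (-1) ^ ?i * (-1) ^ par_sum {..m} i) = ?P i"
      unfolding BI
    proof (rule prod.cong [OF refl])
      fix m assume "m \<in> B"
      then have "{..<r} = {..m} \<union> {m<..<r}" using B by auto
      then have "?i = par_sum {..m} i + par_sum {m<..<r} i"
        unfolding par_sum_def by (metis sum.union_disjoint finite_atMost finite_greaterThanLessThan ivl_disj_int(2) Int_commute ivl_disj_int_one(2) ivl_disj_int_one(1))
      then show "(-1) ^ ?i * (-1) ^ par_sum {..m} i = ((-1) ^ par_sum {m<..<r} i :: complex)"
        by (simp add: power_add mult_ac)
    qed
    finally show ?thesis .
  qed
  have inner: "(\<Sum>j\<in>midxs n r. tconst (twist r i j * app c (delta j) i) * tword (pair_word r r t s i j)) =
      tconst K * (tconst (?P i) * tword (pair_word r r t s i (flipset B i)))" if "i \<in> midxs n r" for i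
  proof -
    have "flipset B i \<in> midxs n r" using that B by (auto simp: midxs_iff flipset_def)
    have "(\<Sum>j\<in>midxs n r. tconst (twist r i j * app c (delta j) i) * tword (pair_word r r t s i j)) =
       (\<Sum>j\<in>midxs n r. if j = flipset B i then tconst (K * ?P i) * tword (pair_word r r t s i (flipset B i)) else 0)"
      by (rule sum.cong) (auto simp: cB delta_def simp flip: twist)
    then show ?thesis using \<open>flipset B i \<in> midxs n r\<close> by (simp add: tconst_fold)
  qed
  have "group_tensor n r c t s = tconst K * (\<Sum>i\<in>midxs n r. tconst (?P i) * tword (pair_word r r t s i (flipset B i)))"
    unfolding group_tensor_def sum_distrib_left by (intro sum.cong refl inner)
  then show ?thesis using nested_gen_lift [OF t] by (simp add: gen_lift_smult)
qed

lemma group_tensor_sergeev: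
  "h \<in> sergeev r \<Longrightarrow> (\<And>m. m < r \<Longrightarrow> t m \<in> {1..k} \<and> s m \<in> {1..p}) \<Longrightarrow> group_tensor n r h t s \<in> gen_lift n k p"
proof (induction h arbitrary: t rule: sergeev.induct)
  case (base c)
  then show ?case by (simp add: group_tensor_cliffords)
next
  case (step h a)
  have "\<And>m. m < r \<Longrightarrow> (t \<circ> transpose a (Suc a)) m \<in> {1..k} \<and> s m \<in> {1..p}"
    using step.prems step.hyps(2) by (auto simp: transpose_def)
  then have "group_tensor n r h (t \<circ> transpose a (Suc a)) s \<in> gen_lift n k p" by (rule step.IH)
  moreover have "group_tensor n r (swap_op a * h) t s - group_tensor n r h (t \<circ> transpose a (Suc a)) s \<in> super_ideal n k p"
    using step.prems by (intro group_tensor_swap step.hyps(2)) auto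
  ultimately show ?case by (rule gen_lift_cong)
qed


section \<open>Invariants in coordinates\<close>

lemma sum_lessThan_split: "(\<Sum>m<a + b. f m) = (\<Sum>m<a. f m) + (\<Sum>m<b. f (a + m :: nat) :: complex)"
  by (induction b) (simp_all add: add.assoc)

lemma length_pair_word [simp]: "length (pair_word r r' t s i j) = r + r'"
  by (simp add: pair_word_def)

lemma pair_word_nth_Vec: "m < r \<Longrightarrow> pair_word r r' t s i j ! (r - Suc m) = Vec (t m) (i m)"
  by (simp add: pair_word_def nth_append rev_nth)

lemma pair_word_nth_Dual: "m < r' \<Longrightarrow> pair_word r r' t s i j ! (r + m) = Dual (j m) (s m)"
  by (simp add: pair_word_def nth_append)

lemma pair_word_eqI:
  assumes "length w = r + r'" "\<And>m. m < r \<Longrightarrow> w ! (r - Suc m) = Vec (t m) (i m)"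
    "\<And>m. m < r' \<Longrightarrow> w ! (r + m) = Dual (j m) (s m)"
  shows "w = pair_word r r' t s i j"
proof (rule nth_equalityI)
  fix q assume "q < length w"
  show "w ! q = pair_word r r' t s i j ! q"
  proof (cases "q < r")
    case True
    then have "r - Suc q < r" "q = r - Suc (r - Suc q)" by auto
    then show ?thesis using assms(2) [of "r - Suc q"] pair_word_nth_Vec [of "r - Suc q" r r' t s i j] by simp
  next
    case False
    then obtain m where "q = r + m" "m < r'"
      using \<open>q < length w\<close> assms(1) by (metis add.commute add_less_cancel_right le_add_diff_inverse2 not_less)
    then show ?thesis using assms(3) by (simp add: pair_word_nth_Dual)
  qed
qed (simp add: assms(1))

lemma pair_word_upd_Vec: "m < r \<Longrightarrow> (pair_word r r' t s i j)[r - Suc m := Vec (t m) a] = pair_word r r' t s (i(m := a)) j"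
proof (rule pair_word_eqI)
  fix m' assume m: "m < r" "m' < r"
  then have "r - Suc m = r - Suc m' \<longleftrightarrow> m = m'" by auto
  with m show "(pair_word r r' t s i j)[r - Suc m := Vec (t m) a] ! (r - Suc m') = Vec (t m') ((i(m := a)) m')"
    by (simp add: nth_list_update pair_word_nth_Vec)
qed (simp_all add: nth_list_update pair_word_nth_Dual)

lemma pair_word_upd_Dual: "m < r' \<Longrightarrow> (pair_word r r' t s i j)[r + m := Dual a (s m)] = pair_word r r' t s i (j(m := a))"
  by (rule pair_word_eqI) (simp_all add: nth_list_update pair_word_nth_Dual pair_word_nth_Vec)

lemma wpar_take_Vec: "m < r \<Longrightarrow> wpar (take (r - Suc m) (pair_word r r' t s i j)) = par_sum {m<..<r} i"
proof -
  assume m: "m < r"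
  have "take (r - Suc m) (pair_word r r' t s i j) = map (\<lambda>m. Vec (t m) (i m)) (rev [Suc m..<r])"
    using m by (simp add: pair_word_def take_map take_rev)
  then have "wpar (take (r - Suc m) (pair_word r r' t s i j)) = sum_list (rev (map (\<lambda>m. ipar (i m)) [Suc m..<r]))"
    by (simp add: wpar_def comp_def rev_map)
  then show ?thesis
    by (simp add: interv_sum_list_conv_sum_set_nat par_sum_def atLeastSucLessThan_greaterThanLessThan)
qed

lemma wpar_take_Dual: "m < r' \<Longrightarrow> wpar (take (r + m) (pair_word r r' t s i j)) = par_sum {..<r} i + par_sum {..<m} j"
proof -
  assume m: "m < r'"
  have "take (r + m) (pair_word r r' t s i j) = map (\<lambda>m. Vec (t m) (i m)) (rev [0..<r]) @ map (\<lambda>m. Dual (j m) (s m)) [0..<m]"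
    using m by (simp add: pair_word_def take_map)
  then have "wpar (take (r + m) (pair_word r r' t s i j)) =
      sum_list (rev (map (\<lambda>m. ipar (i m)) [0..<r])) + sum_list (map (\<lambda>m. ipar (j m)) [0..<m])"
    by (simp add: wpar_def comp_def rev_map)
  then show ?thesis
    by (simp add: interv_sum_list_conv_sum_set_nat par_sum_def atLeast0LessThan)
qed

text \<open>The first sum is the action on the index \<open>i\<close>, with the Koszul sign of
  \<open>pos_op\<close>; the second is the dual action on \<open>j\<close>. For
  \<open>r = r'\<close>, vanishing of the difference is supercommutation in coordinates.\<close>

lemma lookup_hom_act_pair_word:
  assumes X: "X \<in> gl n"
  shows "coeff (hom_act n \<pi> X g) (pair_word r r' t s i j) =
    (\<Sum>m<r. ((-1) ^ par_sum {m<..<r} i) ^ \<pi> * (\<Sum>a\<in>Idx n. X (i m) a * coeff g (pair_word r r' t s (i(m := a)) j))) -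
    (\<Sum>m<r'. ((-1) ^ (par_sum {..<r} i + par_sum {..<m} j)) ^ \<pi> *
      (\<Sum>a\<in>Idx n. ((-1) ^ ipar a) ^ \<pi> * X a (j m) * coeff g (pair_word r r' t s i (j(m := a)))))"
proof -
  let ?w = "pair_word r r' t s i j"
  let ?F = "\<lambda>q. (-1) ^ (\<pi> * wpar (take q ?w)) *
      (\<Sum>a\<in>Idx n. cocoeff \<pi> X (?w ! q) a * coeff g (?w[q := relab (?w ! q) a]))"
  have s: "(-1) ^ (\<pi> * x) = (((-1) ^ x) ^ \<pi> :: complex)" for x
    by (simp add: power_mult sgn_pow_swap)
  have "coeff (hom_act n \<pi> X g) ?w = (\<Sum>q<r + r'. ?F q)"
    by (simp add: lookup_hom_act [OF X])
  also have "\<dots> = (\<Sum>m<r. ?F (r - Suc m)) + (\<Sum>m<r'. ?F (r + m))"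
    unfolding sum_lessThan_split by (subst sum.nat_diff_reindex) (rule refl)
  also have "(\<Sum>m<r. ?F (r - Suc m)) =
    (\<Sum>m<r. ((-1) ^ par_sum {m<..<r} i) ^ \<pi> * (\<Sum>a\<in>Idx n. X (i m) a * coeff g (pair_word r r' t s (i(m := a)) j)))"
    by (rule sum.cong [OF refl]) (simp add: wpar_take_Vec pair_word_nth_Vec pair_word_upd_Vec s)
  also have "(\<Sum>m<r'. ?F (r + m)) =
    (\<Sum>m<r'. - (((-1) ^ (par_sum {..<r} i + par_sum {..<m} j)) ^ \<pi> *
      (\<Sum>a\<in>Idx n. ((-1) ^ ipar a) ^ \<pi> * X a (j m) * coeff g (pair_word r r' t s i (j(m := a))))))"
    by (rule sum.cong [OF refl]) (simp add: wpar_take_Dual pair_word_nth_Dual pair_word_upd_Dual s sum_negf)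
  finally show ?thesis unfolding sum_negf add_uminus_conv_diff .
qed

definition q_killed :: "nat \<Rightarrow> tensor \<Rightarrow> bool" where
  "q_killed n g \<longleftrightarrow> (\<forall>\<pi> X. \<pi> < 2 \<longrightarrow> q_homog n \<pi> X \<longrightarrow> hom_act n \<pi> X g = 0)"

lemma unbalanced_zero:
  assumes g: "q_killed n g" and "r \<noteq> r'" and i: "i \<in> midxs n r" and j: "j \<in> midxs n r'"
  shows "coeff g (pair_word r r' t s i j) = 0"
proof -
  let ?X = "\<lambda>a b. if a = b \<and> a \<in> Idx n then 1 else 0 :: complex"
  let ?c = "coeff g (pair_word r r' t s i j)"
  have X: "q_homog n 0 ?X"
    by (auto simp: q_homog_def homog_def gl_def sharp_def fun_eq_iff) (metis flip_flip)+
  then have gl: "?X \<in> gl n" by (simp add: q_homog_def)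
  have "(\<Sum>a\<in>Idx n. ?X (i m) a * coeff g (pair_word r r' t s (i(m := a)) j)) = ?c" if "m < r" for m
  proof -
    have "(\<Sum>a\<in>Idx n. ?X (i m) a * coeff g (pair_word r r' t s (i(m := a)) j)) =
        (\<Sum>a\<in>Idx n. if a = i m then ?c else 0)"
      by (rule sum.cong) auto
    then show ?thesis using i that by (simp add: midxs_iff)
  qed
  moreover have "(\<Sum>a\<in>Idx n. ?X a (j m) * coeff g (pair_word r r' t s i (j(m := a)))) = ?c" if "m < r'" for m
  proof -
    have "(\<Sum>a\<in>Idx n. ?X a (j m) * coeff g (pair_word r r' t s i (j(m := a)))) =
        (\<Sum>a\<in>Idx n. if a = j m then ?c else 0)"
      by (rule sum.cong) auto
    then show ?thesis using j that by (simp add: midxs_iff)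
  qed
  moreover have "hom_act n 0 ?X g = 0" using g X unfolding q_killed_def by simp
  ultimately have "0 = (\<Sum>m<r. ?c) - (\<Sum>m<r'. ?c)"
    using lookup_hom_act_pair_word [OF gl, of 0 g r r' t s i j] by simp
  then have "(of_nat r - of_nat r') * ?c = 0" by (auto simp: algebra_simps)
  then show ?thesis using assms(2) by auto
qed

definition twisted_op :: "nat \<Rightarrow> nat \<Rightarrow> (midx \<Rightarrow> midx \<Rightarrow> complex) \<Rightarrow> midx lop" where
  "twisted_op n r c = (\<Sum>i\<in>midxs n r. \<Sum>j\<in>midxs n r. scal (twist r i j * c i j) * mat_unit i j)"

lemma twisted_op_lspan: "twisted_op n r c \<in> lspan (mat_units n r)"
  unfolding twisted_op_def by (intro lspan_sum lspan_scal lspan_base) (auto simp: mat_units_def)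

lemma app_twisted_op: "app (twisted_op n r c) v i = (if i \<in> midxs n r then \<Sum>j\<in>midxs n r. twist r i j * c i j * v j else 0)"
proof -
  have "app (twisted_op n r c) v i = (\<Sum>k\<in>midxs n r. if k = i then (\<Sum>j\<in>midxs n r. twist r i j * c i j * v j) else 0)"
    unfolding twisted_op_def app_sum by (rule sum.cong [OF refl]) (auto simp: app_mat_unit)
  then show ?thesis by simp
qed

lemma twist_upd_left:
  assumes "m < r" "(-1) ^ ipar a = ((-1) ^ \<pi> * (-1) ^ ipar (i m) :: complex)"
  shows "twist r (i(m := a)) j = twist r i j * ((-1) ^ par_sum {..<r} j) ^ \<pi>"
proof -
  have "(-1) ^ par_sum {..<r} (i(m := a)) = ((-1) ^ par_sum {..<r} i * (-1) ^ \<pi> :: complex)"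
    using assms by (simp add: par_sum_upd)
  then show ?thesis
    unfolding twist_def sgn_pow_swap [of "par_sum {..<r} j"] by (simp add: power_add power_mult_distrib mult_ac)
qed

lemma twist_upd_right:
  assumes "m < r" "(-1) ^ ipar (j m) = ((-1) ^ \<pi> * (-1) ^ ipar b :: complex)"
  shows "twist r i (j(m := b)) = twist r i j * ((-1) ^ par_sum {..<r} j) ^ \<pi> * ((-1) ^ (par_sum {..<r} i + par_sum {..<r} j + \<pi>)) ^ \<pi>"
proof -
  let ?I = "par_sum {..<r} i" and ?J = "par_sum {..<r} j" and ?J' = "par_sum {..<r} (j(m := b))"
  have J': "(-1) ^ ?J' = ((-1) ^ ?J * (-1) ^ \<pi> :: complex)"
    using assms by (simp add: par_sum_upd)
  have "twist r i (j(m := b)) = ((-1) ^ (?I + ?J')) ^ ?J'"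
    unfolding twist_def by (rule sgn_pow_swap)
  also have "(-1) ^ (?I + ?J') = ((-1) ^ (?I + ?J + \<pi>) :: complex)"
    by (simp add: power_add J')
  also have "((-1) ^ (?I + ?J + \<pi>)) ^ ?J' = ((-1) ^ ?J * (-1) ^ \<pi> :: complex) ^ (?I + ?J + \<pi>)"
    unfolding J' [symmetric] by (rule sgn_pow_swap)
  also have "\<dots> = ((-1) ^ ?J) ^ (?I + ?J) * ((-1) ^ ?J) ^ \<pi> * ((-1) ^ \<pi>) ^ (?I + ?J + \<pi>)"
    by (simp only: power_mult_distrib power_add mult_ac)
  also have "((-1) ^ \<pi>) ^ (?I + ?J + \<pi>) = (((-1) ^ (?I + ?J + \<pi>)) ^ \<pi> :: complex)"
    by (rule sgn_pow_swap)
  finally show ?thesis unfolding twist_def .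
qed

lemma par_sum_split: "m < r \<Longrightarrow> par_sum {..<r} j = par_sum {..<m} j + ipar (j m) + par_sum {m<..<r} j"
proof -
  assume "m < r"
  then have "{..<r} = insert m ({..<m} \<union> {m<..<r})" by auto
  moreover have "{..<m} \<inter> {m<..<r} = {}" by auto
  ultimately show ?thesis by (simp add: par_sum_def sum.union_disjoint)
qed

text \<open>For tuples inside the corner, the entries of the two products match the two sums in
  \<open>lookup_hom_act_pair_word\<close>, except for signs; the twist accounts for these. Outside
  the corner both products vanish.\<close>

lemma twisted_op_commute:
  assumes g: "q_killed n g" and "\<pi> < 2" and X: "q_homog n \<pi> X"
    and c: "c = (\<lambda>i j. coeff g (pair_word r r t s i j))"
  shows "twisted_op n r c * total_op n r \<pi> X = total_op n r \<pi> X * twisted_op n r c"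
proof (rule lop_eqI)
  fix v i
  let ?S = "midxs n r" and ?e = "\<lambda>m i. ((-1) ^ par_sum {m<..<r} i) ^ \<pi> :: complex"
  let ?f = "\<lambda>i j. twist r i j * c i j"
  have gl: "X \<in> gl n" and hom: "homog \<pi> X" using X by (auto simp: q_homog_def)
  have Xz: "X a b = 0" if "a \<notin> Idx n" for a b using gl that by (auto simp: gl_def)
  show "app (twisted_op n r c * total_op n r \<pi> X) v i = app (total_op n r \<pi> X * twisted_op n r c) v i"
  proof (cases "i \<in> ?S")
    case False
    have z: "X (i m) a * app (twisted_op n r c) v (i(m := a)) = 0" if "m < r" "a \<in> Idx n" for m a
      using False that midxs_upd_iff [of m r a n i] Xz [of "i m" a] by (cases "i m \<in> Idx n") (auto simp: app_twisted_op)
    have "app (total_op n r \<pi> X * twisted_op n r c) v i = (\<Sum>m<r. ?e m i * (\<Sum>a\<in>Idx n. X (i m) a * app (twisted_op n r c) v (i(m := a))))"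
      by (simp add: total_op_def app_pos)
    also have "\<dots> = (\<Sum>m<r. ?e m i * (\<Sum>a\<in>Idx n. 0))"
      by (intro sum.cong refl arg_cong [where f = "(*) _"] z) auto
    finally show ?thesis using False by (simp add: app_twisted_op)
  next
    case i: True
    have "app (total_op n r \<pi> X * twisted_op n r c) v i =
        (\<Sum>m<r. ?e m i * (\<Sum>a\<in>Idx n. X (i m) a * (\<Sum>j\<in>?S. ?f (i(m := a)) j * v j)))"
      using i by (simp add: total_op_def app_pos app_twisted_op midxs_upd)
    also have "\<dots> = (\<Sum>j\<in>?S. (\<Sum>m<r. ?e m i * (\<Sum>a\<in>Idx n. X (i m) a * ?f (i(m := a)) j)) * v j)"
      unfolding sum_distrib_left sum_distrib_right
      by (subst (2) sum.swap, subst sum.swap, rule sum.cong [OF refl]) (simp add: sum.swap [of _ "Idx n"] mult_ac)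
    finally have L: "app (total_op n r \<pi> X * twisted_op n r c) v i = \<dots>" .
    have "app (twisted_op n r c * total_op n r \<pi> X) v i =
        (\<Sum>k\<in>?S. ?f i k * (\<Sum>m<r. ?e m k * (\<Sum>a\<in>Idx n. X (k m) a * v (k(m := a)))))"
      using i by (simp add: total_op_def app_pos app_twisted_op)
    also have "\<dots> = (\<Sum>m<r. \<Sum>k\<in>?S. \<Sum>a\<in>Idx n. ?f i k * ?e m k * X (k m) a * v (k(m := a)))"
      unfolding sum_distrib_left by (subst sum.swap) (simp add: mult_ac)
    also have "\<dots> = (\<Sum>m<r. \<Sum>j\<in>?S. \<Sum>b\<in>Idx n. ?f i (j(m := b)) * ?e m j * X b (j m) * v j)"
    proof (rule sum.cong [OF refl])
      fix m assume "m \<in> {..<r}"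
      then have m: "m < r" by simp
      have e: "?e m (k(m := a)) = ?e m k" for k a by (simp add: par_sum_upd)
      \<comment> \<open>The substitution exchanges the entry at \<open>m\<close> with the summation
        index and is its own inverse.\<close>
      have "(\<Sum>z\<in>?S \<times> Idx n. ?f i (fst z) * ?e m (fst z) * X (fst z m) (snd z) * v ((fst z)(m := snd z))) =
          (\<Sum>z\<in>?S \<times> Idx n. ?f i ((fst z)(m := snd z)) * ?e m (fst z) * X (snd z) (fst z m) * v (fst z))"
        by (rule sum.reindex_bij_witness [of _ "\<lambda>z. ((fst z)(m := snd z), fst z m)" "\<lambda>z. ((fst z)(m := snd z), fst z m)"])
          (use m e in \<open>auto simp: midxs_upd midxs_iff\<close>)
      then show "(\<Sum>k\<in>?S. \<Sum>a\<in>Idx n. ?f i k * ?e m k * X (k m) a * v (k(m := a))) =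
          (\<Sum>j\<in>?S. \<Sum>b\<in>Idx n. ?f i (j(m := b)) * ?e m j * X b (j m) * v j)"
        by (simp add: sum.cartesian_product split_beta)
    qed
    also have "\<dots> = (\<Sum>j\<in>?S. (\<Sum>m<r. ?e m j * (\<Sum>b\<in>Idx n. X b (j m) * ?f i (j(m := b)))) * v j)"
      unfolding sum_distrib_left sum_distrib_right by (subst sum.swap) (simp add: mult_ac)
    finally have R: "app (twisted_op n r c * total_op n r \<pi> X) v i = \<dots>" .
    have "(\<Sum>m<r. ?e m i * (\<Sum>a\<in>Idx n. X (i m) a * ?f (i(m := a)) j)) =
        (\<Sum>m<r. ?e m j * (\<Sum>b\<in>Idx n. X b (j m) * ?f i (j(m := b))))" if j: "j \<in> ?S" for j
    proof -
      \<comment> \<open>Where the entry of \<open>X\<close> is nonzero, changing a letter of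
        \<open>i\<close> alters \<open>twist\<close> by the same sign at every position, so this
        factor comes out of the sums.\<close>
      let ?k = "twist r i j * ((-1) ^ par_sum {..<r} j) ^ \<pi>"
      have "(\<Sum>m<r. ?e m i * (\<Sum>a\<in>Idx n. X (i m) a * ?f (i(m := a)) j)) =
          ?k * (\<Sum>m<r. ?e m i * (\<Sum>a\<in>Idx n. X (i m) a * c (i(m := a)) j))"
        unfolding sum_distrib_left
      proof (intro sum.cong refl)
        fix m a assume "m \<in> {..<r}" "a \<in> Idx n"
        show "?e m i * (X (i m) a * (twist r (i(m := a)) j * c (i(m := a)) j)) =
            ?k * (?e m i * (X (i m) a * c (i(m := a)) j))"
        proof (cases "X (i m) a = 0")
          case False
          have "twist r (i(m := a)) j = ?k"
            using \<open>m \<in> {..<r}\<close> homog_sgn [OF hom False] by (simp add: twist_upd_left)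
          then show ?thesis by (simp add: mult_ac)
        qed simp
      qed
      also have "(\<Sum>m<r. ?e m i * (\<Sum>a\<in>Idx n. X (i m) a * c (i(m := a)) j)) =
         (\<Sum>m<r. ((-1) ^ (par_sum {..<r} i + par_sum {..<m} j)) ^ \<pi> * (\<Sum>b\<in>Idx n. ((-1) ^ ipar b) ^ \<pi> * X b (j m) * c i (j(m := b))))"
      proof -
        have "hom_act n \<pi> X g = 0" using g assms(2) X unfolding q_killed_def by blast
        then show ?thesis using lookup_hom_act_pair_word [OF gl, of \<pi> g r r t s i j] by (simp add: c)
      qed
      also have "?k * \<dots> = (\<Sum>m<r. ?e m j * (\<Sum>b\<in>Idx n. X b (j m) * ?f i (j(m := b))))"
        unfolding sum_distrib_left
      proof (intro sum.cong refl)
        fix m b assume "m \<in> {..<r}" "b \<in> Idx n"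
        then have m: "m < r" by simp
        show "?k * (((-1) ^ (par_sum {..<r} i + par_sum {..<m} j)) ^ \<pi> * (((-1) ^ ipar b) ^ \<pi> * X b (j m) * c i (j(m := b)))) =
            ?e m j * (X b (j m) * (twist r i (j(m := b)) * c i (j(m := b))))"
        proof (cases "X b (j m) = 0")
          case False
          have jm: "(-1) ^ ipar (j m) = ((-1) ^ \<pi> * (-1) ^ ipar b :: complex)" by (rule homog_sgn [OF hom False])
          \<comment> \<open>The dual action has the sign of everything to the left of the covector
            at \<open>m\<close>; the twist converts it into the sign of the entries of
            \<open>j\<close> above \<open>m\<close>, as in \<open>pos_op\<close>.\<close>
          have "((-1) ^ par_sum {m<..<r} j) * (-1) ^ (par_sum {..<r} i + par_sum {..<r} j + \<pi>) =
              ((-1) ^ (par_sum {..<r} i + par_sum {..<m} j) * (-1) ^ ipar b :: complex)"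
            by (simp add: par_sum_split [OF m, of j] power_add jm mult_ac)
          then have "?e m j * ((-1) ^ (par_sum {..<r} i + par_sum {..<r} j + \<pi>)) ^ \<pi> =
              (((-1) ^ (par_sum {..<r} i + par_sum {..<m} j)) ^ \<pi> * ((-1) ^ ipar b) ^ \<pi> :: complex)"
            by (metis power_mult_distrib)
          then show ?thesis unfolding twist_upd_right [where j = j and m = m and b = b, OF m jm]
            by (simp add: mult_ac)
        qed simp
      qed
      finally show ?thesis .
    qed
    then show ?thesis unfolding L R by (intro sum.cong refl) simp
  qed
qed

text \<open>In \<open>commutant_lspan\<close> the parity is an arbitrary natural number, while
  invariance is tested for 0 and 1; all signs depend on \<pi> only modulo 2.\<close>

lemma Top_commute':
  assumes g: "q_killed n g" and X: "q_homog n \<pi> X"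
    and c: "c = (\<lambda>i j. coeff g (pair_word r r t s i j))"
  shows "twisted_op n r c * total_op n r \<pi> X = total_op n r \<pi> X * twisted_op n r c"
proof -
  have s: "(-1) ^ (\<pi> mod 2) = ((-1) ^ \<pi> :: complex)" by (simp add: minus_one_power_iff)
  have "q_homog n (\<pi> mod 2) X" using X by (simp add: q_homog_def homog_def sharp_def s)
  moreover have "pos_op n r (\<pi> mod 2) X m = pos_op n r \<pi> X m" for m
    unfolding pos_op_def sgn_pow_swap [of _ "\<pi> mod 2"] s sgn_pow_swap [of \<pi>] ..
  then have "total_op n r (\<pi> mod 2) X = total_op n r \<pi> X" by (simp add: total_op_def)
  ultimately show ?thesis using twisted_op_commute [OF g _ _ c, of "\<pi> mod 2" X] by simp
qed

lemma group_tensor_linear: "group_tensor n r (x + y) t s = group_tensor n r x t s + group_tensor n r y t s"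
  "group_tensor n r (scal a * x) t s = tconst a * group_tensor n r x t s"
  by (simp_all add: group_tensor_def distrib_left distrib_right tconst_add sum.distrib sum_distrib_left tconst_fold mult_ac)

text \<open>The coefficients at words with fixed labels \<open>t\<close> and \<open>s\<close> form
  the matrix of a single operator, so the double commutant argument is applied to each labelling
  separately.\<close>

lemma class_gen_lift:
  assumes g: "q_killed n g" and t: "\<And>m. m < r \<Longrightarrow> t m \<in> {1..k}" and s: "\<And>m. m < r' \<Longrightarrow> s m \<in> {1..p}"
  shows "(\<Sum>i\<in>midxs n r. \<Sum>j\<in>midxs n r'. tconst (coeff g (pair_word r r' t s i j)) * tword (pair_word r r' t s i j))
    \<in> gen_lift n k p"
proof (cases "r = r'")
  case False
  then show ?thesis using unbalanced_zero [OF g] gen_lift_tconst [of 0] by simp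
next
  case True
  define c where "c = (\<lambda>i j. coeff g (pair_word r r t s i j))"
  have "twisted_op n r c \<in> lspan (sergeev_ops n r)"
    by (rule commutant_lspan [OF Top_commute' [OF g _ c_def] twisted_op_lspan])
  then have "group_tensor n r (twisted_op n r c) t s \<in> gen_lift n k p"
  proof (induction rule: lspan.induct)
    case zero
    then show ?case using gen_lift_tconst [of 0] by (simp add: group_tensor_def)
  next
    case (step x y a)
    then obtain h where h: "h \<in> sergeev r" "x = midx_proj n r * h" by (auto simp: sergeev_ops_def)
    have "group_tensor n r x t s = group_tensor n r h t s"
      unfolding group_tensor_def h(2) by (intro sum.cong refl) (simp add: app_midx_proj)
    moreover have "group_tensor n r h t s \<in> gen_lift n k p"
      using t s True by (intro group_tensor_sergeev h(1)) auto
    ultimately show ?case using step.IH by (simp add: group_tensor_linear gen_lift_add gen_lift_smult)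
  qed
  also have "group_tensor n r (twisted_op n r c) t s = (\<Sum>i\<in>midxs n r. \<Sum>j\<in>midxs n r. tconst (c i j) * tword (pair_word r r t s i j))"
    unfolding group_tensor_def
  proof (intro sum.cong refl)
    fix i j assume ij: "i \<in> midxs n r" "j \<in> midxs n r"
    have "(\<Sum>k\<in>midxs n r. twist r i k * c i k * delta j k) = (\<Sum>k\<in>midxs n r. if k = j then twist r i j * c i j else 0)"
      by (rule sum.cong) (auto simp: delta_def)
    then have "app (twisted_op n r c) (delta j) i = twist r i j * c i j"
      using ij by (simp add: app_twisted_op)
    then have "twist r i j * app (twisted_op n r c) (delta j) i = c i j"
      using ij by (simp add: twist_def)
    then show "tconst (twist r i j * app (twisted_op n r c) (delta j) i) * tword (pair_word r r t s i j) = tconst (c i j) * tword (pair_word r r t s i j)"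
      by simp
  qed
  finally show ?thesis using True by (simp add: c_def)
qed


section \<open>The first fundamental theorem\<close>

text \<open>Forgets the index of a letter, with \<open>Ev 0\<close> as placeholder; the fibres are
  the classes treated by \<open>class_gen_lift\<close>.\<close>

fun label :: "gen \<Rightarrow> gen" where
  "label (Vec t i) = Vec t (Ev 0)"
| "label (Dual i s) = Dual (Ev 0) s"

fun gidx :: "gen \<Rightarrow> idx" where
  "gidx (Vec t i) = i"
| "gidx (Dual i s) = i"

lemma label_eq: "label g = label (Vec t i) \<Longrightarrow> g = Vec t (gidx g)" "label g = label (Dual i s) \<Longrightarrow> g = Dual (gidx g) s"
  by (cases g; simp)+

lemma gidx_gens: "g \<in> gens n k p \<Longrightarrow> gidx g \<in> Idx n"
  by (auto simp: gens_def)

lemma pair_word_of_label: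
  assumes "map label w = map label (pair_word r r' t s i0 j0)" and w: "set w \<subseteq> gens n k p"
  shows "\<exists>i\<in>midxs n r. \<exists>j\<in>midxs n r'. w = pair_word r r' t s i j"
proof -
  let ?w = "pair_word r r' t s i0 j0"
  have len: "length w = r + r'" using arg_cong [OF assms(1), of length] by simp
  have lb: "label (w ! q) = label (?w ! q)" if "q < r + r'" for q
    using arg_cong [OF assms(1), of "\<lambda>l. l ! q"] that len by simp
  let ?i = "\<lambda>m. if m < r then gidx (w ! (r - Suc m)) else undefined"
  let ?j = "\<lambda>m. if m < r' then gidx (w ! (r + m)) else undefined"
  have "w = pair_word r r' t s ?i ?j"
  proof (rule pair_word_eqI [OF len])
    fix m assume m: "m < r"
    then show "w ! (r - Suc m) = Vec (t m) (?i m)"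
      using lb [of "r - Suc m"] label_eq(1) [of "w ! (r - Suc m)" "t m" "i0 m"] by (simp add: pair_word_nth_Vec)
  next
    fix m assume m: "m < r'"
    then show "w ! (r + m) = Dual (?j m) (s m)"
      using lb [of "r + m"] label_eq(2) [of "w ! (r + m)" "j0 m" "s m"] by (simp add: pair_word_nth_Dual)
  qed
  moreover have "w ! q \<in> gens n k p" if "q < r + r'" for q
    using w nth_mem [of q w] that len by auto
  then have "?i \<in> midxs n r" "?j \<in> midxs n r'"
    by (auto simp: midxs_iff intro!: gidx_gens [where k = k and p = p])
  ultimately show ?thesis by blast
qed

lemma ordered_append: "ordered w \<Longrightarrow> w = filter isvec w @ filter (\<lambda>g. \<not> isvec g) w"
proof (induction w)
  case (Cons x w)
  then have "ordered w" by (simp add: ordered_def)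
  show ?case
  proof (cases "isvec x")
    case True
    then show ?thesis using Cons.IH [OF \<open>ordered w\<close>] by simp
  next
    case False
    then have "\<forall>y\<in>set w. \<not> isvec y" using Cons.prems by (auto simp: ordered_def)
    then show ?thesis using False by simp
  qed
qed simp

fun glab :: "gen \<Rightarrow> nat" where
  "glab (Vec t i) = t"
| "glab (Dual i s) = s"

lemma ordered_pair_word:
  assumes "ordered w" "set w \<subseteq> gens n k p"
  shows "\<exists>r r' t s i j. w = pair_word r r' t s i j \<and> (\<forall>m<r. t m \<in> {1..k}) \<and> (\<forall>m<r'. s m \<in> {1..p})"
proof -
  let ?u = "filter isvec w" and ?v = "filter (\<lambda>g. \<not> isvec g) w"
  let ?r = "length ?u" and ?r' = "length ?v"
  have w: "w = ?u @ ?v" by (rule ordered_append [OF assms(1)])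
  have u: "?u ! q = Vec (glab (?u ! q)) (gidx (?u ! q)) \<and> glab (?u ! q) \<in> {1..k}" if "q < ?r" for q
  proof -
    have "isvec (?u ! q)" "?u ! q \<in> gens n k p" using nth_mem [OF that] assms(2) by auto
    then show ?thesis by (cases "?u ! q") (auto simp: gens_def)
  qed
  have v: "?v ! q = Dual (gidx (?v ! q)) (glab (?v ! q)) \<and> glab (?v ! q) \<in> {1..p}" if "q < ?r'" for q
  proof -
    have "\<not> isvec (?v ! q)" "?v ! q \<in> gens n k p" using nth_mem [OF that] assms(2) by auto
    then show ?thesis by (cases "?v ! q") (auto simp: gens_def)
  qed
  let ?t = "\<lambda>m. glab (?u ! (?r - Suc m))" and ?i = "\<lambda>m. gidx (?u ! (?r - Suc m))"
  let ?s = "\<lambda>m. glab (?v ! m)" and ?j = "\<lambda>m. gidx (?v ! m)"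
  have "?u @ ?v = pair_word ?r ?r' ?t ?s ?i ?j"
  proof (rule pair_word_eqI)
    fix m assume "m < ?r"
    then have "?r - Suc m < ?r" by simp
    then show "(?u @ ?v) ! (?r - Suc m) = Vec (?t m) (?i m)"
      using u [of "?r - Suc m"] by (metis nth_append)
  next
    fix m assume "m < ?r'"
    then show "(?u @ ?v) ! (?r + m) = Dual (?j m) (?s m)"
      using v [of m] by (metis nth_append_length_plus)
  qed simp
  moreover have "\<forall>m<?r. ?t m \<in> {1..k}"
  proof (intro allI impI)
    fix m assume "m < ?r"
    then have "?r - Suc m < ?r" by simp
    then show "?t m \<in> {1..k}" using u by blast
  qed
  moreover have "\<forall>m<?r'. ?s m \<in> {1..p}" using v by blast
  ultimately show ?thesis using w by metis
qed

lemma ordered_pair_word_word: "ordered (pair_word r r' t s i j)"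
proof -
  have "sorted_wrt (\<lambda>x y. isvec y \<longrightarrow> isvec x) (u @ v)" if "\<forall>x\<in>set u. isvec x" "\<forall>x\<in>set v. \<not> isvec x" for u v
  proof -
    have "sorted_wrt (\<lambda>x y. isvec y \<longrightarrow> isvec x) u" using that(1) by (induction u) auto
    moreover have "sorted_wrt (\<lambda>x y. isvec y \<longrightarrow> isvec x) v" using that(2) by (induction v) auto
    ultimately show ?thesis using that by (auto simp: sorted_wrt_append)
  qed
  then show ?thesis unfolding ordered_def pair_word_def by auto
qed

lemma counts_pair_word: "counts (pair_word r r' t s i j) = (r, r')"
  by (simp add: counts_def pair_word_def filter_map comp_def)

lemma pair_word_inj:
  assumes "pair_word r r' t s i j = pair_word r r' t s i' j'" "i \<in> midxs n r" "i' \<in> midxs n r" "j \<in> midxs n r'" "j' \<in> midxs n r'"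
  shows "i = i' \<and> j = j'"
proof (intro conjI ext)
  fix m
  have "m < r \<Longrightarrow> i m = i' m"
    using arg_cong [OF assms(1), of "\<lambda>l. l ! (r - Suc m)"] by (simp add: pair_word_nth_Vec)
  then show "i m = i' m" using assms(2,3) by (cases "m < r") (auto simp: midxs_iff)
  have "m < r' \<Longrightarrow> j m = j' m"
    using arg_cong [OF assms(1), of "\<lambda>l. l ! (r + m)"] by (simp add: pair_word_nth_Dual)
  then show "j m = j' m" using assms(4,5) by (cases "m < r'") (auto simp: midxs_iff)
qed

text \<open>The ordered words are grouped by their labels. Within a group \<open>fact2\<close> is
  constant, and the sum may be extended to all index tuples because words outside the support have
  coefficient 0.\<close>

lemma ordered_part_gen_lift:
  assumes g: "q_killed n g" and car: "g \<in> carrier (tensor_ring n k p)"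
  shows "lin_ext (\<lambda>w. if ordered w then tconst (1 / fact2 w) * tword w else 0) g \<in> gen_lift n k p"
proof -
  let ?W = "{w \<in> Poly_Mapping.keys g. ordered w}"
  let ?\<phi> = "\<lambda>w. tconst (1 / fact2 w) * (tconst (coeff g w) * tword w)"
  have "lin_ext (\<lambda>w. if ordered w then tconst (1 / fact2 w) * tword w else 0) g = (\<Sum>w\<in>?W. ?\<phi> w)"
    unfolding lin_ext_def
    by (intro sum.mono_neutral_cong_right) (auto simp: tconst_fold mult.commute)
  also have "\<dots> = (\<Sum>l\<in>map label ` ?W. \<Sum>w\<in>{w \<in> ?W. map label w = l}. ?\<phi> w)"
    by (rule sum.image_gen) simp
  also have "\<dots> \<in> gen_lift n k p"
  proof (rule gen_lift_sum)
    fix l assume "l \<in> map label ` ?W"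
    then obtain w0 where w0: "w0 \<in> Poly_Mapping.keys g" "ordered w0" "l = map label w0" by blast
    have gens: "set w \<subseteq> gens n k p" if "w \<in> Poly_Mapping.keys g" for w
      using car that by (auto simp: tensor_ring_def)
    obtain r r' t s i0 j0 where w0_eq: "w0 = pair_word r r' t s i0 j0" and
      t: "\<And>m. m < r \<Longrightarrow> t m \<in> {1..k}" and s: "\<And>m. m < r' \<Longrightarrow> s m \<in> {1..p}"
      using ordered_pair_word [OF w0(2) gens [OF w0(1)]] by blast
    let ?f = "\<lambda>z. pair_word r r' t s (fst z) (snd z)" and ?S = "midxs n r \<times> midxs n r'"
    have inj: "inj_on ?f ?S"
    proof (rule inj_onI)
      fix z z' assume "z \<in> ?S" "z' \<in> ?S" "?f z = ?f z'"
      then show "z = z'" using pair_word_inj [of r r' t s "fst z" "snd z" "fst z'" "snd z'" n] by (auto simp: prod_eq_iff)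
    qed
    have "(\<Sum>w\<in>{w \<in> ?W. map label w = l}. ?\<phi> w) = (\<Sum>w\<in>?f ` ?S. ?\<phi> w)"
    proof (rule sum.mono_neutral_left)
      show "{w \<in> ?W. map label w = l} \<subseteq> ?f ` ?S"
      proof
        fix w assume w: "w \<in> {w \<in> ?W. map label w = l}"
        then have "map label w = map label (pair_word r r' t s i0 j0)" using w0 w0_eq by simp
        moreover have "set w \<subseteq> gens n k p" using gens w by blast
        ultimately obtain i j where "i \<in> midxs n r" "j \<in> midxs n r'" "w = pair_word r r' t s i j"
          using pair_word_of_label by blast
        then show "w \<in> ?f ` ?S" by (intro image_eqI [of _ _ "(i, j)"]) auto
      qed
      show "\<forall>w\<in>?f ` ?S - {w \<in> ?W. map label w = l}. ?\<phi> w = 0"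
      proof
        fix w assume w: "w \<in> ?f ` ?S - {w \<in> ?W. map label w = l}"
        then obtain z where z: "w = ?f z" by blast
        have "map label w = l"
          unfolding w0(3) w0_eq z by (simp add: pair_word_def)
        moreover have "ordered w" unfolding z by (rule ordered_pair_word_word)
        ultimately have "w \<notin> Poly_Mapping.keys g" using w by blast
        then show "?\<phi> w = 0" by (simp add: in_keys_iff)
      qed
    qed (simp add: finite_cartesian_product)
    also have "\<dots> = (\<Sum>z\<in>?S. ?\<phi> (?f z))"
      by (simp add: sum.reindex [OF inj])
    also have "\<dots> = tconst (1 / (fact r * fact r')) * (\<Sum>i\<in>midxs n r. \<Sum>j\<in>midxs n r'.
        tconst (coeff g (pair_word r r' t s i j)) * tword (pair_word r r' t s i j))"
      by (simp add: sum.cartesian_product split_beta fact2_def counts_pair_word sum_distrib_left)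
    also have "\<dots> \<in> gen_lift n k p"
      by (intro gen_lift_smult class_gen_lift g t s)
    finally show "(\<Sum>w\<in>{w \<in> ?W. map label w = l}. ?\<phi> w) \<in> gen_lift n k p" .
  qed
  finally show ?thesis .
qed

lemma invariants_le_subalg: "q_invariants n k p \<subseteq> subalg n k p"
proof
  fix F assume F: "F \<in> q_invariants n k p"
  then have "F \<in> carrier (sym_alg n k p)" by (simp add: q_invariants_def)
  then obtain f where f: "f \<in> carrier (tensor_ring n k p)" "F = proj n k p f"
    using carrier_proj by blast
  have "q_killed n (supersym f)"
    unfolding q_killed_def
  proof (intro allI impI)
    fix \<pi> X assume X: "\<pi> < 2" "q_homog n \<pi> X"
    then have hom: "homog \<pi> X" and "X \<in> q_alg n" by (auto simp: q_homog_def intro: q_homog_q_alg)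
    then have "proj n k p (tensor_act n X f) = proj n k p 0"
      using F by (simp add: q_invariants_def f(2) sym_act_proj [OF f(1)] proj_zero)
    then have "hom_act n \<pi> X f \<in> super_ideal n k p"
      using f(1) by (simp add: proj_eq_iff tensor_act_carrier hom_act_carrier tensor_act_homog [OF hom X(1)])
    then show "hom_act n \<pi> X (supersym f) = 0"
      using hom_act_supersym [OF homog_mod_2 [OF hom X(1)] f(1)] supersym_super_ideal by simp
  qed
  then have "lin_ext (\<lambda>w. if ordered w then tconst (1 / fact2 w) * tword w else 0) (supersym f) \<in> gen_lift n k p"
    by (rule ordered_part_gen_lift) (rule supersym_carrier [OF f(1)])
  then have "f \<in> gen_lift n k p"
    by (rule gen_lift_cong) (rule supersym_reconstruct [OF f(1)])
  then show "F \<in> subalg n k p" by (simp add: gen_lift_def f(2))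
qed

theorem mainTheorem9:
  fixes n k p :: nat
  shows "generated_subalgebra n k p
      ({even_inner n k p t s | t s. t \<in> {1..k} \<and> s \<in> {1..p}} \<union>
       {odd_inner n k p t s | t s. t \<in> {1..k} \<and> s \<in> {1..p}})
    = q_invariants n k p"
  using subalg_le_invariants invariants_le_subalg
  unfolding inner_products_def by (rule equalityI)


end
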